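(* There exist absolute constants $C_0, C_1 > 0$ such that the following holds for all positive integers $n, m, t$ with $t \le m$ and $t \geq C_0 (\log \log m)^2$. Let $(V,\mathcal{S})$ be a random set system with $V=[n]$ and $\mathcal{S}=\{S_1,\ldots,S_m\}$, in which each element $i \in [n]$ lies in exactly $t$ sets, the $t$-tuple of sets containing $i$ being chosen uniformly at random among the $\binom{m}{t}$ possibilities, independently for different elements. Then the expected discrepancy satisfies $\mathbb{E}[\mathrm{disc}(\mathcal{S})] \le C_1 \sqrt{t}$.
   Context: For a set system $(V,\mathcal{S})$ with $V=[n]$, the discrepancy is $\mathrm{disc}(\mathcal{S}) = \min_{\chi: V \to \{-1,+1\}} \max_{S \in \mathcal{S}} \left|\sum_{i \in S} \chi(i)\right|$. The expectation is over the random choice of the set system. *)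

theory Defs
  imports "HOL-Probability.Probability"
begin

(* Meaningful for a finite ground set V and a finite nonempty system S of subsets of V:
   then Min and Max range over finite nonempty sets. *)
definition disc :: "'a set \<Rightarrow> 'a set set \<Rightarrow> int" where
  "disc V \<S> =
     Min ((\<lambda>col. Max ((\<lambda>S. \<bar>\<Sum>i\<in>S. col i\<bar>) ` \<S>)) ` (V \<rightarrow>\<^sub>E {-1, 1 :: int}))"

(* The independent uniform choices: T i is the set of indices j with i in S_j.
   The default value {} only concerns i outside {1..n}. For t > m there are no
   t-subsets of {1..m} and the distribution is not meaningful. *)
definition random_incidence :: "nat \<Rightarrow> nat \<Rightarrow> nat \<Rightarrow> (nat \<Rightarrow> nat set) pmf" where
  "random_incidence n m t =
     Pi_pmf {1..n} {} (\<lambda>_. pmf_of_set {J. J \<subseteq> {1..m} \<and> card J = t})"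

(* Coinciding S_j are identified, which does not affect the discrepancy. *)
definition random_set_system :: "nat \<Rightarrow> nat \<Rightarrow> nat \<Rightarrow> nat set set pmf" where
  "random_set_system n m t =
     map_pmf (\<lambda>T. (\<lambda>j. {i \<in> {1..n}. j \<in> T i}) ` {1..m}) (random_incidence n m t)"

(* The set system has finite support, so its expected discrepancy is a genuine
   expectation rather than the default value of a divergent integral. *)
lemma integrable_random_set_system:
  fixes f :: "nat set set \<Rightarrow> real"
  assumes "t \<le> m"
  shows "integrable (measure_pmf (random_set_system n m t)) f"
proof (rule integrable_measure_pmf_finite)
  have fin: "finite {J. J \<subseteq> {1..m} \<and> card J = t}"
    by (rule finite_subset[of _ "Pow {1..m}"]) auto
  have ne: "{J. J \<subseteq> {1..m} \<and> card J = t} \<noteq> {}"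
    using obtain_subset_with_card_n[of t "{1..m}"] assms by auto
  have "finite (set_pmf (random_incidence n m t))"
    unfolding random_incidence_def using fin ne
    by (subst set_Pi_pmf) (auto intro!: finite_PiE_dflt)
  then show "finite (set_pmf (random_set_system n m t))"
    by (simp add: random_set_system_def)
qed

end

theory Submission
  imports Defs
begin

text \<open>
  Call a set system well spread if, for every set \<open>A\<close> of at most \<open>m\<close> elements, few sets contain many
  more elements of \<open>A\<close> than the average \<open>t |A| / m\<close>. In a well spread system every such \<open>A\<close> has
  discrepancy \<open>O(sqrt t)\<close>: as long as at least \<open>m / sqrt t\<close> elements are left, partial colouring costs
  \<open>O(sqrt t (|A| / m) powr (1/6))\<close> per round, which sums geometrically; afterwards the Beck--Fiala
  argument finishes with error \<open>O(sqrt t)\<close>. Since this bound is hereditary and linear algebra leaves at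
  most \<open>m\<close> fractional elements, every fractional colouring can be rounded with error \<open>O(sqrt t)\<close>.

  A union bound over \<open>A\<close> shows that \<open>N\<close> random elements are well spread with probability
  \<open>1 - O(1 / sqrt t)\<close> provided \<open>ln (N / m) \<le> sqrt t\<close>; for \<open>N\<close> of order \<open>m t\<^sup>2 ln m\<close> this is the
  hypothesis on \<open>ln (ln m)\<close>. If there are more than \<open>N\<close> elements, the surplus is coloured first, by
  Beck--Fiala, with imbalance \<open>b\<close> bounded by \<open>2 t\<close>. As \<open>b\<close> is independent of the first \<open>N\<close> elements,
  giving element \<open>i\<close> the fractional colour \<open>- g (T i)\<close>, for a suitable linear functional \<open>g\<close>,
  cancels \<open>b\<close> in mean, and by concentration up to \<open>sqrt t\<close>. The failure
  probability \<open>O(1 / sqrt t)\<close> is harmless because the discrepancy never exceeds \<open>2 t\<close>.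
\<close>

section \<open>Rounding fractional colourings\<close>

text \<open>Two requirements pull \<open>N\<close> in opposite directions. In the union bound,
  choosing \<open>A\<close> among \<open>N\<close> elements costs about
  \<open>ln (N / m) + ln (m / card A)\<close> in the exponent per element of \<open>A\<close>, while
  excess incidences have an exponent of order \<open>sqrt t\<close> per element. So
  \<open>ln (N / m)\<close> must stay below \<open>sqrt t\<close>, and the unbounded
  \<open>n\<close> cannot serve as \<open>N\<close>. From below, cancelling an imbalance of order
  \<open>t\<close> takes fractional colours of size O(t m / N), each seen by a given row with
  probability \<open>t / m\<close>. A row sum then has variance O(t^3 m / N), and keeping all
  \<open>m\<close> rows within \<open>sqrt t\<close> of their means needs \<open>N\<close> of order
  m t^2 ln m. Thus \<open>ln (N / m)\<close> is about \<open>2 * ln t + ln (ln m)\<close>, the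
  origin of the double logarithm. Independent signs could not do the cancelling: they fluctuate by
  the square root of the row size, of order t^3 ln m here. This is why a rounding theorem for
  arbitrary fractional colourings is proved rather than a mere discrepancy bound.\<close>

lemma homogeneous_system_nontrivial_solution:
  fixes f :: "'j \<Rightarrow> 'i \<Rightarrow> real"
  assumes "finite Q" "finite A" "card Q < card A"
  shows "\<exists>y. (\<exists>i\<in>A. y i \<noteq> 0) \<and> (\<forall>j\<in>Q. (\<Sum>i\<in>A. f j i * y i) = 0)"
  using assms
proof (induction Q arbitrary: A f rule: finite_induct)
  case empty
  then show ?case by (intro exI[of _ "\<lambda>_. 1"]) (auto simp: card_gt_0_iff)
next
  case (insert q Q)
  show ?case
  proof (cases "\<forall>i\<in>A. f q i = 0")
    case True
    obtain y where "\<exists>i\<in>A. y i \<noteq> 0" "\<forall>j\<in>Q. (\<Sum>i\<in>A. f j i * y i) = 0"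
      using insert.IH[of A f] insert.prems insert.hyps by auto
    then show ?thesis using True by (intro exI[of _ y]) auto
  next
    case False
    then obtain p where p: "p \<in> A" "f q p \<noteq> 0" by auto
    define A' where "A' = A - {p}"
    have A: "A = insert p A'" "p \<notin> A'" "finite A'" using p insert.prems by (auto simp: A'_def)
    have "card Q < card A'" using insert.prems insert.hyps A by simp
    then obtain y where y: "\<exists>i\<in>A'. y i \<noteq> 0"
      "\<forall>j\<in>Q. (\<Sum>i\<in>A'. (f j i - f j p * f q i / f q p) * y i) = 0"
      using insert.IH[of A' "\<lambda>j i. f j i - f j p * f q i / f q p"] A by auto
    define s where "s = (\<Sum>i\<in>A'. f q i * y i)"
    \<comment> \<open>Gaussian elimination: the coefficients passed to the induction hypothesis are
      those left after eliminating the pivot \<open>p\<close>, whose value is now solved from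
      equation \<open>q\<close>.\<close>
    define z where "z = y(p := - s / f q p)"
    have sum_z: "(\<Sum>i\<in>A. f j i * z i) = (\<Sum>i\<in>A'. f j i * y i) - f j p * s / f q p" for j
    proof -
      have "(\<Sum>i\<in>A'. f j i * z i) = (\<Sum>i\<in>A'. f j i * y i)"
        using A by (intro sum.cong) (auto simp: z_def)
      then show ?thesis using A by (simp add: z_def)
    qed
    have "(\<Sum>i\<in>A. f q i * z i) = 0" using p by (simp add: sum_z s_def)
    moreover have "(\<Sum>i\<in>A. f j i * z i) = 0" if "j \<in> Q" for j
    proof -
      have "0 = (\<Sum>i\<in>A'. (f j i - f j p * f q i / f q p) * y i)" using y that by simp
      also have "\<dots> = (\<Sum>i\<in>A'. f j i * y i - f j p / f q p * (f q i * y i))"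
        by (intro sum.cong) (auto simp: algebra_simps)
      also have "\<dots> = (\<Sum>i\<in>A'. f j i * y i) - f j p * s / f q p"
        by (simp add: sum_subtractf s_def sum_distrib_left sum_divide_distrib)
      finally show ?thesis by (simp add: sum_z)
    qed
    moreover have "\<exists>i\<in>A. z i \<noteq> 0" using y(1) A by (auto simp: z_def)
    ultimately show ?thesis by (intro exI[of _ z]) auto
  qed
qed

text \<open>Fewer equations than fractional coordinates leave a kernel vector supported on the
  latter. Moving along it keeps the protected sums, and the motion stops when the first coordinate
  reaches the boundary of the cube.\<close>

lemma freeze_step:
  fixes x :: "'i \<Rightarrow> real" and S :: "'j \<Rightarrow> 'i set"
  assumes V: "finite V" and x: "\<forall>i\<in>V. \<bar>x i\<bar> \<le> 1" and Q: "finite Q" "card Q < card {i\<in>V. \<bar>x i\<bar> < 1}"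
  shows "\<exists>x'. (\<forall>i\<in>V. \<bar>x' i\<bar> \<le> 1) \<and> (\<forall>i. \<not> (i \<in> V \<and> \<bar>x i\<bar> < 1) \<longrightarrow> x' i = x i) \<and>
     (\<forall>j\<in>Q. (\<Sum>i\<in>V \<inter> S j. x' i) = (\<Sum>i\<in>V \<inter> S j. x i)) \<and>
     {i\<in>V. \<bar>x' i\<bar> < 1} \<subset> {i\<in>V. \<bar>x i\<bar> < 1}"
proof -
  define A where "A = {i\<in>V. \<bar>x i\<bar> < 1}"
  have A: "finite A" "A \<subseteq> V" using V by (auto simp: A_def)
  obtain y where y: "\<exists>i\<in>A. y i \<noteq> 0" "\<forall>j\<in>Q. (\<Sum>i\<in>A. of_bool (i \<in> S j) * y i) = (0::real)"
    using homogeneous_system_nontrivial_solution[of Q A "\<lambda>j i. of_bool (i \<in> S j)"] Q A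
    by (auto simp: A_def)
  define B where "B = {i\<in>A. y i \<noteq> 0}"
  have B: "finite B" "B \<noteq> {}" using A y by (auto simp: B_def)
  \<comment> \<open>The time at which coordinate \<open>i\<close>, moving with speed
    \<open>y i\<close>, arrives at \<open>sgn (y i)\<close>, the only side on which it can leave the
    cube.\<close>
  define d where "d i = (1 - sgn (y i) * x i) / \<bar>y i\<bar>" for i
  define s where "s = Min (d ` B)"
  have "s \<in> d ` B" unfolding s_def using B by (intro Min_in) auto
  then obtain p where p: "p \<in> B" "s = d p" by auto
  have s_le: "s \<le> d i" if "i \<in> B" for i unfolding s_def using B that by (intro Min_le) auto
  have d_pos: "d i > 0" if "i \<in> B" for i
  proof -
    have "\<bar>sgn (y i) * x i\<bar> < 1" using that by (auto simp: B_def A_def abs_mult abs_sgn_eq)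
    then show ?thesis using that by (auto simp: d_def B_def)
  qed
  have s_pos: "s > 0" using p d_pos by simp
  define x' where "x' i = (if i \<in> A then x i + s * y i else x i)" for i
  have bound: "\<bar>x' i\<bar> \<le> 1" if "i \<in> A" for i
  proof (cases "y i = 0")
    case True
    then show ?thesis using that by (auto simp: x'_def A_def)
  next
    case False
    then have "s * \<bar>y i\<bar> \<le> 1 - sgn (y i) * x i"
      using s_le[of i] that by (simp add: d_def B_def pos_le_divide_eq)
    moreover have "s * \<bar>y i\<bar> > 0" using False s_pos by simp
    ultimately show ?thesis using that False
      by (cases "y i > 0") (auto simp: x'_def A_def abs_if sgn_if)
  qed
  have "\<bar>x' p\<bar> = 1"
  proof -
    have "s * \<bar>y p\<bar> = 1 - sgn (y p) * x p" using p by (simp add: d_def B_def)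
    then show ?thesis using p by (cases "y p > 0") (auto simp: x'_def B_def abs_if sgn_if)
  qed
  moreover have "p \<in> A" using p by (simp add: B_def)
  ultimately have "p \<in> A" "p \<notin> {i\<in>V. \<bar>x' i\<bar> < 1}" by auto
  moreover have "{i\<in>V. \<bar>x' i\<bar> < 1} \<subseteq> A" by (auto simp: A_def x'_def split: if_splits)
  ultimately have "{i\<in>V. \<bar>x' i\<bar> < 1} \<subset> A" by blast
  moreover have "(\<Sum>i\<in>V \<inter> S j. x' i) = (\<Sum>i\<in>V \<inter> S j. x i)" if "j \<in> Q" for j
  proof -
    have "(\<Sum>i\<in>V \<inter> S j. x' i) = (\<Sum>i\<in>V \<inter> S j. x i + (if i \<in> A then s * y i else 0))"
      by (intro sum.cong) (auto simp: x'_def)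
    also have "\<dots> = (\<Sum>i\<in>V \<inter> S j. x i) + (\<Sum>i\<in>V \<inter> S j \<inter> A. s * y i)"
      using V by (simp add: sum.distrib sum.inter_restrict)
    also have "V \<inter> S j \<inter> A = A \<inter> {i. i \<in> S j}" using A by auto
    also have "(\<Sum>i\<in>A \<inter> {i. i \<in> S j}. s * y i) = s * (\<Sum>i\<in>A. of_bool (i \<in> S j) * y i)"
      using A by (simp add: sum_distrib_left)
    finally show ?thesis using y that by simp
  qed
  moreover have "\<forall>i\<in>V. \<bar>x' i\<bar> \<le> 1" using bound x by (auto simp: x'_def)
  moreover have "\<forall>i. \<not> (i \<in> V \<and> \<bar>x i\<bar> < 1) \<longrightarrow> x' i = x i" by (auto simp: x'_def A_def)
  ultimately show ?thesis unfolding A_def[symmetric] by blast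
qed

text \<open>Freezing with all of \<open>J\<close> protected costs no error at all and brings the
  number of fractional elements down to \<open>card J\<close>, the range in which
  \<open>well_spread\<close> gives information.\<close>

lemma few_fractional:
  fixes x :: "'i \<Rightarrow> real" and S :: "'j \<Rightarrow> 'i set"
  assumes V: "finite V" and J: "finite J" and x: "\<forall>i\<in>V. \<bar>x i\<bar> \<le> 1"
  shows "\<exists>x'. (\<forall>i\<in>V. \<bar>x' i\<bar> \<le> 1) \<and> (\<forall>j\<in>J. (\<Sum>i\<in>V \<inter> S j. x' i) = (\<Sum>i\<in>V \<inter> S j. x i)) \<and>
     card {i\<in>V. \<bar>x' i\<bar> < 1} \<le> card J"
  using x
proof (induction "card {i\<in>V. \<bar>x i\<bar> < 1}" arbitrary: x rule: less_induct)
  case less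
  show ?case
  proof (cases "card {i\<in>V. \<bar>x i\<bar> < 1} \<le> card J")
    case True
    then show ?thesis using less.prems by blast
  next
    case False
    then obtain z where z: "\<forall>i\<in>V. \<bar>z i\<bar> \<le> 1" "\<forall>j\<in>J. (\<Sum>i\<in>V \<inter> S j. z i) = (\<Sum>i\<in>V \<inter> S j. x i)"
      "{i\<in>V. \<bar>z i\<bar> < 1} \<subset> {i\<in>V. \<bar>x i\<bar> < 1}"
      using freeze_step[OF V less.prems J, of S] by auto
    have "card {i\<in>V. \<bar>z i\<bar> < 1} < card {i\<in>V. \<bar>x i\<bar> < 1}"
      using z(3) V by (intro psubset_card_mono) auto
    from less.hyps[OF this z(1)] z(2) show ?thesis by auto
  qed
qed

text \<open>A row is protected while it has more than \<open>K\<close> fractional elements;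
  \<open>few\<close> says that there are always fewer such rows than fractional elements. The
  threshold is kept abstract because it is \<open>t\<close> in the classical bound and
  \<open>12 * sqrt t\<close> for small sets of a well spread system.\<close>

lemma beck_fiala_rounding:
  fixes x :: "'i \<Rightarrow> real" and S :: "'j \<Rightarrow> 'i set" and K :: real
  assumes V: "finite V" and J: "finite J" and K: "K \<ge> 0"
    and few: "\<And>A. A \<subseteq> V \<Longrightarrow> A \<noteq> {} \<Longrightarrow> card {j\<in>J. real (card (A \<inter> S j)) > K} < card A"
    and x: "\<forall>i\<in>V. \<bar>x i\<bar> \<le> 1"
  shows "\<exists>\<sigma>. (\<forall>i\<in>V. \<sigma> i \<in> {-1, 1}) \<and> (\<forall>i. \<not> (i \<in> V \<and> \<bar>x i\<bar> < 1) \<longrightarrow> \<sigma> i = x i) \<and>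
     (\<forall>j\<in>J. \<bar>\<Sum>i\<in>V \<inter> S j. \<sigma> i - x i\<bar> \<le> 2 * K)"
  using x
proof (induction "card {i\<in>V. \<bar>x i\<bar> < 1}" arbitrary: x rule: less_induct)
  case less
  define A where "A = {i\<in>V. \<bar>x i\<bar> < 1}"
  have A: "finite A" "A \<subseteq> V" using V by (auto simp: A_def)
  show ?case
  proof (cases "A = {}")
    case True
    have "x i \<in> {-1, 1}" if "i \<in> V" for i
      using True less.prems that by (force simp: A_def abs_if split: if_splits)
    then show ?thesis using K by (intro exI[of _ x]) auto
  next
    case False
    define Q where "Q = {j\<in>J. real (card (A \<inter> S j)) > K}"
    have "finite Q" "card Q < card A" using few[OF A(2) False] J by (auto simp: Q_def)
    then obtain z where z: "\<forall>i\<in>V. \<bar>z i\<bar> \<le> 1" "\<forall>i. \<not> (i \<in> V \<and> \<bar>x i\<bar> < 1) \<longrightarrow> z i = x i"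
      "\<forall>j\<in>Q. (\<Sum>i\<in>V \<inter> S j. z i) = (\<Sum>i\<in>V \<inter> S j. x i)"
      "{i\<in>V. \<bar>z i\<bar> < 1} \<subset> {i\<in>V. \<bar>x i\<bar> < 1}"
      using freeze_step[OF V less.prems, of Q S] by (auto simp: A_def)
    have "card {i\<in>V. \<bar>z i\<bar> < 1} < card {i\<in>V. \<bar>x i\<bar> < 1}"
      using z(4) V by (intro psubset_card_mono) auto
    from less.hyps[OF this z(1)] obtain \<sigma> where
      \<sigma>: "\<forall>i\<in>V. \<sigma> i \<in> {-1, 1}" "\<forall>i. \<not> (i \<in> V \<and> \<bar>z i\<bar> < 1) \<longrightarrow> \<sigma> i = z i"
        "\<forall>j\<in>J. \<bar>\<Sum>i\<in>V \<inter> S j. \<sigma> i - z i\<bar> \<le> 2 * K" by blast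
    have fixed: "\<sigma> i = x i" if "\<not> (i \<in> V \<and> \<bar>x i\<bar> < 1)" for i
    proof -
      have "\<not> (i \<in> V \<and> \<bar>z i\<bar> < 1)" using z(4) that by blast
      then show ?thesis using \<sigma>(2) z(2) that by auto
    qed
    have "\<bar>\<Sum>i\<in>V \<inter> S j. \<sigma> i - x i\<bar> \<le> 2 * K" if j: "j \<in> J" for j
    proof (cases "j \<in> Q")
      case True
      then have "(\<Sum>i\<in>V \<inter> S j. z i) = (\<Sum>i\<in>V \<inter> S j. x i)" using z(3) by blast
      then show ?thesis using bspec[OF \<sigma>(3) j] by (simp add: sum_subtractf)
    next
      case False
      \<comment> \<open>An unprotected row is bounded at once, without the induction hypothesis:
        from here on only its at most \<open>K\<close> fractional elements can change, each by at
        most 2.\<close>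
      have "(\<Sum>i\<in>V \<inter> S j. \<sigma> i - x i) = (\<Sum>i\<in>A \<inter> S j. \<sigma> i - x i)"
        using V A fixed by (intro sum.mono_neutral_right) (auto simp: A_def)
      also have "\<bar>\<dots>\<bar> \<le> (\<Sum>i\<in>A \<inter> S j. 2)"
      proof (intro order.trans[OF sum_abs] sum_mono)
        fix i assume "i \<in> A \<inter> S j"
        then have "\<sigma> i \<in> {-1, 1}" "\<bar>x i\<bar> < 1" using \<sigma>(1) A by (auto simp: A_def)
        then show "\<bar>\<sigma> i - x i\<bar> \<le> 2" by auto
      qed
      also have "\<dots> \<le> 2 * K" using False j by (simp add: Q_def)
      finally show ?thesis .
    qed
    then show ?thesis using \<sigma>(1) fixed by blast
  qed
qed

text \<open>The bits of a dyadic fractional colouring are rounded off one after the other, starting with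
  the least significant one; the errors then form a geometric series.\<close>

lemma hereditary_rounding_dyadic:
  fixes S :: "'j \<Rightarrow> 'i set" and c :: "'i \<Rightarrow> int" and D :: real
  assumes V: "finite V" and D: "D \<ge> 0"
    and hered: "\<And>B. B \<subseteq> V \<Longrightarrow> \<exists>\<sigma>::'i \<Rightarrow> int. (\<forall>i\<in>B. \<sigma> i \<in> {-1, 1}) \<and> (\<forall>j\<in>J. \<bar>\<Sum>i\<in>B \<inter> S j. real_of_int (\<sigma> i)\<bar> \<le> D)"
    and c: "\<forall>i\<in>V. 0 \<le> c i \<and> c i \<le> 2 ^ k"
  shows "\<exists>d::'i \<Rightarrow> int. (\<forall>i\<in>V. d i \<in> {0, 1}) \<and>
     (\<forall>j\<in>J. \<bar>\<Sum>i\<in>V \<inter> S j. of_int (d i) - of_int (c i) / 2 ^ k\<bar> \<le> D * (1 - 1 / 2 ^ k))"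
  using c
proof (induction k arbitrary: c)
  case 0
  then have "\<forall>i\<in>V. c i \<in> {0, 1}" by force
  then show ?case using D by (intro exI[of _ c]) auto
next
  case (Suc k)
  define B where "B = {i\<in>V. odd (c i)}"
  obtain \<sigma> :: "'i \<Rightarrow> int" where \<sigma>: "\<forall>i\<in>B. \<sigma> i \<in> {-1, 1}" "\<forall>j\<in>J. \<bar>\<Sum>i\<in>B \<inter> S j. real_of_int (\<sigma> i)\<bar> \<le> D"
    using hered[of B] by (auto simp: B_def)
  \<comment> \<open>Adding a sign to every odd numerator makes all numerators even, so one bit is
    dropped at cost \<open>D / 2 ^ Suc k\<close>. The range survives because its end points are
    even, hence never among the modified values.\<close>
  define c' where "c' i = (if i \<in> B then (c i + \<sigma> i) div 2 else c i div 2)" for i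
  have c'2: "2 * c' i = c i + (if i \<in> B then \<sigma> i else 0)" if "i \<in> V" for i
  proof -
    have "even (c i + \<sigma> i)" if "i \<in> B" using \<sigma>(1) that by (force simp: B_def)
    then show ?thesis using that by (auto simp: c'_def B_def)
  qed
  have "\<forall>i\<in>V. 0 \<le> c' i \<and> c' i \<le> 2 ^ k"
  proof
    fix i assume i: "i \<in> V"
    have "0 \<le> c i" "c i \<le> 2 * 2 ^ k" using Suc.prems i by auto
    moreover have "c i \<noteq> 0" "c i \<noteq> 2 * 2 ^ k" if "i \<in> B" using that by (auto simp: B_def)
    moreover have "i \<in> B \<longrightarrow> \<sigma> i \<in> {-1, 1}" using \<sigma> by auto
    ultimately show "0 \<le> c' i \<and> c' i \<le> 2 ^ k" using c'2[OF i] by (auto split: if_splits)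
  qed
  from Suc.IH[OF this] obtain d :: "'i \<Rightarrow> int" where d: "\<forall>i\<in>V. d i \<in> {0, 1}"
    "\<forall>j\<in>J. \<bar>\<Sum>i\<in>V \<inter> S j. of_int (d i) - of_int (c' i) / 2 ^ k\<bar> \<le> D * (1 - 1 / 2 ^ k)" by blast
  have "\<bar>\<Sum>i\<in>V \<inter> S j. of_int (d i) - of_int (c i) / 2 ^ Suc k\<bar> \<le> D * (1 - 1 / 2 ^ Suc k)" if j: "j \<in> J" for j
  proof -
    have "(\<Sum>i\<in>V \<inter> S j. of_int (d i) - of_int (c i) / 2 ^ Suc k :: real) =
      (\<Sum>i\<in>V \<inter> S j. (of_int (d i) - of_int (c' i) / 2 ^ k) + (if i \<in> B then of_int (\<sigma> i) / 2 ^ Suc k else 0))"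
    proof (rule sum.cong)
      fix i assume "i \<in> V \<inter> S j"
      then have "real_of_int (c i) = 2 * of_int (c' i) - (if i \<in> B then of_int (\<sigma> i) else 0)"
        using c'2[of i] by auto
      then show "of_int (d i) - of_int (c i) / 2 ^ Suc k =
         (of_int (d i) - real_of_int (c' i) / 2 ^ k) + (if i \<in> B then of_int (\<sigma> i) / 2 ^ Suc k else 0)"
        by (simp add: diff_divide_distrib)
    qed simp
    also have "\<dots> = (\<Sum>i\<in>V \<inter> S j. of_int (d i) - of_int (c' i) / 2 ^ k) + (\<Sum>i\<in>V \<inter> S j \<inter> B. of_int (\<sigma> i)) / 2 ^ Suc k"
      using V by (simp add: sum.distrib sum.inter_restrict sum_divide_distrib) (intro sum.cong, auto)
    also have "V \<inter> S j \<inter> B = B \<inter> S j" by (auto simp: B_def)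
    also have "\<bar>(\<Sum>i\<in>V \<inter> S j. of_int (d i) - of_int (c' i) / 2 ^ k) + (\<Sum>i\<in>B \<inter> S j. real_of_int (\<sigma> i)) / 2 ^ Suc k\<bar>
      \<le> D * (1 - 1 / 2 ^ k) + D / 2 ^ Suc k"
    proof (rule order.trans[OF abs_triangle_ineq add_mono])
      show "\<bar>(\<Sum>i\<in>B \<inter> S j. real_of_int (\<sigma> i)) / 2 ^ Suc k\<bar> \<le> D / 2 ^ Suc k"
        using \<sigma>(2) j by (simp add: abs_divide divide_right_mono)
    qed (use d j in auto)
    also have "\<dots> = D * (1 - 1 / 2 ^ Suc k)" by (simp add: field_simps)
    finally show ?thesis .
  qed
  then show ?case using d(1) by blast
qed

text \<open>Colours are mapped from [-1, 1] to [0, 1] and truncated to \<open>k\<close> bits, with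
  \<open>k\<close> so large that all truncation errors of a row sum to at most 1/2. Mapping back
  doubles both this error and the dyadic one, whence \<open>2 * D + 1\<close>.\<close>

lemma hereditary_rounding:
  fixes S :: "'j \<Rightarrow> 'i set" and x :: "'i \<Rightarrow> real" and D :: real
  assumes V: "finite V" and D: "D \<ge> 0"
    and hered: "\<And>B. B \<subseteq> V \<Longrightarrow> \<exists>\<sigma>::'i \<Rightarrow> int. (\<forall>i\<in>B. \<sigma> i \<in> {-1, 1}) \<and> (\<forall>j\<in>J. \<bar>\<Sum>i\<in>B \<inter> S j. real_of_int (\<sigma> i)\<bar> \<le> D)"
    and x: "\<forall>i\<in>V. \<bar>x i\<bar> \<le> 1"
  shows "\<exists>\<sigma>::'i \<Rightarrow> int. (\<forall>i\<in>V. \<sigma> i \<in> {-1, 1}) \<and> (\<forall>j\<in>J. \<bar>\<Sum>i\<in>V \<inter> S j. real_of_int (\<sigma> i) - x i\<bar> \<le> 2 * D + 1)"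
proof -
  obtain k where k: "2 * real (card V) < 2 ^ k" using real_arch_pow[of 2] by force
  define u where "u i = (x i + 1) / 2" for i
  define c where "c i = \<lfloor>u i * 2 ^ k\<rfloor>" for i
  have c: "\<forall>i\<in>V. 0 \<le> c i \<and> c i \<le> 2 ^ k"
  proof
    fix i assume "i \<in> V"
    then have "0 \<le> u i" "u i \<le> 1" using x by (auto simp: u_def abs_le_iff)
    then have "0 \<le> u i * 2 ^ k" "u i * 2 ^ k \<le> of_int (2 ^ k)" by (auto simp: mult_left_le_one_le)
    then show "0 \<le> c i \<and> c i \<le> 2 ^ k" unfolding c_def
      by (metis floor_mono floor_of_int zero_le_floor)
  qed
  obtain d :: "'i \<Rightarrow> int" where d: "\<forall>i\<in>V. d i \<in> {0, 1}"
    "\<forall>j\<in>J. \<bar>\<Sum>i\<in>V \<inter> S j. of_int (d i) - of_int (c i) / 2 ^ k\<bar> \<le> D * (1 - 1 / 2 ^ k)"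
    using hereditary_rounding_dyadic[OF V D hered c] by blast
  have trunc: "\<bar>of_int (c i) / 2 ^ k - u i\<bar> \<le> 1 / 2 ^ k" for i
  proof -
    have "of_int (c i) \<le> u i * 2 ^ k" "u i * 2 ^ k \<le> of_int (c i) + 1" unfolding c_def by linarith+
    then have "\<bar>of_int (c i) - u i * 2 ^ k\<bar> / 2 ^ k \<le> 1 / 2 ^ k" by (intro divide_right_mono) auto
    moreover have "of_int (c i) / 2 ^ k - u i = (of_int (c i) - u i * 2 ^ k) / 2 ^ k" by (simp add: diff_divide_distrib)
    ultimately show ?thesis by (simp add: abs_divide)
  qed
  have "\<bar>\<Sum>i\<in>V \<inter> S j. real_of_int (2 * d i - 1) - x i\<bar> \<le> 2 * D + 1" if j: "j \<in> J" for j
  proof -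
    have "(\<Sum>i\<in>V \<inter> S j. real_of_int (2 * d i - 1) - x i) =
       (\<Sum>i\<in>V \<inter> S j. 2 * (of_int (d i) - of_int (c i) / 2 ^ k) + 2 * (of_int (c i) / 2 ^ k - u i))"
      by (intro sum.cong) (auto simp: u_def field_simps)
    also have "\<dots> = 2 * (\<Sum>i\<in>V \<inter> S j. of_int (d i) - of_int (c i) / 2 ^ k)
        + 2 * (\<Sum>i\<in>V \<inter> S j. of_int (c i) / 2 ^ k - u i)"
      by (simp only: sum.distrib sum_distrib_left)
    finally have eq: "(\<Sum>i\<in>V \<inter> S j. real_of_int (2 * d i - 1) - x i) = \<dots>" .
    have "\<bar>\<Sum>i\<in>V \<inter> S j. of_int (c i) / 2 ^ k - u i\<bar> \<le> (\<Sum>i\<in>V \<inter> S j. 1 / 2 ^ k)"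
      by (intro order.trans[OF sum_abs] sum_mono trunc)
    also have "\<dots> \<le> real (card V) / 2 ^ k"
      using V by (simp add: divide_right_mono card_mono)
    also have "\<dots> \<le> 1 / 2" using k by (simp add: field_simps)
    finally have 1: "\<bar>\<Sum>i\<in>V \<inter> S j. of_int (c i) / 2 ^ k - u i\<bar> \<le> 1 / 2" .
    have "D * (1 - 1 / 2 ^ k) \<le> D" using D by (simp add: mult_left_le)
    then have 2: "\<bar>\<Sum>i\<in>V \<inter> S j. of_int (d i) - of_int (c i) / 2 ^ k\<bar> \<le> D" using d j by force
    show ?thesis unfolding eq using 1 2 by linarith
  qed
  then show ?thesis using d(1) by (intro exI[of _ "\<lambda>i. 2 * d i - 1"]) auto
qed

section \<open>Partial colouring\<close>

lemma sum_colourings_insert: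
  fixes f :: "('i \<Rightarrow> int) \<Rightarrow> real"
  assumes "finite A" "a \<notin> A"
  shows "(\<Sum>\<sigma>\<in>insert a A \<rightarrow>\<^sub>E {-1, 1}. f \<sigma>) =
    (\<Sum>\<sigma>\<in>A \<rightarrow>\<^sub>E {-1, 1}. f (\<sigma>(a := 1)) + f (\<sigma>(a := -1)))"
proof -
  have "(\<Sum>\<sigma>\<in>insert a A \<rightarrow>\<^sub>E {-1, 1}. f \<sigma>) =
      (\<Sum>(y, g)\<in>{-1, 1} \<times> (A \<rightarrow>\<^sub>E {-1, 1}). f (g(a := y)))"
    unfolding PiE_insert_eq
    by (subst sum.reindex[OF inj_combinator[OF assms(2)]]) (auto simp: case_prod_unfold)
  also have "\<dots> = (\<Sum>y\<in>{-1, 1}. \<Sum>g\<in>A \<rightarrow>\<^sub>E {-1, 1}. f (g(a := y)))"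
    by (simp add: sum.cartesian_product)
  finally show ?thesis by (simp add: sum.distrib)
qed

lemma card_colourings: "finite A \<Longrightarrow> card (A \<rightarrow>\<^sub>E {-1, 1::int}) = 2 ^ card A"
  by (subst card_PiE) (auto simp: numeral_2_eq_2)

text \<open>The two moments share one induction because expanding the fourth power of a sum with one
  more sign produces the second moment. The second moment serves rows that are large compared with
  the permitted error, the fourth moment the small ones.\<close>

lemma colouring_moments:
  fixes B :: "'i set"
  assumes "finite A" "B \<subseteq> A"
  shows "(\<Sum>\<sigma>\<in>A \<rightarrow>\<^sub>E {-1, 1::int}. (\<Sum>i\<in>B. real_of_int (\<sigma> i))\<^sup>2) = 2 ^ card A * real (card B)"
    and "(\<Sum>\<sigma>\<in>A \<rightarrow>\<^sub>E {-1, 1::int}. (\<Sum>i\<in>B. real_of_int (\<sigma> i)) ^ 4) \<le> 2 ^ card A * (3 * (real (card B))\<^sup>2)"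
  using assms
proof (induction A arbitrary: B rule: finite_induct)
  case empty
  {
    case 1 then show ?case by simp
  next
    case 2 then show ?case by simp
  }
next
  case (insert a A)
  have split: "(\<Sum>\<sigma>\<in>insert a A \<rightarrow>\<^sub>E {-1, 1::int}. (\<Sum>i\<in>B. real_of_int (\<sigma> i)) ^ p) =
     (\<Sum>\<sigma>\<in>A \<rightarrow>\<^sub>E {-1, 1}. ((\<Sum>i\<in>B - {a}. real_of_int (\<sigma> i)) + of_bool (a \<in> B)) ^ p +
        ((\<Sum>i\<in>B - {a}. real_of_int (\<sigma> i)) - of_bool (a \<in> B)) ^ p)" if "B \<subseteq> insert a A" for p B
  proof -
    have B: "finite B" using that insert.hyps by (auto intro: finite_subset)
    have "(\<Sum>i\<in>B. real_of_int ((\<sigma>(a := y)) i)) = (\<Sum>i\<in>B - {a}. real_of_int (\<sigma> i)) + of_bool (a \<in> B) * of_int y" for \<sigma> :: "'i \<Rightarrow> int" and y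
    proof -
      have "(\<Sum>i\<in>B - {a}. real_of_int ((\<sigma>(a := y)) i)) = (\<Sum>i\<in>B - {a}. real_of_int (\<sigma> i))"
        by (intro sum.cong) auto
      then show ?thesis using B by (cases "a \<in> B") (auto simp: sum.remove[of B a])
    qed
    then show ?thesis using insert.hyps by (simp add: sum_colourings_insert)
  qed
  have card_B: "real (card B) = real (card (B - {a})) + of_bool (a \<in> B)" if "finite B" for B :: "'i set"
    using that card.remove[of B a] by (cases "a \<in> B") auto
  have cardA: "card (A \<rightarrow>\<^sub>E {-1, 1::int}) = 2 ^ card A" using insert.hyps by (intro card_colourings)
  {
    case 1
    have B: "B - {a} \<subseteq> A" "finite B" using 1 insert.hyps by (auto intro: finite_subset)
    have "(\<Sum>\<sigma>\<in>insert a A \<rightarrow>\<^sub>E {-1, 1::int}. (\<Sum>i\<in>B. real_of_int (\<sigma> i))\<^sup>2) =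
      (\<Sum>\<sigma>\<in>A \<rightarrow>\<^sub>E {-1, 1}. 2 * (\<Sum>i\<in>B - {a}. real_of_int (\<sigma> i))\<^sup>2 + 2 * of_bool (a \<in> B))"
      unfolding split[OF 1] by (intro sum.cong) (auto simp: power2_eq_square algebra_simps)
    also have "\<dots> = 2 * (2 ^ card A * real (card (B - {a}))) + 2 ^ card A * (2 * of_bool (a \<in> B))"
      using insert.IH(1)[OF B(1)] cardA by (simp add: sum.distrib flip: sum_distrib_left)
    also have "\<dots> = 2 ^ card (insert a A) * real (card B)"
      unfolding card_B[OF B(2)] using insert.hyps by (simp add: algebra_simps)
    finally show ?case .
  next
    case 2
    have B: "B - {a} \<subseteq> A" "finite B" using 2 insert.hyps by (auto intro: finite_subset)
    let ?r = "real (card (B - {a}))"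
    have "(\<Sum>\<sigma>\<in>insert a A \<rightarrow>\<^sub>E {-1, 1::int}. (\<Sum>i\<in>B. real_of_int (\<sigma> i)) ^ 4) =
      (\<Sum>\<sigma>\<in>A \<rightarrow>\<^sub>E {-1, 1}. 2 * (\<Sum>i\<in>B - {a}. real_of_int (\<sigma> i)) ^ 4 +
         12 * of_bool (a \<in> B) * (\<Sum>i\<in>B - {a}. real_of_int (\<sigma> i))\<^sup>2 + 2 * of_bool (a \<in> B))"
      unfolding split[OF 2] by (intro sum.cong) (auto simp: power2_eq_square power4_eq_xxxx algebra_simps)
    also have "\<dots> = 2 * (\<Sum>\<sigma>\<in>A \<rightarrow>\<^sub>E {-1, 1}. (\<Sum>i\<in>B - {a}. real_of_int (\<sigma> i)) ^ 4)
        + 12 * of_bool (a \<in> B) * (2 ^ card A * ?r) + 2 ^ card A * (2 * of_bool (a \<in> B))"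
      using insert.IH(1)[OF B(1)] cardA by (simp add: sum.distrib flip: sum_distrib_left)
    also have "\<dots> \<le> 2 * (2 ^ card A * (3 * ?r\<^sup>2)) + 12 * of_bool (a \<in> B) * (2 ^ card A * ?r)
        + 2 ^ card A * (2 * of_bool (a \<in> B))"
      using insert.IH(2)[OF B(1)] by simp
    also have "\<dots> = 2 ^ card A * (6 * ?r\<^sup>2 + 12 * of_bool (a \<in> B) * ?r + 2 * of_bool (a \<in> B))"
      by (simp add: algebra_simps)
    also have "\<dots> \<le> 2 ^ card A * (2 * (3 * (real (card B))\<^sup>2))"
    proof (intro mult_left_mono)
      show "6 * ?r\<^sup>2 + 12 * of_bool (a \<in> B) * ?r + 2 * of_bool (a \<in> B) \<le> 2 * (3 * (real (card B))\<^sup>2)"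
        unfolding card_B[OF B(2)] by (cases "a \<in> B") (simp_all add: power2_eq_square distrib_left distrib_right)
    qed auto
    also have "\<dots> = 2 ^ card (insert a A) * (3 * (real (card B))\<^sup>2)" using insert.hyps by simp
    finally show ?case .
  }
qed

text \<open>The weights \<open>Q\<close> play the role of a prefix code: if the codeword of \<open>v \<sigma>\<close> has average length at
  most \<open>H\<close>, then by Gibbs' inequality some value of \<open>v\<close> has probability at least \<open>exp (- H)\<close>.
  This replaces subadditivity of entropy in the partial colouring method.\<close>

lemma gibbs_pigeonhole:
  fixes Q :: "'v \<Rightarrow> real"
  assumes fin: "finite \<Omega>" and ne: "\<Omega> \<noteq> {}" and pos: "\<And>w. Q w > 0"
    and kraft: "(\<Sum>w\<in>v ` \<Omega>. Q w) \<le> 1"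
    and length: "(\<Sum>\<sigma>\<in>\<Omega>. - ln (Q (v \<sigma>))) \<le> H * real (card \<Omega>)"
  shows "\<exists>\<sigma>\<^sub>0\<in>\<Omega>. real (card {\<sigma>\<in>\<Omega>. v \<sigma> = v \<sigma>\<^sub>0}) \<ge> real (card \<Omega>) * exp (- H)"
proof (rule ccontr)
  define N where "N w = real (card {\<sigma>\<in>\<Omega>. v \<sigma> = w})" for w
  define M where "M = real (card \<Omega>)"
  have M: "M > 0" using fin ne by (simp add: M_def card_gt_0_iff)
  have N: "N (v \<sigma>) > 0" if "\<sigma> \<in> \<Omega>" for \<sigma> using fin that by (auto simp: N_def card_gt_0_iff)
  assume "\<not> ?thesis"
  then have small: "N (v \<sigma>) < M * exp (- H)" if "\<sigma> \<in> \<Omega>" for \<sigma>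
    using that by (force simp: N_def M_def)
  \<comment> \<open>If every fibre has density below \<open>exp (- H)\<close>, then
    \<open>ln Q + H\<close> is strictly below the log-ratio of \<open>Q\<close> to the true
    distribution \<open>N / M\<close> of \<open>v\<close>. The average of that ratio is at most 0 by
    \<open>ln x \<le> x - 1\<close> and Kraft, whereas the left side has nonnegative average by
    \<open>length\<close>.\<close>
  have "(\<Sum>\<sigma>\<in>\<Omega>. ln (Q (v \<sigma>)) + H) < (\<Sum>\<sigma>\<in>\<Omega>. ln (Q (v \<sigma>) * M / N (v \<sigma>)))"
  proof (intro sum_strict_mono fin ne)
    fix \<sigma> assume \<sigma>: "\<sigma> \<in> \<Omega>"
    have "ln (N (v \<sigma>)) < ln (M * exp (- H))"
      using small[OF \<sigma>] N[OF \<sigma>] M by (subst ln_less_cancel_iff) auto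
    also have "\<dots> = ln M - H" using M by (simp add: ln_mult)
    finally show "ln (Q (v \<sigma>)) + H < ln (Q (v \<sigma>) * M / N (v \<sigma>))"
      using pos[of "v \<sigma>"] M N[OF \<sigma>] by (simp add: ln_mult ln_div)
  qed
  also have "\<dots> \<le> (\<Sum>\<sigma>\<in>\<Omega>. Q (v \<sigma>) * M / N (v \<sigma>) - 1)"
    using pos M N by (intro sum_mono ln_le_minus_one) auto
  also have "\<dots> = (\<Sum>\<sigma>\<in>\<Omega>. Q (v \<sigma>) * M / N (v \<sigma>)) - M" by (simp add: sum_subtractf M_def)
  also have "(\<Sum>\<sigma>\<in>\<Omega>. Q (v \<sigma>) * M / N (v \<sigma>)) = (\<Sum>w\<in>v ` \<Omega>. \<Sum>\<sigma>\<in>{\<sigma>\<in>\<Omega>. v \<sigma> = w}. Q (v \<sigma>) * M / N (v \<sigma>))"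
    using fin by (intro sum.image_gen)
  also have "\<dots> = (\<Sum>w\<in>v ` \<Omega>. Q w * M)"
  proof (intro sum.cong refl)
    fix w assume w: "w \<in> v ` \<Omega>"
    have "(\<Sum>\<sigma>\<in>{\<sigma>\<in>\<Omega>. v \<sigma> = w}. Q (v \<sigma>) * M / N (v \<sigma>)) = (\<Sum>\<sigma>\<in>{\<sigma>\<in>\<Omega>. v \<sigma> = w}. Q w * M / N w)"
      by (intro sum.cong) auto
    also have "\<dots> = N w * (Q w * M / N w)" by (simp add: N_def)
    also have "\<dots> = Q w * M" using N w by force
    finally show "(\<Sum>\<sigma>\<in>{\<sigma>\<in>\<Omega>. v \<sigma> = w}. Q (v \<sigma>) * M / N (v \<sigma>)) = Q w * M" .
  qed
  also have "\<dots> - M \<le> 0"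
    using mult_right_mono[OF kraft, of M] M by (simp flip: sum_distrib_right)
  finally have "(\<Sum>\<sigma>\<in>\<Omega>. ln (Q (v \<sigma>)) + H) < 0" by simp
  then show False using length by (simp add: sum.distrib sum_negf algebra_simps)
qed

text \<open>The two-sided geometric distribution on the integers; the prefactor normalises its total
  mass to 1. Its code length is affine in \<open>\<bar>k\<bar>\<close>, so the average length
  involves only the first absolute moment of the encoded value.\<close>

definition geometric_code :: "real \<Rightarrow> int \<Rightarrow> real" where
  "geometric_code w k = (1 - w) / (1 + w) * w ^ nat \<bar>k\<bar>"

lemma geometric_code_pos: "0 < w \<Longrightarrow> w < 1 \<Longrightarrow> geometric_code w k > 0"
  by (simp add: geometric_code_def)

lemma geometric_code_kraft:
  assumes w: "0 < w" "w < 1" and F: "finite F"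
  shows "(\<Sum>k\<in>F. geometric_code w k) \<le> 1"
proof -
  define N where "N = nat (Max (abs ` insert 0 F))"
  have sub: "F \<subseteq> {- int N..int N}"
  proof
    fix k assume "k \<in> F"
    then have "\<bar>k\<bar> \<le> Max (abs ` insert 0 F)" using F by (intro Max_ge) auto
    then show "k \<in> {- int N..int N}" by (auto simp: N_def)
  qed
  have "(\<Sum>k\<in>{- int N..int N}. w ^ nat \<bar>k\<bar>) = (1 + w - 2 * w ^ Suc N) / (1 - w)" for N
  proof (induction N)
    case 0
    then show ?case using w by simp
  next
    case (Suc N)
    have "{- int (Suc N)..int (Suc N)} = insert (- int (Suc N)) (insert (int (Suc N)) {- int N..int N})" by auto
    then have "(\<Sum>k\<in>{- int (Suc N)..int (Suc N)}. w ^ nat \<bar>k\<bar>) = 2 * w ^ Suc N + (1 + w - 2 * w ^ Suc N) / (1 - w)"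
      using Suc by (simp add: nat_add_distrib)
    also have "\<dots> = (1 + w - 2 * w ^ Suc (Suc N)) / (1 - w)" using w by (simp add: field_simps)
    finally show ?case .
  qed
  then have "(\<Sum>k\<in>{- int N..int N}. w ^ nat \<bar>k\<bar>) \<le> (1 + w) / (1 - w)"
    using w by (simp add: divide_right_mono)
  moreover have "(\<Sum>k\<in>F. w ^ nat \<bar>k\<bar>) \<le> (\<Sum>k\<in>{- int N..int N}. w ^ nat \<bar>k\<bar>)"
    using sub w by (intro sum_mono2) auto
  ultimately have "(\<Sum>k\<in>F. w ^ nat \<bar>k\<bar>) \<le> (1 + w) / (1 - w)" by simp
  then have "(1 - w) / (1 + w) * (\<Sum>k\<in>F. w ^ nat \<bar>k\<bar>) \<le> (1 - w) / (1 + w) * ((1 + w) / (1 - w))"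
    using w by (intro mult_left_mono) auto
  also have "\<dots> = 1" using w by simp
  finally show ?thesis by (simp add: geometric_code_def sum_distrib_left)
qed

lemma neg_ln_geometric_code:
  assumes w: "0 < w" "w < 1"
  shows "- ln (geometric_code w k) \<le> 2 * w / (1 - w) + ln (1 / w) * \<bar>k\<bar>"
proof -
  have "- ln (geometric_code w k) = ln ((1 + w) / (1 - w)) + ln (1 / w) * \<bar>k\<bar>"
    using w by (simp add: geometric_code_def ln_mult ln_div ln_realpow of_nat_nat)
  moreover have "ln ((1 + w) / (1 - w)) \<le> (1 + w) / (1 - w) - 1" using w by (intro ln_le_minus_one) auto
  moreover have "(1 + w) / (1 - w) - 1 = 2 * w / (1 - w)" using w by (simp add: field_simps)
  ultimately show ?thesis by simp
qed

text \<open>The row sum divided by \<open>2 * \<Delta>\<close> and rounded to the nearest integer.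
  The shift by 1/2 centres bucket 0 at sum 0, so that rows short compared with
  \<open>\<Delta>\<^sup>2\<close> nearly always give 0 and cost almost nothing to encode.\<close>

definition bucket :: "real \<Rightarrow> 'i set \<Rightarrow> ('i \<Rightarrow> int) \<Rightarrow> int" where
  "bucket \<Delta> B \<sigma> = \<lfloor>(\<Sum>i\<in>B. of_int (\<sigma> i)) / (2 * \<Delta>) + 1 / 2\<rfloor>"

lemma bucket_eq:
  assumes "bucket \<Delta> B \<sigma> = bucket \<Delta> B \<tau>" "\<Delta> > 0"
  shows "\<bar>(\<Sum>i\<in>B. of_int (\<sigma> i)) - (\<Sum>i\<in>B. of_int (\<tau> i))\<bar> \<le> 2 * \<Delta>"
proof -
  let ?x = "(\<Sum>i\<in>B. of_int (\<sigma> i)) / (2 * \<Delta>)" and ?y = "(\<Sum>i\<in>B. of_int (\<tau> i)) / (2 * \<Delta>)"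
  have "\<bar>?x - ?y\<bar> \<le> 1" using assms(1) unfolding bucket_def by linarith
  then show ?thesis using assms(2) by (simp add: abs_divide flip: diff_divide_distrib)
qed

text \<open>A nonzero index has absolute value at least 1 and at most that of the sum divided by
  \<open>\<Delta>\<close>, and raising a number that is at least 1 to a power does not decrease it.
  Even moments therefore control the mean of \<open>\<bar>bucket\<bar>\<close>.\<close>

lemma bucket_bound:
  assumes "\<Delta> > 0" "even p" "p > 0"
  shows "real_of_int \<bar>bucket \<Delta> B \<sigma>\<bar> \<le> ((\<Sum>i\<in>B. of_int (\<sigma> i)) / \<Delta>) ^ p"
proof (cases "bucket \<Delta> B \<sigma> = 0")
  case True
  then show ?thesis using assms(2) by (simp add: zero_le_even_power)
next
  case False
  let ?X = "(\<Sum>i\<in>B. of_int (\<sigma> i)) / \<Delta>" and ?k = "bucket \<Delta> B \<sigma>"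
  have "?k = \<lfloor>?X / 2 + 1 / 2\<rfloor>" using assms by (simp add: bucket_def mult.commute)
  then have "of_int ?k \<le> ?X / 2 + 1 / 2" "?X / 2 + 1 / 2 < of_int ?k + 1" by linarith+
  moreover have "?k \<ge> 1 \<or> ?k \<le> -1" using False by auto
  then have "real_of_int ?k \<ge> 1 \<or> real_of_int ?k \<le> -1" by linarith
  ultimately have *: "real_of_int \<bar>?k\<bar> \<le> \<bar>?X\<bar>" by (auto simp: abs_if)
  have "real_of_int \<bar>?k\<bar> \<ge> 1" using False by auto
  then have "real_of_int \<bar>?k\<bar> \<le> real_of_int \<bar>?k\<bar> ^ p" using assms by (intro self_le_power) auto
  also have "\<dots> \<le> \<bar>?X\<bar> ^ p" using * by (intro power_mono) auto
  also have "\<dots> = ?X ^ p" by (rule power_even_abs[OF assms(2)])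
  finally show ?thesis .
qed

lemma ln_inverse_le:
  assumes "\<rho> > 0"
  shows "ln (1 / \<rho>) \<le> 2 / sqrt \<rho>"
proof -
  have "ln (1 / \<rho>) = 2 * ln (1 / sqrt \<rho>)" using assms by (simp add: ln_div ln_sqrt)
  also have "ln (1 / sqrt \<rho>) \<le> 1 / sqrt \<rho> - 1" using assms by (intro ln_le_minus_one) auto
  finally show ?thesis by simp
qed

text \<open>For \<open>\<rho> \<ge> 1\<close> the parameter \<open>w = 1/2\<close> costs a constant
  plus a multiple of the second-moment bound. For smaller \<open>\<rho>\<close> the choice
  \<open>w = \<rho>\<^sup>2 / 2\<close> makes the fixed cost comparable with the fourth-moment bound
  \<open>3 * \<rho>\<^sup>2\<close>; the factor \<open>ln (1 / w)\<close>, at most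
  \<open>5 / sqrt \<rho>\<close>, lowers the exponent to 3/2, and 2 + 15 gives 17. An exponent above
  1 is what makes short rows cheap.\<close>

lemma bucket_code_length:
  fixes B :: "'i set"
  assumes A: "finite A" "B \<subseteq> A" "B \<noteq> {}" and \<Delta>: "\<Delta> > 0"
  defines "\<rho> \<equiv> real (card B) / \<Delta>\<^sup>2"
  shows "\<exists>w. 0 < w \<and> w < 1 \<and> (\<Sum>\<sigma>\<in>A \<rightarrow>\<^sub>E {-1, 1}. - ln (geometric_code w (bucket \<Delta> B \<sigma>))) \<le>
    2 ^ card A * (17 * min \<rho> (\<rho> * sqrt \<rho>))"
proof -
  define E where "E = (\<Sum>\<sigma>\<in>A \<rightarrow>\<^sub>E {-1, 1}. real_of_int \<bar>bucket \<Delta> B \<sigma>\<bar>)"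
  define M :: real where "M = 2 ^ card A"
  have M: "M > 0" by (simp add: M_def)
  have "card B > 0" using A by (auto simp: card_gt_0_iff intro: finite_subset)
  then have \<rho>: "\<rho> > 0" using \<Delta> by (simp add: \<rho>_def)
  have E2: "E \<le> M * \<rho>"
  proof -
    have "E \<le> (\<Sum>\<sigma>\<in>A \<rightarrow>\<^sub>E {-1, 1::int}. ((\<Sum>i\<in>B. of_int (\<sigma> i)) / \<Delta>)\<^sup>2)"
      unfolding E_def using \<Delta> by (intro sum_mono bucket_bound) auto
    also have "\<dots> = (\<Sum>\<sigma>\<in>A \<rightarrow>\<^sub>E {-1, 1::int}. (\<Sum>i\<in>B. real_of_int (\<sigma> i))\<^sup>2) / \<Delta>\<^sup>2"
      unfolding power_divide by (rule sum_divide_distrib[symmetric])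
    also have "\<dots> = M * \<rho>" using colouring_moments(1)[OF A(1,2)] by (simp add: M_def \<rho>_def)
    finally show ?thesis .
  qed
  have E4: "E \<le> M * (3 * \<rho>\<^sup>2)"
  proof -
    have "E \<le> (\<Sum>\<sigma>\<in>A \<rightarrow>\<^sub>E {-1, 1::int}. ((\<Sum>i\<in>B. of_int (\<sigma> i)) / \<Delta>) ^ 4)"
      unfolding E_def using \<Delta> by (intro sum_mono bucket_bound) auto
    also have "\<dots> = (\<Sum>\<sigma>\<in>A \<rightarrow>\<^sub>E {-1, 1::int}. (\<Sum>i\<in>B. real_of_int (\<sigma> i)) ^ 4) / \<Delta> ^ 4"
      unfolding power_divide by (rule sum_divide_distrib[symmetric])
    also have "\<dots> \<le> (2 ^ card A * (3 * (real (card B))\<^sup>2)) / \<Delta> ^ 4"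
      using colouring_moments(2)[OF A(1,2)] \<Delta> by (intro divide_right_mono) auto
    also have "\<dots> = M * (3 * \<rho>\<^sup>2)" by (simp add: M_def \<rho>_def power_divide flip: power_mult)
    finally show ?thesis .
  qed
  have total: "(\<Sum>\<sigma>\<in>A \<rightarrow>\<^sub>E {-1, 1}. - ln (geometric_code w (bucket \<Delta> B \<sigma>))) \<le> M * (2 * w / (1 - w)) + ln (1 / w) * E"
    if w: "0 < w" "w < 1" for w
  proof -
    have "(\<Sum>\<sigma>\<in>A \<rightarrow>\<^sub>E {-1, 1}. - ln (geometric_code w (bucket \<Delta> B \<sigma>))) \<le>
        (\<Sum>\<sigma>\<in>A \<rightarrow>\<^sub>E {-1, 1}. 2 * w / (1 - w) + ln (1 / w) * \<bar>bucket \<Delta> B \<sigma>\<bar>)"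
      using w by (intro sum_mono neg_ln_geometric_code)
    also have "\<dots> = M * (2 * w / (1 - w)) + ln (1 / w) * E"
      using card_colourings[OF A(1)] by (simp add: sum.distrib M_def E_def sum_distrib_left)
    finally show ?thesis .
  qed
  show ?thesis
  proof (cases "\<rho> \<ge> 1")
    case True
    have "E \<ge> 0" by (simp add: E_def sum_nonneg)
    then have "ln 2 * E \<le> 1 * (M * \<rho>)" using E2 ln_le_minus_one[of 2] by (intro mult_mono) auto
    moreover have "M \<le> M * \<rho>" using mult_left_mono[OF True, of M] M by simp
    moreover have "M * (2 * (1 / 2) / (1 - 1 / 2)) + ln (1 / (1 / 2)) * E = 2 * M + ln 2 * E" by simp
    ultimately have "M * (2 * (1 / 2) / (1 - 1 / 2)) + ln (1 / (1 / 2)) * E \<le> M * (17 * \<rho>)"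
      using M by linarith
    also have "\<rho> = min \<rho> (\<rho> * sqrt \<rho>)" using True by simp
    finally show ?thesis using total[of "1/2"] by (intro exI[of _ "1/2"]) (auto simp: M_def)
  next
    case False
    define w where "w = \<rho>\<^sup>2 / 2"
    have \<rho>2: "\<rho>\<^sup>2 \<le> 1" "\<rho> \<le> 1" "sqrt \<rho> \<le> 1" using False \<rho> by (auto simp: power_le_one)
    have w: "0 < w" "w \<le> 1 / 2" using \<rho> \<rho>2 by (auto simp: w_def)
    have "2 * w / (1 - w) \<le> 2 * w / (1 / 2)" using w by (intro divide_left_mono) auto
    then have 1: "2 * w / (1 - w) \<le> 2 * \<rho>\<^sup>2" by (simp add: w_def)
    have "ln (1 / w) = ln 2 + 2 * ln (1 / \<rho>)" using \<rho> by (simp add: w_def ln_div ln_realpow)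
    also have "\<dots> \<le> 1 + 2 * (2 / sqrt \<rho>)"
      using ln_le_minus_one[of 2] ln_inverse_le[OF \<rho>] by (intro add_mono mult_left_mono) auto
    also have "\<dots> \<le> 1 / sqrt \<rho> + 2 * (2 / sqrt \<rho>)"
      using \<rho> \<rho>2(3) by (intro add_right_mono) (simp add: pos_le_divide_eq del: real_sqrt_le_1_iff)
    also have "\<dots> = 5 / sqrt \<rho>" by simp
    finally have 2: "ln (1 / w) \<le> 5 / sqrt \<rho>" .
    have "M * (2 * w / (1 - w)) + ln (1 / w) * E \<le> M * (2 * \<rho>\<^sup>2) + 5 / sqrt \<rho> * (M * (3 * \<rho>\<^sup>2))"
      using M \<rho> 1 2 E4 by (intro add_mono[OF mult_left_mono mult_mono]) (auto simp: E_def sum_nonneg)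
    also have "\<rho>\<^sup>2 = \<rho> * sqrt \<rho> * sqrt \<rho>" using \<rho> by (simp add: power2_eq_square)
    also have "M * (2 * (\<rho> * sqrt \<rho> * sqrt \<rho>)) + 5 / sqrt \<rho> * (M * (3 * (\<rho> * sqrt \<rho> * sqrt \<rho>)))
      = M * (\<rho> * sqrt \<rho>) * (2 * sqrt \<rho> + 15)"
    proof -
      have "M * (2 * (\<rho> * q * q)) + 5 / q * (M * (3 * (\<rho> * q * q))) = M * (\<rho> * q) * (2 * q + 15)"
        if "q > 0" for q :: real
        using that by (simp add: field_simps)
      from this[of "sqrt \<rho>"] show ?thesis using \<rho> by (simp only: real_sqrt_gt_0_iff)
    qed
    also have "\<dots> \<le> M * (\<rho> * sqrt \<rho>) * 17" using \<rho>2 \<rho> M by (intro mult_left_mono) auto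
    also have "\<dots> = M * (17 * (\<rho> * sqrt \<rho>))" by simp
    also have "\<rho> * sqrt \<rho> = min \<rho> (\<rho> * sqrt \<rho>)" using \<rho>2 \<rho> by (simp add: mult_left_le min_def)
    finally show ?thesis using total[of w] w by (intro exI[of _ w]) (auto simp: M_def)
  qed
qed

text \<open>Chernoff's method: each disagreement is weighted by \<open>y\<close>, and the sum of the
  weights over all colourings factorises. The strict inequality is used later, since the fibre
  supplied by \<open>gibbs_pigeonhole\<close> is only known to have at least this size.\<close>

lemma hamming_ball_card:
  fixes \<sigma>\<^sub>0 :: "'i \<Rightarrow> int"
  assumes A: "finite A" "A \<noteq> {}" and \<sigma>\<^sub>0: "\<sigma>\<^sub>0 \<in> A \<rightarrow>\<^sub>E {-1, 1}"
  shows "real (card {\<sigma> \<in> A \<rightarrow>\<^sub>E {-1, 1}. real (card {i\<in>A. \<sigma> i \<noteq> \<sigma>\<^sub>0 i}) < real (card A) / 10}) < 2 ^ card A * exp (- (real (card A) / 4))"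
proof -
  define y :: real where "y = exp (- (3 / 2))"
  define a where "a = real (card A)"
  have a: "a > 0" using A by (simp add: a_def card_gt_0_iff)
  let ?F = "{\<sigma> \<in> A \<rightarrow>\<^sub>E {-1, 1::int}. real (card {i\<in>A. \<sigma> i \<noteq> \<sigma>\<^sub>0 i}) < a / 10}"
  have "real (card ?F) * exp (- (3 / 20 * a)) \<le> (\<Sum>\<sigma>\<in>?F. y ^ card {i\<in>A. \<sigma> i \<noteq> \<sigma>\<^sub>0 i})"
  proof -
    have "exp (- (3 / 20 * a)) \<le> y ^ card {i\<in>A. \<sigma> i \<noteq> \<sigma>\<^sub>0 i}" if "\<sigma> \<in> ?F" for \<sigma>
      using that by (simp add: y_def flip: exp_of_nat_mult)
    then have "(\<Sum>\<sigma>\<in>?F. exp (- (3 / 20 * a))) \<le> (\<Sum>\<sigma>\<in>?F. y ^ card {i\<in>A. \<sigma> i \<noteq> \<sigma>\<^sub>0 i})" by (intro sum_mono)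
    then show ?thesis by simp
  qed
  also have "\<dots> \<le> (\<Sum>\<sigma>\<in>A \<rightarrow>\<^sub>E {-1, 1::int}. y ^ card {i\<in>A. \<sigma> i \<noteq> \<sigma>\<^sub>0 i})"
    using A by (intro sum_mono2) (auto simp: y_def intro!: finite_PiE)
  also have "\<dots> = (\<Sum>\<sigma>\<in>A \<rightarrow>\<^sub>E {-1, 1::int}. \<Prod>i\<in>A. if \<sigma> i \<noteq> \<sigma>\<^sub>0 i then y else 1)"
    using A by (intro sum.cong refl) (simp add: prod.If_cases Collect_conj_eq)
  also have "\<dots> = (\<Prod>i\<in>A. \<Sum>c\<in>{-1, 1::int}. if c \<noteq> \<sigma>\<^sub>0 i then y else 1)"
    using A by (intro prod_sum_PiE[symmetric]) auto
  also have "\<dots> = (\<Prod>i\<in>A. 1 + y)"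
    using \<sigma>\<^sub>0 by (intro prod.cong) (auto simp: PiE_iff)
  also have "\<dots> = (1 + y) ^ card A" by simp
  finally have "real (card ?F) \<le> (1 + y) ^ card A * exp (3 / 20 * a)"
    by (simp add: exp_minus field_simps)
  also have "\<dots> = ((1 + y) * exp (3 / 20)) ^ card A" by (simp add: a_def power_mult_distrib flip: exp_of_nat_mult)
  also have "\<dots> < (2 * exp (- (1 / 4))) ^ card A"
  proof (rule power_strict_mono)
    \<comment> \<open>Moving \<open>exp (- (1 / 4))\<close> to the left leaves
      \<open>(1 + y) * exp (2 / 5) < 2\<close>, because 3/20 + 1/4 = 2/5. The number 29/8 is 1 + 3/2
      + 9/8.\<close>
    have "29 / 8 \<le> exp (3 / 2 :: real)" using exp_lower_Taylor_quadratic[of "3/2"] by (simp add: power2_eq_square)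
    then have "y \<le> 8 / 29" by (simp add: y_def exp_minus field_simps)
    moreover have "exp (2 / 5 :: real) \<le> 1 + 2 / 5 + (2 / 5)\<^sup>2" by (intro exp_bound) auto
    ultimately have "(1 + y) * exp (2 / 5) \<le> (1 + 8 / 29) * (1 + 2 / 5 + (2 / 5)\<^sup>2)"
      by (intro mult_mono) (auto simp: y_def)
    also have "\<dots> < 2" by (simp add: power2_eq_square)
    finally have "(1 + y) * exp (2 / 5) < 2" .
    moreover have "exp (2 / 5 :: real) = exp (3 / 20) * exp (1 / 4)" by (simp flip: exp_add)
    ultimately show "(1 + y) * exp (3 / 20) < 2 * exp (- (1 / 4))" by (simp add: exp_minus field_simps)
  qed (use A in \<open>auto simp: y_def card_gt_0_iff intro!: mult_nonneg_nonneg add_nonneg_nonneg\<close>)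
  also have "\<dots> = 2 ^ card A * exp (- (a / 4))"
    by (simp add: a_def power_mult_distrib flip: exp_of_nat_mult)
  finally show ?thesis by (simp add: a_def)
qed

text \<open>The row codes multiply to a code for the vector of all buckets, of average length at
  most \<open>card A / 4\<close>. Some fibre is then larger than a Hamming ball of radius
  \<open>card A / 10\<close> and contains two colourings that are far apart; half their difference
  vanishes where they agree and has row sums at most \<open>\<Delta>\<close>.\<close>

lemma partial_colouring:
  fixes S :: "'j \<Rightarrow> 'i set"
  assumes A: "finite A" "A \<noteq> {}" and J: "finite J" and \<Delta>: "\<Delta> > 0"
    and entropy: "(\<Sum>j\<in>J. let \<rho> = real (card (A \<inter> S j)) / \<Delta>\<^sup>2 in 17 * min \<rho> (\<rho> * sqrt \<rho>)) \<le> real (card A) / 4"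
  shows "\<exists>\<sigma>::'i \<Rightarrow> int. (\<forall>i\<in>A. \<sigma> i \<in> {-1, 0, 1}) \<and> real (card {i\<in>A. \<sigma> i \<noteq> 0}) \<ge> real (card A) / 10 \<and>
     (\<forall>j\<in>J. \<bar>\<Sum>i\<in>A \<inter> S j. real_of_int (\<sigma> i)\<bar> \<le> \<Delta>)"
proof -
  define h where "h j = (let \<rho> = real (card (A \<inter> S j)) / \<Delta>\<^sup>2 in 17 * min \<rho> (\<rho> * sqrt \<rho>))" for j
  \<comment> \<open>A row that misses \<open>A\<close> has sum 0 anyway, and
    \<open>bucket_code_length\<close> is about nonempty rows.\<close>
  define J' where "J' = {j\<in>J. A \<inter> S j \<noteq> {}}"
  have J': "finite J'" "J' \<subseteq> J" using J by (auto simp: J'_def)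
  define \<Omega> where "\<Omega> = A \<rightarrow>\<^sub>E {-1, 1::int}"
  have \<Omega>: "finite \<Omega>" "card \<Omega> = 2 ^ card A" "\<Omega> \<noteq> {}"
    using A card_colourings[of A] by (auto simp: \<Omega>_def finite_PiE PiE_eq_empty_iff)
  have "\<forall>j\<in>J'. \<exists>w. 0 < w \<and> w < 1 \<and> (\<Sum>\<sigma>\<in>\<Omega>. - ln (geometric_code w (bucket \<Delta> (A \<inter> S j) \<sigma>))) \<le> 2 ^ card A * h j"
    using bucket_code_length[OF A(1) _ _ \<Delta>] by (simp add: J'_def \<Omega>_def h_def Let_def)
  then obtain w where w: "\<And>j. j \<in> J' \<Longrightarrow> 0 < w j" "\<And>j. j \<in> J' \<Longrightarrow> w j < 1"
    "\<And>j. j \<in> J' \<Longrightarrow> (\<Sum>\<sigma>\<in>\<Omega>. - ln (geometric_code (w j) (bucket \<Delta> (A \<inter> S j) \<sigma>))) \<le> 2 ^ card A * h j"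
    by metis
  define v where "v \<sigma> = (\<lambda>j\<in>J'. bucket \<Delta> (A \<inter> S j) \<sigma>)" for \<sigma>
  define Q where "Q f = (\<Prod>j\<in>J'. geometric_code (w j) (f j))" for f
  have Q_pos: "Q f > 0" for f unfolding Q_def using w by (intro prod_pos ballI geometric_code_pos) auto
  have kraft: "(\<Sum>f\<in>v ` \<Omega>. Q f) \<le> 1"
  proof -
    \<comment> \<open>Bucket vectors are embedded in a finite product, over which the sum of
      \<open>Q\<close> factorises into one Kraft sum per row.\<close>
    define F where "F = (\<lambda>j. (\<lambda>\<sigma>. bucket \<Delta> (A \<inter> S j) \<sigma>) ` \<Omega>)"
    have "(\<Sum>f\<in>v ` \<Omega>. Q f) \<le> (\<Sum>f\<in>PiE J' F. Q f)"
    proof (intro sum_mono2)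
      show "finite (PiE J' F)" using J' \<Omega> by (intro finite_PiE) (auto simp: F_def)
      show "v ` \<Omega> \<subseteq> PiE J' F" by (auto simp: v_def F_def)
    qed (rule less_imp_le[OF Q_pos])
    also have "\<dots> = (\<Prod>j\<in>J'. \<Sum>k\<in>F j. geometric_code (w j) k)"
      unfolding Q_def using J' \<Omega> by (intro prod_sum_PiE[symmetric]) (auto simp: F_def)
    also have "\<dots> \<le> 1"
      using w \<Omega>
      by (intro prod_le_1 conjI sum_nonneg geometric_code_kraft less_imp_le[OF geometric_code_pos])
        (auto simp: F_def)
    finally show ?thesis .
  qed
  have "(\<Sum>\<sigma>\<in>\<Omega>. - ln (Q (v \<sigma>))) = (\<Sum>\<sigma>\<in>\<Omega>. \<Sum>j\<in>J'. - ln (geometric_code (w j) (bucket \<Delta> (A \<inter> S j) \<sigma>)))"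
  proof (intro sum.cong refl)
    fix \<sigma>
    have "ln (Q (v \<sigma>)) = (\<Sum>j\<in>J'. ln (geometric_code (w j) (v \<sigma> j)))"
      unfolding Q_def
    proof (intro ln_prod)
      fix j assume "j \<in> J'"
      then show "geometric_code (w j) (v \<sigma> j) \<noteq> 0" using w geometric_code_pos by (metis less_irrefl)
    qed (rule J')
    then show "- ln (Q (v \<sigma>)) = (\<Sum>j\<in>J'. - ln (geometric_code (w j) (bucket \<Delta> (A \<inter> S j) \<sigma>)))"
      by (simp add: v_def sum_negf)
  qed
  also have "\<dots> = (\<Sum>j\<in>J'. \<Sum>\<sigma>\<in>\<Omega>. - ln (geometric_code (w j) (bucket \<Delta> (A \<inter> S j) \<sigma>)))" by (rule sum.swap)
  also have "\<dots> \<le> (\<Sum>j\<in>J'. 2 ^ card A * h j)" by (intro sum_mono w)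
  also have "\<dots> \<le> 2 ^ card A * (\<Sum>j\<in>J. h j)"
    unfolding sum_distrib_left[symmetric] using J J'
    by (intro mult_left_mono sum_mono2) (auto simp: h_def Let_def)
  also have "\<dots> \<le> 2 ^ card A * (real (card A) / 4)"
    using entropy by (intro mult_left_mono) (auto simp: h_def)
  finally have "(\<Sum>\<sigma>\<in>\<Omega>. - ln (Q (v \<sigma>))) \<le> real (card A) / 4 * real (card \<Omega>)" using \<Omega> by (simp add: mult.commute)
  from gibbs_pigeonhole[where Q = Q and v = v, OF \<Omega>(1,3) Q_pos kraft this] obtain \<sigma>\<^sub>0 where \<sigma>\<^sub>0: "\<sigma>\<^sub>0 \<in> \<Omega>"
    "real (card {\<sigma>\<in>\<Omega>. v \<sigma> = v \<sigma>\<^sub>0}) \<ge> 2 ^ card A * exp (- (real (card A) / 4))"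
    using \<Omega> by auto
  define Ball where "Ball = {\<sigma> \<in> \<Omega>. real (card {i\<in>A. \<sigma> i \<noteq> \<sigma>\<^sub>0 i}) < real (card A) / 10}"
  have "card Ball < card {\<sigma>\<in>\<Omega>. v \<sigma> = v \<sigma>\<^sub>0}"
    using hamming_ball_card[OF A, of \<sigma>\<^sub>0] \<sigma>\<^sub>0 by (simp add: Ball_def \<Omega>_def)
  moreover have "finite Ball" using \<Omega> by (simp add: Ball_def)
  ultimately have "\<not> {\<sigma>\<in>\<Omega>. v \<sigma> = v \<sigma>\<^sub>0} \<subseteq> Ball" using card_mono leD by blast
  then obtain \<sigma>\<^sub>1 where \<sigma>\<^sub>1: "\<sigma>\<^sub>1 \<in> \<Omega>" "v \<sigma>\<^sub>1 = v \<sigma>\<^sub>0" "real (card {i\<in>A. \<sigma>\<^sub>1 i \<noteq> \<sigma>\<^sub>0 i}) \<ge> real (card A) / 10"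
    unfolding Ball_def by (force simp: not_less)
  define \<sigma> where "\<sigma> i = (\<sigma>\<^sub>1 i - \<sigma>\<^sub>0 i) div 2" for i
  have pm: "\<sigma>\<^sub>0 i \<in> {-1, 1}" "\<sigma>\<^sub>1 i \<in> {-1, 1}" if "i \<in> A" for i using \<sigma>\<^sub>0 \<sigma>\<^sub>1 that by (auto simp: \<Omega>_def PiE_iff)
  have \<sigma>2: "2 * \<sigma> i = \<sigma>\<^sub>1 i - \<sigma>\<^sub>0 i" if "i \<in> A" for i using pm[OF that] by (auto simp: \<sigma>_def)
  have "\<bar>\<Sum>i\<in>A \<inter> S j. real_of_int (\<sigma> i)\<bar> \<le> \<Delta>" if j: "j \<in> J" for j
  proof (cases "j \<in> J'")
    case True
    have "bucket \<Delta> (A \<inter> S j) \<sigma>\<^sub>1 = bucket \<Delta> (A \<inter> S j) \<sigma>\<^sub>0"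
      using fun_cong[OF \<sigma>\<^sub>1(2), of j] True by (simp add: v_def)
    from bucket_eq[OF this \<Delta>]
    have "\<bar>\<Sum>i\<in>A \<inter> S j. real_of_int (\<sigma>\<^sub>1 i - \<sigma>\<^sub>0 i)\<bar> \<le> 2 * \<Delta>" by (simp add: sum_subtractf)
    also have "(\<Sum>i\<in>A \<inter> S j. real_of_int (\<sigma>\<^sub>1 i - \<sigma>\<^sub>0 i)) = (\<Sum>i\<in>A \<inter> S j. 2 * real_of_int (\<sigma> i))"
    proof (intro sum.cong refl)
      fix i assume "i \<in> A \<inter> S j"
      then show "real_of_int (\<sigma>\<^sub>1 i - \<sigma>\<^sub>0 i) = 2 * real_of_int (\<sigma> i)" by (subst \<sigma>2[symmetric]) auto
    qed
    finally show ?thesis by (simp add: abs_mult flip: sum_distrib_left)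
  next
    case False
    then show ?thesis using j \<Delta> by (simp add: J'_def)
  qed
  moreover have "\<sigma> i \<in> {-1, 0, 1}" if "i \<in> A" for i using pm[OF that] by (auto simp: \<sigma>_def)
  moreover have "{i\<in>A. \<sigma> i \<noteq> 0} = {i\<in>A. \<sigma>\<^sub>1 i \<noteq> \<sigma>\<^sub>0 i}" using \<sigma>2 by force
  ultimately show ?thesis using \<sigma>\<^sub>1(3) by (intro exI[of _ \<sigma>]) auto
qed

section \<open>Well spread set systems\<close>

lemma sum_row_sizes:
  assumes "finite V" "finite J" "A \<subseteq> V" and deg: "\<forall>i\<in>V. card {j\<in>J. i \<in> S j} = t"
  shows "(\<Sum>j\<in>J. real (card (A \<inter> S j))) = real (card A) * real t"
proof -
  have A: "finite A" using assms finite_subset by blast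
  have "(\<Sum>j\<in>J. real (card (A \<inter> S j))) = (\<Sum>j\<in>J. \<Sum>i\<in>A. of_bool (i \<in> S j))"
    using A by (simp add: Int_def)
  also have "\<dots> = (\<Sum>i\<in>A. \<Sum>j\<in>J. of_bool (i \<in> S j))" by (rule sum.swap)
  also have "\<dots> = (\<Sum>i\<in>A. real (card {j\<in>J. i \<in> S j}))"
    using assms(2) by (simp add: Int_def)
  also have "\<dots> = (\<Sum>i\<in>A. real t)" using deg assms(3) by (intro sum.cong) auto
  finally show ?thesis by simp
qed

text \<open>The rows share \<open>t * card A\<close> incidences with \<open>A\<close>, so fewer than
  \<open>card A\<close> of them can have more than \<open>t\<close>. The result bounds the
  discrepancy on the exceptional event and colours the surplus elements.\<close>

lemma beck_fiala:
  fixes S :: "'j \<Rightarrow> 'i set"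
  assumes V: "finite V" and J: "finite J" and deg: "\<forall>i\<in>V. card {j\<in>J. i \<in> S j} = t" and t: "t > 0"
  shows "\<exists>\<sigma>::'i \<Rightarrow> int. (\<forall>i\<in>V. \<sigma> i \<in> {-1, 1}) \<and> (\<forall>j\<in>J. \<bar>\<Sum>i\<in>V \<inter> S j. real_of_int (\<sigma> i)\<bar> \<le> 2 * real t)"
proof -
  have few: "card {j\<in>J. real (card (A \<inter> S j)) > real t} < card A" if A: "A \<subseteq> V" "A \<noteq> {}" for A
  proof (cases "{j\<in>J. real (card (A \<inter> S j)) > real t} = {}")
    case True
    then show ?thesis using A finite_subset[OF A(1) V] unfolding True by (simp add: card_gt_0_iff)
  next
    case False
    let ?Q = "{j\<in>J. real (card (A \<inter> S j)) > real t}"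
    have "real (card ?Q) * real t = (\<Sum>j\<in>?Q. real t)" by simp
    also have "\<dots> < (\<Sum>j\<in>?Q. real (card (A \<inter> S j)))" using False J by (intro sum_strict_mono) auto
    also have "\<dots> \<le> (\<Sum>j\<in>J. real (card (A \<inter> S j)))" using J by (intro sum_mono2) auto
    also have "\<dots> = real (card A) * real t" by (rule sum_row_sizes[OF V J A(1) deg])
    finally show ?thesis using t by simp
  qed
  obtain \<sigma> where \<sigma>: "\<forall>i\<in>V. \<sigma> i \<in> {-1, 1}" "\<forall>j\<in>J. \<bar>\<Sum>i\<in>V \<inter> S j. \<sigma> i - 0\<bar> \<le> 2 * real t"
    using beck_fiala_rounding[OF V J, of "real t" S "\<lambda>_. 0"] few by auto
  define \<tau> :: "'i \<Rightarrow> int" where "\<tau> i = (if \<sigma> i = 1 then 1 else -1)" for i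
  have "(\<Sum>i\<in>V \<inter> S j. real_of_int (\<tau> i)) = (\<Sum>i\<in>V \<inter> S j. \<sigma> i)" for j
    using \<sigma>(1) by (intro sum.cong) (auto simp: \<tau>_def)
  then show ?thesis using \<sigma>(2) by (intro exI[of _ \<tau>]) (auto simp: \<tau>_def)
qed

text \<open>For sets of at least \<open>m / sqrt t\<close> elements the condition feeds the partial colouring lemma,
  for smaller ones it feeds the Beck--Fiala argument.\<close>

definition well_spread :: "'i set \<Rightarrow> 'j set \<Rightarrow> ('j \<Rightarrow> 'i set) \<Rightarrow> nat \<Rightarrow> bool" where
  "well_spread V J S t \<longleftrightarrow> (\<forall>A\<subseteq>V. A \<noteq> {} \<longrightarrow> card A \<le> card J \<longrightarrow>
     (real (card J) \<le> real (card A) * sqrt t \<longrightarrow>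
       (\<Sum>j\<in>{j\<in>J. real (card (A \<inter> S j)) > 4 * real t * (real (card A) / real (card J))}. real (card (A \<inter> S j)))
         \<le> real (card A) * real t * (root 6 (real (card A) / real (card J)))\<^sup>2) \<and>
     (real (card A) * sqrt t \<le> real (card J) \<longrightarrow>
       card {j\<in>J. real (card (A \<inter> S j)) > 12 * sqrt t} < card A))"

text \<open>Here both thresholds are at least \<open>card A\<close>: \<open>4 * t / m\<close> is at
  least 1, and in the second range \<open>card A\<close> is at most \<open>4 * sqrt t\<close>. No
  row qualifies as heavy, so randomness plays no part when \<open>m\<close> is at most
  \<open>4 * t\<close>.\<close>

lemma well_spread_trivial:
  assumes V: "finite V" and J: "finite J" and t: "4 * t \<ge> card J" "t > 0"
  shows "well_spread V J S t"
  unfolding well_spread_def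
proof (intro allI impI conjI)
  fix A assume A: "A \<subseteq> V" "A \<noteq> {}" "card A \<le> card J"
  have fin: "finite A" using A V finite_subset by blast
  then have a: "card A > 0" using A by (simp add: card_gt_0_iff)
  have r: "real (card (A \<inter> S j)) \<le> real (card A)" for j using fin by (simp add: card_mono)
  {
    have "real (card J) \<le> 4 * real t" "real (card J) > 0" using t a A by linarith+
    then have "real (card A) * 1 \<le> real (card A) * (4 * real t / real (card J))"
      by (intro mult_left_mono) auto
    then have "real (card A) \<le> 4 * real t * (real (card A) / real (card J))" by (simp add: mult_ac)
    then have "{j\<in>J. real (card (A \<inter> S j)) > 4 * real t * (real (card A) / real (card J))} = {}"
      using order.trans[OF r] by (simp add: not_less del: times_divide_eq_right)
    then show "(\<Sum>j\<in>{j\<in>J. real (card (A \<inter> S j)) > 4 * real t * (real (card A) / real (card J))}. real (card (A \<inter> S j)))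
         \<le> real (card A) * real t * (root 6 (real (card A) / real (card J)))\<^sup>2"
      by (simp only: sum.empty) simp
  }
  {
    assume "real (card A) * sqrt t \<le> real (card J)"
    also have "\<dots> \<le> 4 * (sqrt t * sqrt t)" using t by simp
    finally have "real (card A) * sqrt t \<le> 4 * sqrt t * sqrt t" by (simp only: mult.assoc)
    then have "real (card A) \<le> 4 * sqrt t" by (rule mult_right_le_imp_le) (use t in simp)
    moreover have "4 * sqrt t \<le> 12 * sqrt t" by simp
    ultimately have "\<not> real (card (A \<inter> S j)) > 12 * sqrt t" for j using r[of j] by linarith
    then have "{j\<in>J. real (card (A \<inter> S j)) > 12 * sqrt t} = {}"
by blast
    then show "card {j\<in>J. real (card (A \<inter> S j)) > 12 * sqrt t} < card A" using a by (simp only: card.empty)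
  }
qed

text \<open>Origin of the sixth root. Put x = card A / m and suppose that \<open>\<Delta>\<close> is
  of order sqrt t times x^e. A row of the typical size \<open>t\<close> x has \<open>\<rho>\<close>
  of order x^(1 - 2e), and the values of \<open>\<rho>\<close> sum to about card A times x^(-2e).
  Hence the sum of \<open>\<rho> * sqrt \<rho>\<close> is about card A times x^(1/2 - 3e), which is
  O(card A) exactly for e at most 1/6. Rows above four times the typical size use the linear bound
  in \<open>\<rho>\<close>, which is why \<open>well_spread\<close> limits their total by a multiple
  of \<open>y\<^sup>2\<close>.\<close>

lemma well_spread_entropy:
  fixes S :: "'j \<Rightarrow> 'i set"
  assumes V: "finite V" and J: "finite J" and deg: "\<forall>i\<in>V. card {j\<in>J. i \<in> S j} = t" and t: "t > 0"
    and spread: "well_spread V J S t" and A: "A \<subseteq> V" "A \<noteq> {}" "card A \<le> card J"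
    and large: "real (card J) \<le> real (card A) * sqrt t"
  defines "\<Delta> \<equiv> 10 * sqrt t * root 6 (real (card A) / real (card J))"
  shows "(\<Sum>j\<in>J. let \<rho> = real (card (A \<inter> S j)) / \<Delta>\<^sup>2 in 17 * min \<rho> (\<rho> * sqrt \<rho>)) \<le> real (card A) / 4"
proof -
  define y where "y = root 6 (real (card A) / real (card J))"
  define r where "r j = real (card (A \<inter> S j))" for j
  define big where "big = {j\<in>J. r j > 4 * real t * (real (card A) / real (card J))}"
  have a: "card A > 0" using A V by (simp add: card_gt_0_iff finite_subset)
  have m: "card J > 0" using a A by linarith
  have y: "y > 0" "y ^ 6 = real (card A) / real (card J)" using a m by (auto simp: y_def)
  have \<Delta>2: "\<Delta>\<^sup>2 = 100 * real t * y\<^sup>2" by (simp add: \<Delta>_def y_def power_mult_distrib)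
  have \<Delta>2_pos: "\<Delta>\<^sup>2 > 0" using y t by (simp add: \<Delta>2)
  have big_sum: "(\<Sum>j\<in>big. r j) \<le> real (card A) * real t * y\<^sup>2"
    using spread A large unfolding well_spread_def big_def r_def y_def by blast
  have "(\<Sum>j\<in>J. let \<rho> = r j / \<Delta>\<^sup>2 in 17 * min \<rho> (\<rho> * sqrt \<rho>)) \<le>
    (\<Sum>j\<in>J. 17 / (500 * real t) * r j + (if j \<in> big then 17 / (100 * real t * y\<^sup>2) * r j else 0))"
  proof (intro sum_mono)
    fix j assume j: "j \<in> J"
    define \<rho> where "\<rho> = r j / \<Delta>\<^sup>2"
    have \<rho>: "\<rho> \<ge> 0" using \<Delta>2_pos by (simp add: \<rho>_def r_def)
    have "17 * min \<rho> (\<rho> * sqrt \<rho>) \<le> 17 / (500 * real t) * r j + (if j \<in> big then 17 / (100 * real t * y\<^sup>2) * r j else 0)"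
    proof (cases "j \<in> big")
      case True
      have "17 * min \<rho> (\<rho> * sqrt \<rho>) \<le> 17 * \<rho>" by simp
      also have "\<dots> = 17 / (100 * real t * y\<^sup>2) * r j" by (simp add: \<rho>_def \<Delta>2)
      also have "\<dots> \<le> 17 / (500 * real t) * r j + 17 / (100 * real t * y\<^sup>2) * r j" by (simp add: r_def)
      finally show ?thesis using True by simp
    next
      case False
      then have "r j \<le> 4 * real t * y ^ 6" using j by (simp add: big_def y)
      then have "\<rho> \<le> 4 * real t * y ^ 6 / \<Delta>\<^sup>2" unfolding \<rho>_def using \<Delta>2_pos by (intro divide_right_mono) auto
      also have "\<dots> = (y\<^sup>2 / 5)\<^sup>2" using y(1) t by (simp add: \<Delta>2 field_simps flip: power_add)
      finally have "sqrt \<rho> \<le> y\<^sup>2 / 5" by (intro real_le_lsqrt) auto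
      then have "\<rho> * sqrt \<rho> \<le> \<rho> * (y\<^sup>2 / 5)" using \<rho> by (intro mult_left_mono)
      then have "17 * min \<rho> (\<rho> * sqrt \<rho>) \<le> 17 * (\<rho> * (y\<^sup>2 / 5))" by linarith
      also have "\<dots> = 17 / (500 * real t) * r j" using y t by (simp add: \<rho>_def \<Delta>2 field_simps)
      finally show ?thesis using False by simp
    qed
    then show "(let \<rho> = r j / \<Delta>\<^sup>2 in 17 * min \<rho> (\<rho> * sqrt \<rho>)) \<le>
        17 / (500 * real t) * r j + (if j \<in> big then 17 / (100 * real t * y\<^sup>2) * r j else 0)"
      unfolding Let_def \<rho>_def .
  qed
  also have "\<dots> = 17 / (500 * real t) * (\<Sum>j\<in>J. r j) + 17 / (100 * real t * y\<^sup>2) * (\<Sum>j\<in>big. r j)"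
  proof -
    have "J \<inter> big = big" by (auto simp: big_def)
    then show ?thesis using J by (simp add: sum.distrib sum_distrib_left flip: sum.inter_restrict)
  qed
  \<comment> \<open>Ordinary rows contribute 17/500 and heavy rows 17/100 per element of
    \<open>A\<close>, together 51/250, just below the permitted 1/4.\<close>
  also have "\<dots> \<le> 17 / (500 * real t) * (real (card A) * real t) + 17 / (100 * real t * y\<^sup>2) * (real (card A) * real t * y\<^sup>2)"
    using sum_row_sizes[OF V J A(1) deg] big_sum
    by (intro add_mono mult_left_mono) (auto simp: r_def)
  also have "\<dots> \<le> real (card A) / 4" using t y by simp
  finally show ?thesis by (simp add: r_def)
qed

text \<open>A round costs \<open>10 * sqrt t * y\<close> and leaves at most 9/10 of the elements,
  which multiplies \<open>y\<close> by at most 59/60. The constant 600 solves c = 59/60 c + 10, so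
  the geometric series is hidden in the induction; 24 is twice the threshold 12 of the final
  Beck-Fiala stage.\<close>

lemma well_spread_hereditary_discrepancy:
  fixes S :: "'j \<Rightarrow> 'i set"
  assumes V: "finite V" and J: "finite J" and deg: "\<forall>i\<in>V. card {j\<in>J. i \<in> S j} = t" and t: "t > 0"
    and spread: "well_spread V J S t" and A: "A \<subseteq> V" "card A \<le> card J"
  shows "\<exists>\<sigma>::'i \<Rightarrow> int. (\<forall>i\<in>A. \<sigma> i \<in> {-1, 1}) \<and>
    (\<forall>j\<in>J. \<bar>\<Sum>i\<in>A \<inter> S j. real_of_int (\<sigma> i)\<bar> \<le> (600 * root 6 (real (card A) / real (card J)) + 24) * sqrt t)"
  using A
proof (induction "card A" arbitrary: A rule: less_induct)
  case less
  have A: "finite A" using less.prems V finite_subset by blast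
  define y where "y = root 6 (real (card A) / real (card J))"
  have y: "y \<ge> 0" by (simp add: y_def)
  consider "A = {}" | "A \<noteq> {}" "real (card A) * sqrt t \<le> real (card J)"
    | "A \<noteq> {}" "real (card J) \<le> real (card A) * sqrt t" by linarith
  then show ?case
  proof cases
    case 1
    then show ?thesis by auto
  next
    case 2
    have few: "card {j\<in>J. real (card (B \<inter> S j)) > 12 * sqrt t} < card B" if B: "B \<subseteq> A" "B \<noteq> {}" for B
    proof -
      have "card B \<le> card A" using A B by (intro card_mono)
      then have "real (card B) * sqrt t \<le> real (card A) * sqrt t" by (intro mult_right_mono) auto
      then have "real (card B) * sqrt t \<le> real (card J)" "card B \<le> card J" "B \<subseteq> V"
        using 2 B less.prems \<open>card B \<le> card A\<close> by auto
      then show ?thesis using spread B unfolding well_spread_def by blast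
    qed
    obtain \<sigma> where \<sigma>: "\<forall>i\<in>A. \<sigma> i \<in> {-1, 1}" "\<forall>j\<in>J. \<bar>\<Sum>i\<in>A \<inter> S j. \<sigma> i - 0\<bar> \<le> 2 * (12 * sqrt t)"
      using beck_fiala_rounding[OF A J, of "12 * sqrt t" S "\<lambda>_. 0"] few by auto
    define \<tau> :: "'i \<Rightarrow> int" where "\<tau> i = (if \<sigma> i = 1 then 1 else -1)" for i
    have "(\<Sum>i\<in>A \<inter> S j. real_of_int (\<tau> i)) = (\<Sum>i\<in>A \<inter> S j. \<sigma> i)" for j
      using \<sigma>(1) by (intro sum.cong) (auto simp: \<tau>_def)
    moreover have "2 * (12 * sqrt t) \<le> (600 * y + 24) * sqrt t" using y by (simp add: algebra_simps)
    ultimately show ?thesis using \<sigma>(2) unfolding y_def[symmetric]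
      by (intro exI[of _ \<tau>]) (force simp: \<tau>_def)
  next
    case 3
    define \<Delta> where "\<Delta> = 10 * sqrt t * y"
    have a: "card A > 0" using A 3 by (simp add: card_gt_0_iff)
    have m: "card J > 0" using a less.prems by linarith
    have y_pos: "y > 0" "y ^ 6 = real (card A) / real (card J)" using a m by (auto simp: y_def)
    have "\<Delta> > 0" using t y_pos by (simp add: \<Delta>_def)
    from partial_colouring[OF A 3(1) J this, of S]
      well_spread_entropy[OF V J deg t spread less.prems(1) 3(1) less.prems(2) 3(2)]
    obtain \<tau> :: "'i \<Rightarrow> int" where \<tau>: "\<forall>i\<in>A. \<tau> i \<in> {-1, 0, 1}"
      "real (card {i\<in>A. \<tau> i \<noteq> 0}) \<ge> real (card A) / 10"
      "\<forall>j\<in>J. \<bar>\<Sum>i\<in>A \<inter> S j. real_of_int (\<tau> i)\<bar> \<le> \<Delta>" unfolding \<Delta>_def y_def by blast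
    define B where "B = {i\<in>A. \<tau> i = 0}"
    have "A = B \<union> {i\<in>A. \<tau> i \<noteq> 0}" by (auto simp: B_def)
    then have "card A = card B + card {i\<in>A. \<tau> i \<noteq> 0}"
      using A card_Un_disjoint[of B "{i\<in>A. \<tau> i \<noteq> 0}"] by (auto simp: B_def)
    then have B: "real (card B) \<le> 9 / 10 * real (card A)" using \<tau>(2) by linarith
    then have "card B < card A" using a by linarith
    moreover have "B \<subseteq> V" "card B \<le> card J" using less.prems \<open>card B < card A\<close> by (auto simp: B_def)
    ultimately obtain \<sigma> :: "'i \<Rightarrow> int" where \<sigma>: "\<forall>i\<in>B. \<sigma> i \<in> {-1, 1}"
      "\<forall>j\<in>J. \<bar>\<Sum>i\<in>B \<inter> S j. real_of_int (\<sigma> i)\<bar> \<le> (600 * root 6 (real (card B) / real (card J)) + 24) * sqrt t"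
      using less.hyps by blast
    have "root 6 (real (card B) / real (card J)) \<le> 59 / 60 * y"
    proof -
      have "real (card B) / real (card J) \<le> 9 / 10 * real (card A) / real (card J)"
        using B by (intro divide_right_mono) auto
      also have "\<dots> = 9 / 10 * y ^ 6" by (simp add: y_pos)
      \<comment> \<open>59/60 is a rational upper bound for the sixth root of 9/10.\<close>
      also have "\<dots> \<le> (59 / 60) ^ 6 * y ^ 6" using y by (intro mult_right_mono) (auto simp: power_divide)
      also have "\<dots> = (59 / 60 * y) ^ 6" by (rule power_mult_distrib[symmetric])
      finally have "root 6 (real (card B) / real (card J)) \<le> root 6 ((59 / 60 * y) ^ 6)"
        by (intro real_root_le_mono) auto
      also have "\<dots> = 59 / 60 * y" using y by (intro real_root_power_cancel) auto
      finally show ?thesis .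
    qed
    then have decay: "(600 * root 6 (real (card B) / real (card J)) + 24) * sqrt t \<le> (590 * y + 24) * sqrt t"
      by (intro mult_right_mono) auto
    define \<phi> where "\<phi> i = (if i \<in> B then \<sigma> i else \<tau> i)" for i
    have "\<bar>\<Sum>i\<in>A \<inter> S j. real_of_int (\<phi> i)\<bar> \<le> (600 * y + 24) * sqrt t" if j: "j \<in> J" for j
    proof -
      have "(\<Sum>i\<in>A \<inter> S j. real_of_int (\<phi> i)) = (\<Sum>i\<in>A \<inter> S j. (if i \<in> B then real_of_int (\<sigma> i) else 0) + real_of_int (\<tau> i))"
        by (intro sum.cong) (auto simp: \<phi>_def B_def)
      also have "\<dots> = (\<Sum>i\<in>A \<inter> S j \<inter> B. real_of_int (\<sigma> i)) + (\<Sum>i\<in>A \<inter> S j. real_of_int (\<tau> i))"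
        using A by (simp add: sum.distrib sum.inter_restrict)
      also have "A \<inter> S j \<inter> B = B \<inter> S j" by (auto simp: B_def)
      also have "\<bar>(\<Sum>i\<in>B \<inter> S j. real_of_int (\<sigma> i)) + (\<Sum>i\<in>A \<inter> S j. real_of_int (\<tau> i))\<bar> \<le> (590 * y + 24) * sqrt t + \<Delta>"
        using \<sigma>(2) \<tau>(3) j decay by (intro order.trans[OF abs_triangle_ineq add_mono]) force+
      also have "\<dots> = (600 * y + 24) * sqrt t" by (simp add: \<Delta>_def algebra_simps)
      finally show ?thesis .
    qed
    moreover have "\<forall>i\<in>A. \<phi> i \<in> {-1, 1}" using \<sigma>(1) \<tau>(1) by (auto simp: \<phi>_def B_def)
    ultimately show ?thesis unfolding y_def by blast
  qed
qed

text \<open>Once at most \<open>card J\<close> elements are fractional, every subset of them has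
  discrepancy at most \<open>624 * sqrt t\<close>, as \<open>y\<close> is at most 1. Rounding
  doubles this and adds 1, which is absorbed by \<open>sqrt t \<ge> 1\<close>.\<close>

lemma well_spread_rounding:
  fixes S :: "'j \<Rightarrow> 'i set" and x :: "'i \<Rightarrow> real"
  assumes V: "finite V" and J: "finite J" and deg: "\<forall>i\<in>V. card {j\<in>J. i \<in> S j} = t" and t: "t > 0"
    and spread: "well_spread V J S t" and x: "\<forall>i\<in>V. \<bar>x i\<bar> \<le> 1"
  shows "\<exists>\<sigma>::'i \<Rightarrow> int. (\<forall>i\<in>V. \<sigma> i \<in> {-1, 1}) \<and>
    (\<forall>j\<in>J. \<bar>\<Sum>i\<in>V \<inter> S j. real_of_int (\<sigma> i) - x i\<bar> \<le> 1249 * sqrt t)"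
proof -
  obtain x' where x': "\<forall>i\<in>V. \<bar>x' i\<bar> \<le> 1" "\<forall>j\<in>J. (\<Sum>i\<in>V \<inter> S j. x' i) = (\<Sum>i\<in>V \<inter> S j. x i)"
    "card {i\<in>V. \<bar>x' i\<bar> < 1} \<le> card J"
    using few_fractional[OF V J x, of S] by blast
  define A where "A = {i\<in>V. \<bar>x' i\<bar> < 1}"
  have A: "finite A" "A \<subseteq> V" "card A \<le> card J" using V x'(3) by (auto simp: A_def)
  have hered: "\<exists>\<sigma>::'i \<Rightarrow> int. (\<forall>i\<in>B. \<sigma> i \<in> {-1, 1}) \<and> (\<forall>j\<in>J. \<bar>\<Sum>i\<in>B \<inter> S j. real_of_int (\<sigma> i)\<bar> \<le> 624 * sqrt t)"
    if B: "B \<subseteq> A" for B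
  proof -
    have "card B \<le> card A" using A B by (intro card_mono)
    then have BJ: "B \<subseteq> V" "card B \<le> card J" using A B by auto
    have "real (card B) / real (card J) \<le> 1" using BJ by (auto simp: divide_le_eq_1)
    then have "root 6 (real (card B) / real (card J)) \<le> 1" by simp
    then have "(600 * root 6 (real (card B) / real (card J)) + 24) * sqrt t \<le> 624 * sqrt t"
      by (intro mult_right_mono) auto
    then show ?thesis
      using well_spread_hereditary_discrepancy[OF V J deg t spread BJ] by (meson order.trans)
  qed
  have "\<forall>i\<in>A. \<bar>x' i\<bar> \<le> 1" by (auto simp: A_def)
  then obtain \<sigma> :: "'i \<Rightarrow> int" where \<sigma>: "\<forall>i\<in>A. \<sigma> i \<in> {-1, 1}"
    "\<forall>j\<in>J. \<bar>\<Sum>i\<in>A \<inter> S j. real_of_int (\<sigma> i) - x' i\<bar> \<le> 2 * (624 * sqrt t) + 1"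
    using hereditary_rounding[OF A(1), of "624 * sqrt t" J S x'] hered by auto
  define \<phi> :: "'i \<Rightarrow> int" where "\<phi> i = (if i \<in> A then \<sigma> i else if x' i = 1 then 1 else -1)" for i
  have out: "x' i = real_of_int (\<phi> i)" if "i \<in> V" "i \<notin> A" for i
  proof -
    have "x' i = 1 \<or> x' i = -1" using x'(1) that by (force simp: A_def abs_if split: if_splits)
    then show ?thesis using that by (auto simp: \<phi>_def)
  qed
  have "\<bar>\<Sum>i\<in>V \<inter> S j. real_of_int (\<phi> i) - x i\<bar> \<le> 1249 * sqrt t" if j: "j \<in> J" for j
  proof -
    have "(\<Sum>i\<in>V \<inter> S j. real_of_int (\<phi> i) - x i) = (\<Sum>i\<in>V \<inter> S j. real_of_int (\<phi> i) - x' i)"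
      using x'(2) j by (simp add: sum_subtractf)
    also have "\<dots> = (\<Sum>i\<in>A \<inter> S j. real_of_int (\<phi> i) - x' i)"
    proof (intro sum.mono_neutral_right ballI)
      fix i assume "i \<in> V \<inter> S j - A \<inter> S j"
      then have "x' i = real_of_int (\<phi> i)" by (intro out) auto
      then show "real_of_int (\<phi> i) - x' i = 0" by simp
    qed (use V A(2) in auto)
    also have "\<dots> = (\<Sum>i\<in>A \<inter> S j. real_of_int (\<sigma> i) - x' i)" by (intro sum.cong) (auto simp: \<phi>_def)
    also have "\<bar>\<dots>\<bar> \<le> 2 * (624 * sqrt t) + 1" using \<sigma>(2) j by blast
    also have "\<dots> \<le> 1249 * sqrt t" using t by (simp add: Suc_leI)
    finally show ?thesis .
  qed
  moreover have "\<forall>i\<in>V. \<phi> i \<in> {-1, 1}" using \<sigma>(1) by (auto simp: \<phi>_def)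
  ultimately show ?thesis by blast
qed

section \<open>Random set systems are well spread\<close>

abbreviation t_subsets :: "nat \<Rightarrow> nat \<Rightarrow> nat set set" where
  "t_subsets m t \<equiv> {J. J \<subseteq> {1..m} \<and> card J = t}"

lemma finite_t_subsets: "finite (t_subsets m t)"
  by (rule finite_subset[of _ "Pow {1..m}"]) auto

lemma t_subsets_nonempty: "t \<le> m \<Longrightarrow> t_subsets m t \<noteq> {}"
  using obtain_subset_with_card_n[of t "{1..m}"] by auto

lemma card_t_subsets: "card (t_subsets m t) = m choose t"
  by (simp add: n_subsets)

section \<open>Containment probabilities and exponential moments of a uniform t-subset\<close>

lemma card_t_supersets:
  assumes Q: "Q \<subseteq> {1..m}" "card Q \<le> t"
  shows "card {T \<in> t_subsets m t. Q \<subseteq> T} = (m - card Q) choose (t - card Q)"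
proof -
  have fin: "finite Q" using Q finite_subset by blast
  have "bij_betw (\<lambda>U. U \<union> Q) {U. U \<subseteq> {1..m} - Q \<and> card U = t - card Q} {T \<in> t_subsets m t. Q \<subseteq> T}"
  proof (rule bij_betw_byWitness[where f' = "\<lambda>T. T - Q"])
    show "(\<lambda>U. U \<union> Q) ` {U. U \<subseteq> {1..m} - Q \<and> card U = t - card Q} \<subseteq> {T \<in> t_subsets m t. Q \<subseteq> T}"
    proof safe
      fix U assume U: "U \<subseteq> {1..m} - Q" "card U = t - card Q"
      then have "finite U" by (meson finite_Diff finite_atLeastAtMost finite_subset)
      then show "card (U \<union> Q) = t" using U Q fin by (subst card_Un_disjoint) auto
    qed (use Q in auto)
    show "(\<lambda>T. T - Q) ` {T \<in> t_subsets m t. Q \<subseteq> T} \<subseteq> {U. U \<subseteq> {1..m} - Q \<and> card U = t - card Q}"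
      using fin by (auto simp: card_Diff_subset)
  qed auto
  then have "card {T \<in> t_subsets m t. Q \<subseteq> T} = card {U. U \<subseteq> {1..m} - Q \<and> card U = t - card Q}"
    by (rule bij_betw_same_card[symmetric])
  also have "\<dots> = card ({1..m} - Q) choose (t - card Q)" by (rule n_subsets) simp
  also have "card ({1..m} - Q) = m - card Q" using Q fin by (simp add: card_Diff_subset)
  finally show ?thesis .
qed

text \<open>The ratio of the binomials is the product of the factors (t - i) / (m - i), none of
  which exceeds \<open>t / m\<close>.\<close>

lemma choose_diff_le:
  assumes "q \<le> t" "t \<le> m"
  shows "real ((m - q) choose (t - q)) \<le> (real t / real m) ^ q * real (m choose t)"
  using assms(1)
proof (induction q)
  case 0
  then show ?case by simp
next
  case (Suc q)
  let ?N = "m - q" and ?K = "t - q"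
  have pos: "?K > 0" "?N > 0" "m > 0" using Suc.prems assms by auto
  have "?K * (?N choose ?K) = ?N * ((?N - 1) choose (?K - 1))"
    using pos by (intro times_binomial_minus1_eq) auto
  then have "real ?K * real (?N choose ?K) = real ?N * real ((m - Suc q) choose (t - Suc q))"
    by (simp flip: of_nat_mult)
  then have "real ((m - Suc q) choose (t - Suc q)) = real ?K / real ?N * real (?N choose ?K)"
    using pos by (simp add: field_simps)
  also have "\<dots> \<le> real t / real m * ((real t / real m) ^ q * real (m choose t))"
  proof (intro mult_mono)
    have "real q * real t \<le> real q * real m" using assms by (intro mult_left_mono) auto
    then have "(real t - real q) * real m \<le> real t * (real m - real q)" by (simp add: algebra_simps)
    then show "real ?K / real ?N \<le> real t / real m" using pos Suc.prems assms
      by (simp add: frac_le_eq divide_le_0_iff of_nat_diff mult.commute)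
  qed (use Suc in auto)
  finally show ?case by (simp add: mult_ac)
qed

lemma prob_superset_le:
  assumes "t \<le> m" "Q \<subseteq> {1..m}"
  shows "measure_pmf.prob (pmf_of_set (t_subsets m t)) {T. Q \<subseteq> T} \<le> (real t / real m) ^ card Q"
proof -
  have pos: "real (m choose t) > 0" using assms by (simp add: zero_less_binomial_iff)
  have "t_subsets m t \<inter> {T. Q \<subseteq> T} = {T \<in> t_subsets m t. Q \<subseteq> T}" by auto
  then have prob: "measure_pmf.prob (pmf_of_set (t_subsets m t)) {T. Q \<subseteq> T} =
      real (card {T \<in> t_subsets m t. Q \<subseteq> T}) / real (m choose t)"
    using measure_pmf_of_set[OF t_subsets_nonempty[OF assms(1)] finite_t_subsets, of "{T. Q \<subseteq> T}"]
    by (simp only: card_t_subsets)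
  show ?thesis
  proof (cases "card Q \<le> t")
    case True
    then show ?thesis unfolding prob card_t_supersets[OF assms(2) True]
      using choose_diff_le[OF True assms(1)] pos by (simp add: pos_divide_le_eq)
  next
    case False
    have "\<not> Q \<subseteq> T" if "T \<in> t_subsets m t" for T
      using False that card_mono[of T Q] by (auto dest: finite_subset)
    then have "{T \<in> t_subsets m t. Q \<subseteq> T} = {}" by blast
    then show ?thesis unfolding prob by (simp only: card.empty) simp
  qed
qed

text \<open>Writing \<open>z\<close> as (z - 1) + 1 and expanding the product over \<open>R\<close>
  gives a combination of containment events. Its coefficients are nonnegative because
  \<open>z \<ge> 1\<close>, so each probability may be replaced by its value under independent
  sampling, after which the sum folds back into a product.\<close>

lemma hypergeometric_mgf_le:
  fixes z :: real
  assumes "t \<le> m" "m > 0" "R \<subseteq> {1..m}" "z \<ge> 1"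
  shows "measure_pmf.expectation (pmf_of_set (t_subsets m t)) (\<lambda>T. z ^ card (T \<inter> R))
    \<le> exp ((z - 1) * real t * real (card R) / real m)"
proof -
  define P where "P = pmf_of_set (t_subsets m t)"
  have "finite (set_pmf P)" unfolding P_def
    using t_subsets_nonempty[OF assms(1)] finite_t_subsets by simp
  then have int: "integrable (measure_pmf P) f" for f :: "nat set \<Rightarrow> real" by (rule integrable_measure_pmf_finite)
  have R: "finite R" using assms finite_subset by blast
  have expand: "z ^ card (T \<inter> R) = (\<Sum>Q\<in>Pow R. (z - 1) ^ card Q * indicator {T. Q \<subseteq> T} T)" for T
  proof -
    have "z ^ card (T \<inter> R) = (\<Prod>x\<in>R. if x \<in> T then z else 1)"
      using R by (simp add: prod.If_cases Int_commute)
    also have "\<dots> = (\<Prod>x\<in>R. (z - 1) * of_bool (x \<in> T) + 1)" by (intro prod.cong) auto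
    also have "\<dots> = (\<Sum>Q\<in>Pow R. (\<Prod>x\<in>Q. (z - 1) * of_bool (x \<in> T)) * (\<Prod>x\<in>R - Q. 1))"
      using R by (rule prod_add)
    also have "\<dots> = (\<Sum>Q\<in>Pow R. (z - 1) ^ card Q * indicator {T. Q \<subseteq> T} T)"
    proof (intro sum.cong refl)
      fix Q assume "Q \<in> Pow R"
      then have Q: "finite Q" using R finite_subset by blast
      have "(\<Prod>x\<in>Q. of_bool (x \<in> T) :: real) = indicator {T. Q \<subseteq> T} T"
      proof (cases "Q \<subseteq> T")
        case True
        then have "(\<Prod>x\<in>Q. of_bool (x \<in> T) :: real) = (\<Prod>x\<in>Q. 1)" by (intro prod.cong) auto
        then show ?thesis using True by simp
      qed (use Q in \<open>auto simp: prod_zero_iff\<close>)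
      then show "(\<Prod>x\<in>Q. (z - 1) * of_bool (x \<in> T)) * (\<Prod>x\<in>R - Q. 1) = (z - 1) ^ card Q * indicator {T. Q \<subseteq> T} T"
        by (simp add: prod.distrib)
    qed
    finally show ?thesis .
  qed
  have "measure_pmf.expectation P (\<lambda>T. z ^ card (T \<inter> R)) = (\<Sum>Q\<in>Pow R. (z - 1) ^ card Q * measure_pmf.prob P {T. Q \<subseteq> T})"
    unfolding expand by (subst Bochner_Integration.integral_sum[OF int]) simp
  also have "\<dots> \<le> (\<Sum>Q\<in>Pow R. (z - 1) ^ card Q * (real t / real m) ^ card Q)"
    unfolding P_def using assms by (intro sum_mono mult_left_mono prob_superset_le) auto
  also have "\<dots> = (\<Sum>Q\<in>Pow R. (\<Prod>x\<in>Q. (z - 1) * (real t / real m)) * (\<Prod>x\<in>R - Q. 1))"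
    by (simp only: prod_constant power_mult_distrib power_one mult_1_right)
  also have "\<dots> = (\<Prod>x\<in>R. (z - 1) * (real t / real m) + 1)" using R by (rule prod_add[symmetric])
  also have "\<dots> = (1 + (z - 1) * (real t / real m)) ^ card R" by (simp add: add.commute)
  also have "\<dots> \<le> exp ((z - 1) * (real t / real m)) ^ card R"
    using assms by (intro power_mono) auto
  also have "\<dots> = exp ((z - 1) * real t * real (card R) / real m)"
    by (simp add: mult_ac flip: exp_of_nat_mult)
  finally show ?thesis by (simp add: P_def)
qed

lemma set_pmf_random_incidence:
  assumes "t \<le> m"
  shows "set_pmf (random_incidence n m t) = PiE_dflt {1..n} {} (\<lambda>_. t_subsets m t)"
  unfolding random_incidence_def using t_subsets_nonempty[OF assms] finite_t_subsets
  by (subst set_Pi_pmf) (auto simp: o_def)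

lemma integrable_random_incidence:
  fixes f :: "(nat \<Rightarrow> nat set) \<Rightarrow> real"
  assumes "t \<le> m"
  shows "integrable (measure_pmf (random_incidence n m t)) f"
  using assms finite_t_subsets
  by (intro integrable_measure_pmf_finite) (auto simp: set_pmf_random_incidence)

text \<open>Chernoff's bound for the block of elements \<open>A\<close> and sets \<open>R\<close>.
  The parameter \<open>s\<close> stays free: it is 1 for large \<open>A\<close> and grows with
  \<open>m / card A\<close> for small \<open>A\<close>.\<close>

lemma prob_many_incidences:
  fixes s :: real
  assumes "t \<le> m" "m > 0" "A \<subseteq> {1..n}" "R \<subseteq> {1..m}" "s \<ge> 0"
  shows "measure_pmf.prob (random_incidence n m t) {T. E \<le> (\<Sum>i\<in>A. real (card (T i \<inter> R)))}
    \<le> exp ((exp s - 1) * real t * real (card A) * real (card R) / real m - s * E)"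
proof (cases "s = 0")
  case False
  then have s: "s > 0" using assms by simp
  define P where "P = pmf_of_set (t_subsets m t)"
  have intP: "integrable (measure_pmf P) f" for f :: "nat set \<Rightarrow> real"
    unfolding P_def using t_subsets_nonempty[OF assms(1)] finite_t_subsets
    by (intro integrable_measure_pmf_finite) simp
  define f where "f i X = (if i \<in> A then exp s ^ card (X \<inter> R) else 1)" for i :: nat and X :: "nat set"
  define c where "c = (exp s - 1) * real t * real (card R) / real m"
  have A: "finite A" using assms finite_subset by blast
  have prod_eq: "(\<Prod>i\<in>{1..n}. f i (T i)) = exp (s * (\<Sum>i\<in>A. real (card (T i \<inter> R))))" for T
  proof -
    have "(\<Prod>i\<in>{1..n}. f i (T i)) = (\<Prod>i\<in>A. exp s ^ card (T i \<inter> R))"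
      unfolding f_def using assms(3) by (simp add: prod.If_cases Int_absorb1)
    also have "\<dots> = (\<Prod>i\<in>A. exp (s * real (card (T i \<inter> R))))"
      by (simp add: mult.commute flip: exp_of_nat_mult)
    finally show ?thesis using A by (simp add: exp_sum sum_distrib_left)
  qed
  have "measure_pmf.prob (random_incidence n m t) {T. E \<le> (\<Sum>i\<in>A. real (card (T i \<inter> R)))}
    = measure (measure_pmf (random_incidence n m t))
        {T \<in> space (measure_pmf (random_incidence n m t)). (\<Prod>i\<in>{1..n}. f i (T i)) \<ge> exp (s * E)}"
    unfolding prod_eq using s by simp
  also have "\<dots> \<le> measure_pmf.expectation (random_incidence n m t) (\<lambda>T. \<Prod>i\<in>{1..n}. f i (T i)) / exp (s * E)"
  proof (intro integral_Markov_inequality_measure[where A = "{}"] integrable_random_incidence assms)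
    show "AE T in measure_pmf (random_incidence n m t). 0 \<le> (\<Prod>i\<in>{1..n}. f i (T i))"
      unfolding prod_eq by simp
  qed auto
  also have "measure_pmf.expectation (random_incidence n m t) (\<lambda>T. \<Prod>i\<in>{1..n}. f i (T i))
    = (\<Prod>i\<in>{1..n}. measure_pmf.expectation P (f i))"
    unfolding random_incidence_def P_def[symmetric]
    by (intro expectation_prod_Pi_pmf intP) (auto simp: f_def)
  also have "\<dots> \<le> (\<Prod>i\<in>{1..n}. if i \<in> A then exp c else 1)"
  proof (intro prod_mono conjI)
    fix i
    show "measure_pmf.expectation P (f i) \<le> (if i \<in> A then exp c else 1)"
      using hypergeometric_mgf_le[OF assms(1,2,4), of "exp s"] s
      by (cases "i \<in> A") (simp_all add: f_def [abs_def] c_def P_def)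
    show "measure_pmf.expectation P (f i) \<ge> 0" by (intro integral_nonneg_AE) (auto simp: f_def)
  qed
  also have "\<dots> = exp (c * real (card A))"
    using assms(3) by (simp add: prod.If_cases Int_absorb1 mult.commute flip: exp_of_nat_mult)
  finally show ?thesis by (simp add: c_def exp_diff divide_right_mono mult_ac)
qed (simp add: measure_pmf.prob_le_1)

section \<open>Counting estimates and the union bound\<close>

lemma power_div_fact_le_exp:
  fixes x :: real
  assumes "x \<ge> 0"
  shows "x ^ k / fact k \<le> exp x"
proof -
  have "(\<Sum>n\<in>{k}. x ^ n /\<^sub>R fact n) \<le> (\<Sum>n. x ^ n /\<^sub>R fact n)"
    using assms sums_summable[OF exp_converges[of x]] by (intro sum_le_suminf) auto
  also have "\<dots> = exp x" by (rule sums_unique[OF exp_converges, symmetric])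
  finally show ?thesis by (simp add: divide_inverse mult.commute)
qed

text \<open>The estimate (e X / a)^a in exponential form, ready to be multiplied with tail bounds; a
  real \<open>X\<close> admits bounds on the number of elements that are not integers.\<close>

lemma binomial_le_exp:
  fixes X :: real
  assumes a: "a > 0" and X: "real N \<le> X" "X > 0"
  shows "real (N choose a) \<le> exp (real a * (1 + ln (X / real a)))"
proof -
  have "real (N choose a) * fact a \<le> real N ^ a"
    using binomial_fact_pow[of N a] by (metis of_nat_fact of_nat_le_iff of_nat_mult of_nat_power)
  also have "\<dots> \<le> X ^ a" using X by (intro power_mono) auto
  finally have 1: "real (N choose a) * fact a \<le> X ^ a" .
  have "real a ^ a \<le> exp (real a) * fact a"
    using power_div_fact_le_exp[of "real a" a] by (simp add: divide_le_eq)
  then have "real (N choose a) * real a ^ a \<le> real (N choose a) * (exp (real a) * fact a)"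
    by (intro mult_left_mono) auto
  also have "\<dots> = exp (real a) * (real (N choose a) * fact a)" by simp
  also have "\<dots> \<le> exp (real a) * X ^ a" using 1 by (intro mult_left_mono) auto
  finally have "real (N choose a) \<le> exp (real a) * (X ^ a / real a ^ a)" using a by (simp add: field_simps)
  also have "X ^ a / real a ^ a = exp (real a * ln (X / real a))"
    using a X by (simp add: power_divide exp_of_nat_mult)
  finally show ?thesis by (simp add: distrib_left exp_add)
qed

definition rows :: "nat \<Rightarrow> (nat \<Rightarrow> nat set) \<Rightarrow> nat \<Rightarrow> nat set" where
  "rows n T j = {i \<in> {1..n}. j \<in> T i}"

lemma sum_card_rows:
  assumes "A \<subseteq> {1..n}" "finite R"
  shows "(\<Sum>j\<in>R. real (card (A \<inter> rows n T j))) = (\<Sum>i\<in>A. real (card (T i \<inter> R)))"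
proof -
  have A: "finite A" using assms finite_subset by blast
  have "(\<Sum>j\<in>R. real (card (A \<inter> rows n T j))) = (\<Sum>j\<in>R. \<Sum>i\<in>A. of_bool (j \<in> T i))"
  proof (intro sum.cong refl)
    fix j
    have "A \<inter> rows n T j = A \<inter> {i. j \<in> T i}" using assms by (auto simp: rows_def)
    then show "real (card (A \<inter> rows n T j)) = (\<Sum>i\<in>A. of_bool (j \<in> T i))" using A by simp
  qed
  also have "\<dots> = (\<Sum>i\<in>A. \<Sum>j\<in>R. of_bool (j \<in> T i))" by (rule sum.swap)
  also have "\<dots> = (\<Sum>i\<in>A. real (card (T i \<inter> R)))"
  proof (intro sum.cong refl)
    fix i
    have "R \<inter> {j. j \<in> T i} = T i \<inter> R" by auto
    then show "(\<Sum>j\<in>R. of_bool (j \<in> T i)) = real (card (T i \<inter> R))" using assms by simp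
  qed
  finally show ?thesis .
qed

lemma prob_some_subset_le:
  fixes P :: "'a pmf" and V :: "'v set"
  assumes V: "finite V" and W: "finite W"
    and le: "\<And>A R. A \<subseteq> V \<Longrightarrow> card A = a \<Longrightarrow> R \<in> W \<Longrightarrow> measure_pmf.prob P (F A R) \<le> p"
  shows "measure_pmf.prob P {T. \<exists>A R. A \<subseteq> V \<and> card A = a \<and> R \<in> W \<and> T \<in> F A R}
    \<le> real (card V choose a) * real (card W) * p"
proof -
  define I where "I = {A. A \<subseteq> V \<and> card A = a} \<times> W"
  have I: "finite I" "card I = (card V choose a) * card W"
    using V W by (auto simp: I_def n_subsets card_cartesian_product intro!: finite_cartesian_product)
  have "{T. \<exists>A R. A \<subseteq> V \<and> card A = a \<and> R \<in> W \<and> T \<in> F A R} = (\<Union>(A, R)\<in>I. F A R)" by (auto simp: I_def)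
  also have "measure_pmf.prob P \<dots> \<le> (\<Sum>(A, R)\<in>I. measure_pmf.prob P (F A R))"
    using measure_pmf.finite_measure_subadditive_finite[of I "\<lambda>(A, R). F A R" P] I(1) by (simp add: case_prod_unfold)
  also have "\<dots> \<le> (\<Sum>(A, R)\<in>I. p)" using le by (intro sum_mono) (auto simp: I_def)
  also have "\<dots> = real (card V choose a) * real (card W) * p" by (simp add: I)
  finally show ?thesis .
qed

lemma ln_le_self: "x > 0 \<Longrightarrow> ln x \<le> (x::real)"
  using ln_le_minus_one[of x] by linarith

text \<open>A violation for \<open>A\<close> exhibits a block of \<open>A\<close> and some
  \<open>R\<close> with too many incidences, so a union bound over such blocks applies. With
  \<open>a = card A\<close>, choosing \<open>A\<close> costs the exponent
  \<open>a * (1 + s + ln (m / a))\<close>. Choosing \<open>R\<close> costs at most \<open>m\<close>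
  when \<open>A\<close> is large and \<open>a * (1 + ln (m / a))\<close> when it is small, where
  \<open>a\<close> heavy rows suffice. Each tail leaves \<open>exp (- (5 * a * s))\<close> after
  paying for both choices.\<close>

lemma prob_not_well_spread:
  fixes N :: real
  assumes tm: "t \<le> m" and t: "t \<ge> 8000" and V: "V \<subseteq> {1..n}" "real (card V) \<le> N" "N > 0"
    and N: "ln (N / real m) \<le> sqrt t"
  shows "measure_pmf.prob (random_incidence n m t) {T. \<not> well_spread V {1..m} (rows n T) t} \<le> 2 / sqrt t"
proof -
  define P where "P = random_incidence n m t"
  have m: "m > 0" using tm t by simp
  have finV: "finite V" using V finite_subset by blast
  define s where "s = sqrt t"
  have s2: "s * s = real t" using t by (simp add: s_def)
  have s: "s \<ge> 2" unfolding s_def using t by (intro real_le_rsqrt) simp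
  define y where "y a = root 6 (real a / real m)" for a
  \<comment> \<open>Both lower bounds hold for the set \<open>R\<close> of heavy rows: one is the
    violated inequality, the other says that each row has more than four times its mean. Together
    they make the Chernoff exponent with parameter 1 at least half the count.\<close>
  define F1 where "F1 A R = {T. max (real (card A) * real t * (y (card A))\<^sup>2) (4 * real t * real (card A) * real (card R) / real m)
     \<le> (\<Sum>i\<in>A. real (card (T i \<inter> R)))}"
    for A :: "nat set" and R :: "nat set"
  define F2 where "F2 A R = {T. 12 * s * real (card A) \<le> (\<Sum>i\<in>A. real (card (T i \<inter> R)))}"
    for A :: "nat set" and R :: "nat set"
  define B1 where "B1 a = {T. \<exists>A R. A \<subseteq> V \<and> card A = a \<and> R \<in> Pow {1..m} \<and> T \<in> F1 A R}" for a
  define B2 where "B2 a = {T. \<exists>A R. A \<subseteq> V \<and> card A = a \<and> R \<in> {R. R \<subseteq> {1..m} \<and> card R = a} \<and> T \<in> F2 A R}" for a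
  define I1 where "I1 = {a \<in> {1..m}. real m \<le> real a * s}"
  define I2 where "I2 = {a \<in> {1..m}. real a * s \<le> real m}"
  have cover: "{T. \<not> well_spread V {1..m} (rows n T) t} \<subseteq> (\<Union>a\<in>I1. B1 a) \<union> (\<Union>a\<in>I2. B2 a)"
  proof
    fix T assume "T \<in> {T. \<not> well_spread V {1..m} (rows n T) t}"
    then have "\<not> well_spread V {1..m} (rows n T) t" by simp
    then obtain A where A: "A \<subseteq> V" "A \<noteq> {}" "card A \<le> m" and
      alt: "(real m \<le> real (card A) * s \<and>
        \<not> (\<Sum>j\<in>{j\<in>{1..m}. real (card (A \<inter> rows n T j)) > 4 * real t * (real (card A) / real m)}. real (card (A \<inter> rows n T j)))
         \<le> real (card A) * real t * (y (card A))\<^sup>2) \<or>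
       (real (card A) * s \<le> real m \<and>
         \<not> card {j\<in>{1..m}. real (card (A \<inter> rows n T j)) > 12 * s} < card A)"
      unfolding well_spread_def y_def s_def card_atLeastAtMost diff_Suc_1 by blast
    have An: "A \<subseteq> {1..n}" using A V by blast
    have a: "card A \<in> {1..m}" using A finV by (auto simp: card_gt_0_iff Suc_le_eq finite_subset)
    from alt show "T \<in> (\<Union>a\<in>I1. B1 a) \<union> (\<Union>a\<in>I2. B2 a)"
    proof
      define R where "R = {j\<in>{1..m}. real (card (A \<inter> rows n T j)) > 4 * real t * (real (card A) / real m)}"
      assume "real m \<le> real (card A) * s \<and>
        \<not> (\<Sum>j\<in>{j\<in>{1..m}. real (card (A \<inter> rows n T j)) > 4 * real t * (real (card A) / real m)}. real (card (A \<inter> rows n T j)))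
         \<le> real (card A) * real t * (y (card A))\<^sup>2"
      then have h: "real m \<le> real (card A) * s"
        "real (card A) * real t * (y (card A))\<^sup>2 \<le> (\<Sum>j\<in>R. real (card (A \<inter> rows n T j)))"
        by (auto simp: R_def)
      have R: "finite R" "R \<subseteq> {1..m}" by (auto simp: R_def)
      have "real (card R) * (4 * real t * (real (card A) / real m)) \<le> (\<Sum>j\<in>R. real (card (A \<inter> rows n T j)))"
        by (rule sum_bounded_below) (auto simp: R_def)
      then have "4 * real t * real (card A) * real (card R) / real m \<le> (\<Sum>j\<in>R. real (card (A \<inter> rows n T j)))"
        by (simp add: mult_ac)
      then have "T \<in> F1 A R" using h(2) by (simp add: F1_def sum_card_rows[OF An R(1)])
      then have "T \<in> B1 (card A)" using A R by (auto simp: B1_def)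
      then show ?thesis using h(1) a by (auto simp: I1_def)
    next
      assume "real (card A) * s \<le> real m \<and> \<not> card {j\<in>{1..m}. real (card (A \<inter> rows n T j)) > 12 * s} < card A"
      then have h: "real (card A) * s \<le> real m"
        and "card A \<le> card {j\<in>{1..m}. real (card (A \<inter> rows n T j)) > 12 * s}" by auto
      from obtain_subset_with_card_n[OF this(2)]
      obtain R where R: "R \<subseteq> {j\<in>{1..m}. real (card (A \<inter> rows n T j)) > 12 * s}" "card R = card A" "finite R"
        by blast
      have "real (card R) * (12 * s) \<le> (\<Sum>j\<in>R. real (card (A \<inter> rows n T j)))"
        by (rule sum_bounded_below) (use R in force)
      then have "T \<in> F2 A R" by (simp add: F2_def sum_card_rows[OF An R(3)] R mult_ac)
      then have "T \<in> B2 (card A)" using A R unfolding B2_def by blast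
      then show ?thesis using h a by (auto simp: I2_def)
    qed
  qed
  \<comment> \<open>The factor \<open>(1 / 2) ^ a\<close> makes the sum over all sizes converge;
    \<open>1 / s\<close> is the probability finally claimed.\<close>
  have decay: "exp (- (5 * real a * s)) \<le> (1 / 2) ^ a / s" if "a \<ge> 1" for a :: nat
  proof -
    have "real a + s \<le> real a * s + real a * s"
      using that s by (intro add_mono) (auto simp: mult_le_cancel_left1 mult_le_cancel_right1)
    moreover have "real a * s \<ge> 0" using s by simp
    ultimately have "- (5 * (real a * s)) \<le> - real a - s" by linarith
    then have "exp (- (5 * real a * s)) \<le> exp (- real a - s)" by (simp add: mult.assoc)
    also have "\<dots> = exp (- 1) ^ a * exp (- s)" by (simp add: exp_diff exp_minus power_inverse divide_inverse flip: exp_of_nat_mult)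
    also have "\<dots> \<le> (1 / 2) ^ a * (1 / s)"
    proof (intro mult_mono power_mono)
      show "exp (- 1) \<le> (1 / 2 :: real)" using exp_ge_add_one_self[of "1::real"] by (simp add: exp_minus field_simps)
      have "s \<le> exp s" using exp_ge_add_one_self[of s] by linarith
      then show "exp (- s) \<le> 1 / s" using s by (simp add: exp_minus field_simps)
    qed (use s in auto)
    finally show ?thesis by simp
  qed
  have binom_V: "real (card V choose a) \<le> exp (real a * (1 + s + ln (real m / real a)))" if "a \<in> {1..m}" for a
  proof -
    have "real (card V choose a) \<le> exp (real a * (1 + ln (N / real a)))"
      using that V by (intro binomial_le_exp) auto
    also have "ln (N / real a) = ln (N / real m) + ln (real m / real a)"
      using V m that by (simp add: ln_div)
    also have "real a * (1 + (ln (N / real m) + ln (real m / real a))) \<le> real a * (1 + s + ln (real m / real a))"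
      using N by (intro mult_left_mono) (auto simp: s_def)
    finally show ?thesis by simp
  qed
  have B1: "measure_pmf.prob P (B1 a) \<le> (1 / 2) ^ a / s" if a: "a \<in> I1" for a
  proof -
    have a1: "a \<in> {1..m}" "real m \<le> real a * s" "real a > 0" using a by (auto simp: I1_def)
    have y6: "y a ^ 6 = real a / real m" "y a \<ge> 0" by (auto simp: y_def)
    \<comment> \<open>Source of the threshold 8000, which is 20 cubed. The cube of the left side is
      s^2 times \<open>s * a / m\<close>; here s^2 = \<open>t\<close>, and the second factor is at
      least 1 in this range.\<close>
    have sy: "s * (y a)\<^sup>2 \<ge> 20"
    proof (rule ccontr)
      assume "\<not> ?thesis"
      then have "(s * (y a)\<^sup>2) ^ 3 < 20 ^ 3" using s by (intro power_strict_mono) auto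
      moreover have "(s * (y a)\<^sup>2) ^ 3 = s * s * (s * y a ^ 6)" by (simp add: power_mult_distrib power3_eq_cube flip: power_mult)
      moreover have "s * y a ^ 6 \<ge> 1" using a1 m by (simp add: y6 field_simps)
      then have "s * s * 1 \<le> s * s * (s * y a ^ 6)" using s by (intro mult_left_mono) auto
      moreover have "s * s \<ge> 8000" using t by (simp add: s2)
      moreover have "(20 :: real) ^ 3 = 8000" by simp
      ultimately show False by linarith
    qed
    have F1: "measure_pmf.prob P (F1 A R) \<le> exp (- (10 * real a * s))"
      if AR: "A \<subseteq> V" "card A = a" "R \<in> Pow {1..m}" for A R
    proof -
      define E where "E = max (real a * real t * (y a)\<^sup>2) (4 * real t * real a * real (card R) / real m)"
      have "measure_pmf.prob P (F1 A R) \<le> exp ((exp 1 - 1) * real t * real a * real (card R) / real m - 1 * E)"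
        unfolding P_def F1_def using prob_many_incidences[OF tm m, of A n R 1 E] AR V by (auto simp: E_def)
      also have "\<dots> \<le> exp (- (E / 2))"
      proof -
        have "(exp 1 - 1) * (real t * real a * real (card R) / real m) \<le> 2 * (real t * real a * real (card R) / real m)"
          using exp_le by (intro mult_right_mono) auto
        moreover have "4 * real t * real a * real (card R) / real m \<le> E" by (simp add: E_def)
        ultimately show ?thesis by (simp add: mult_ac)
      qed
      also have "\<dots> \<le> exp (- (10 * real a * s))"
      proof -
        have "real a * s * 20 \<le> real a * s * (s * (y a)\<^sup>2)" using sy s by (intro mult_left_mono) auto
        also have "\<dots> = real a * (s * s) * (y a)\<^sup>2" by (simp add: mult_ac)
        also have "\<dots> \<le> E" by (simp add: E_def s2)
        finally show ?thesis by simp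
      qed
      finally show ?thesis .
    qed
    have "measure_pmf.prob P (B1 a) \<le> real (card V choose a) * real (card (Pow {1..m})) * exp (- (10 * real a * s))"
      unfolding B1_def by (intro prob_some_subset_le finV F1) auto
    also have "\<dots> \<le> exp (real a * (1 + s + ln (real m / real a))) * exp (real a * s) * exp (- (10 * real a * s))"
    proof (intro mult_mono)
      \<comment> \<open>All subsets \<open>R\<close> can be afforded because \<open>m\<close> is at
        most \<open>a * s\<close> in this range.\<close>
      have "real (card (Pow {1..m})) = 2 ^ m" by (simp add: card_Pow)
      also have "\<dots> \<le> exp 1 ^ m" using exp_ge_add_one_self[of 1] by (intro power_mono) auto
      also have "\<dots> = exp (real m)" by (simp flip: exp_of_nat_mult)
      also have "\<dots> \<le> exp (real a * s)" using a1 by simp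
      finally show "real (card (Pow {1..m})) \<le> exp (real a * s)" .
    qed (use binom_V a1 in auto)
    also have "\<dots> = exp (real a * (1 + s + ln (real m / real a)) + real a * s + - (10 * real a * s))"
      by (simp only: exp_add)
    also have "\<dots> \<le> exp (- (5 * real a * s))"
    proof -
      have "ln (real m / real a) \<le> ln s" using a1 m s by (subst ln_le_cancel_iff) (auto simp: field_simps)
      then have "1 + s + ln (real m / real a) \<le> 3 * s" using ln_le_self[of s] s by linarith
      then have "real a * (1 + s + ln (real m / real a)) \<le> real a * (3 * s)" by (intro mult_left_mono) auto
      moreover have "real a * s \<ge> 0" using s by simp
      ultimately show ?thesis by (simp add: algebra_simps)
    qed
    also have "\<dots> \<le> (1 / 2) ^ a / s" using a1 by (intro decay) auto
    finally show ?thesis .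
  qed
  have B2: "measure_pmf.prob P (B2 a) \<le> (1 / 2) ^ a / s" if a: "a \<in> I2" for a
  proof -
    have a1: "a \<in> {1..m}" "real a * s \<le> real m" "real a > 0" using a by (auto simp: I2_def)
    \<comment> \<open>With Chernoff parameter \<open>1 + w\<close> the factor \<open>exp w\<close>
      cancels the sparsity of a small block, turning the mean term into
      \<open>exp 1 * a * s\<close>, while the gain becomes
      \<open>(1 + w) * 12 * s * a\<close>.\<close>
    define w where "w = ln (real m / (real a * s))"
    have w: "w \<ge> 0" "exp w = real m / (real a * s)" using a1 m s by (auto simp: w_def field_simps)
    have ln_ma: "ln (real m / real a) = w + ln s" using a1 m s by (simp add: w_def ln_div ln_mult)
    have F2: "measure_pmf.prob P (F2 A R) \<le> exp (3 * real a * s - (1 + w) * (12 * s * real a))"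
      if AR: "A \<subseteq> V" "card A = a" "R \<in> {R. R \<subseteq> {1..m} \<and> card R = a}" for A R
    proof -
      have "measure_pmf.prob P (F2 A R) \<le> exp ((exp (1 + w) - 1) * real t * real a * real a / real m - (1 + w) * (12 * s * real a))"
        unfolding P_def F2_def using prob_many_incidences[OF tm m, of A n R "1 + w" "12 * s * real a"] AR V w by auto
      also have "\<dots> \<le> exp (3 * real a * s - (1 + w) * (12 * s * real a))"
      proof -
        have "(exp (1 + w) - 1) * (real t * real a * real a / real m) \<le> exp (1 + w) * (real t * real a * real a / real m)"
          by (intro mult_right_mono) auto
        also have "\<dots> = exp 1 * (real a * s)" using a1 m s by (simp add: exp_add w(2) flip: s2)
        also have "\<dots> \<le> 3 * (real a * s)" using exp_le s by (intro mult_right_mono) auto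
        finally show ?thesis by (simp add: mult_ac)
      qed
      finally show ?thesis .
    qed
    have "measure_pmf.prob P (B2 a) \<le> real (card V choose a) * real (card {R. R \<subseteq> {1..m} \<and> card R = a})
        * exp (3 * real a * s - (1 + w) * (12 * s * real a))"
      unfolding B2_def by (intro prob_some_subset_le finV F2) (auto intro: finite_t_subsets)
    also have "\<dots> \<le> exp (real a * (1 + s + (w + ln s))) * exp (real a * (1 + (w + ln s)))
        * exp (3 * real a * s - (1 + w) * (12 * s * real a))"
    proof (intro mult_mono)
      have "real (card {R. R \<subseteq> {1..m} \<and> card R = a}) = real (m choose a)" by (simp only: card_t_subsets)
      also have "\<dots> \<le> exp (real a * (1 + ln (real m / real a)))" using a1 m by (intro binomial_le_exp) auto
      finally show "real (card {R. R \<subseteq> {1..m} \<and> card R = a}) \<le> exp (real a * (1 + (w + ln s)))" by (simp only: ln_ma)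
    qed (use binom_V[OF a1(1)] in \<open>auto simp: ln_ma\<close>)
    also have "\<dots> = exp (real a * (1 + s + (w + ln s)) + real a * (1 + (w + ln s)) + (3 * real a * s - (1 + w) * (12 * s * real a)))"
      by (simp add: exp_add)
    also have "\<dots> \<le> exp (- (5 * real a * s))"
    proof -
      \<comment> \<open>Per element of \<open>A\<close> the two choices cost
        \<open>2 + s + 2 * w + 2 * ln s\<close> and the mean term \<open>3 * s\<close>. The part of
        the gain proportional to \<open>w\<close> pays for \<open>2 * w\<close>; the rest reduces to
        \<open>2 + 2 * ln s \<le> 3 * s\<close>, which follows from \<open>ln s \<le> s\<close> and
        \<open>s \<ge> 2\<close>.\<close>
      have "w * 2 \<le> w * (12 * s)" using w s by (intro mult_left_mono) auto
      then have "2 + s + 2 * w + 2 * ln s + 3 * s - 12 * s - w * (12 * s) \<le> - (5 * s)"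
        using ln_le_self[of s] s by linarith
      then have "real a * (2 + s + 2 * w + 2 * ln s + 3 * s - 12 * s - w * (12 * s)) \<le> real a * (- (5 * s))"
        by (intro mult_left_mono) auto
      then show ?thesis by (simp add: algebra_simps)
    qed
    also have "\<dots> \<le> (1 / 2) ^ a / s" using a1 by (intro decay) auto
    finally show ?thesis .
  qed
  have geom: "(\<Sum>a\<in>I. (1 / 2) ^ a / s) \<le> 1 / s" if "I \<subseteq> {1..m}" for I
  proof -
    have "(\<Sum>a\<in>I. (1 / 2 :: real) ^ a) \<le> (\<Sum>a\<in>{1..m}. (1 / 2) ^ a)" using that by (intro sum_mono2) auto
    also have "\<dots> \<le> 1" using m by (subst sum_gp) auto
    finally show ?thesis using s by (simp add: divide_right_mono flip: sum_divide_distrib)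
  qed
  have I: "finite I1" "finite I2" "I1 \<subseteq> {1..m}" "I2 \<subseteq> {1..m}" by (auto simp: I1_def I2_def)
  have "measure_pmf.prob P {T. \<not> well_spread V {1..m} (rows n T) t} \<le> measure_pmf.prob P ((\<Union>a\<in>I1. B1 a) \<union> (\<Union>a\<in>I2. B2 a))"
    using cover by (intro measure_pmf.finite_measure_mono) auto
  also have "\<dots> \<le> measure_pmf.prob P (\<Union>a\<in>I1. B1 a) + measure_pmf.prob P (\<Union>a\<in>I2. B2 a)"
    by (intro measure_Un_le) auto
  also have "\<dots> \<le> (\<Sum>a\<in>I1. measure_pmf.prob P (B1 a)) + (\<Sum>a\<in>I2. measure_pmf.prob P (B2 a))"
    using I by (intro add_mono measure_pmf.finite_measure_subadditive_finite) auto
  also have "\<dots> \<le> (\<Sum>a\<in>I1. (1 / 2) ^ a / s) + (\<Sum>a\<in>I2. (1 / 2) ^ a / s)"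
    using B1 B2 by (intro add_mono sum_mono)
  also have "\<dots> \<le> 1 / s + 1 / s" using I by (intro add_mono geom)
  finally show ?thesis by (simp add: P_def s_def)
qed

section \<open>Balancing a fixed imbalance by random elements\<close>

text \<open>Arbitrarily negative arguments are covered, so the tail bound below asks only for an
  upper bound on \<open>\<theta> * h\<close>. For them the reciprocal is estimated:
  \<open>1 - u + u\<^sup>2\<close> times the quadratic Taylor polynomial of \<open>exp u\<close> is
  at least 1.\<close>

lemma exp_le_quadratic:
  fixes x :: real
  assumes "x \<le> 1"
  shows "exp x \<le> 1 + x + x\<^sup>2"
proof (cases "x \<ge> 0")
  case True
  then show ?thesis using assms by (intro exp_bound) auto
next
  case False
  define u where "u = - x"
  have u: "u > 0" using False by (simp add: u_def)
  have "1 + u + u\<^sup>2 / 2 \<le> exp u" using u by (intro exp_lower_Taylor_quadratic) auto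
  moreover have "1 \<le> (1 - u + u\<^sup>2) * (1 + u + u\<^sup>2 / 2)"
  proof -
    have "(1 - u + u\<^sup>2) * (1 + u + u\<^sup>2 / 2) = 1 + (u\<^sup>2 + u ^ 3 + u ^ 4) / 2"
      by (simp add: field_simps power2_eq_square power3_eq_cube power4_eq_xxxx)
    then show ?thesis using u by simp
  qed
  moreover have "1 - u + u\<^sup>2 \<ge> 0" using zero_le_power2[of "u - 1/2"] by (simp add: power2_eq_square algebra_simps)
  ultimately have "1 \<le> (1 - u + u\<^sup>2) * exp u" by (meson mult_left_mono order.trans)
  then have "exp (- u) \<le> 1 - u + u\<^sup>2" by (simp add: exp_minus field_simps)
  then show ?thesis by (simp add: u_def)
qed

text \<open>Bernstein's argument, with the raw second moment in place of the variance. This loses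
  nothing of importance for a variable that vanishes except with small probability.\<close>

lemma Pi_pmf_upper_tail:
  fixes P :: "'b pmf" and h :: "'b \<Rightarrow> real"
  assumes V: "finite V" and P: "finite (set_pmf P)" and \<theta>: "\<theta> > 0"
    and bound: "\<And>T. T \<in> set_pmf P \<Longrightarrow> \<theta> * h T \<le> 1"
    and variance: "measure_pmf.expectation P (\<lambda>T. (h T)\<^sup>2) \<le> v"
  shows "measure_pmf.prob (Pi_pmf V d (\<lambda>_. P)) {f. (\<Sum>i\<in>V. h (f i)) \<ge> real (card V) * measure_pmf.expectation P h + \<epsilon>}
    \<le> exp (real (card V) * \<theta>\<^sup>2 * v - \<theta> * \<epsilon>)"
proof -
  define \<mu> where "\<mu> = measure_pmf.expectation P h"
  let ?M = "Pi_pmf V d (\<lambda>_. P)"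
  have intP: "integrable (measure_pmf P) f" for f :: "'b \<Rightarrow> real" using P by (rule integrable_measure_pmf_finite)
  have intM: "integrable (measure_pmf ?M) f" for f :: "('a \<Rightarrow> 'b) \<Rightarrow> real"
    using V P by (intro integrable_measure_pmf_finite) (auto simp: set_Pi_pmf intro!: finite_PiE_dflt)
  have prod_eq: "(\<Prod>i\<in>V. exp (\<theta> * h (f i))) = exp (\<theta> * (\<Sum>i\<in>V. h (f i)))" for f :: "'a \<Rightarrow> 'b"
    using V by (simp add: exp_sum sum_distrib_left)
  have "measure_pmf.expectation P (\<lambda>T. exp (\<theta> * h T)) \<le> measure_pmf.expectation P (\<lambda>T. 1 + \<theta> * h T + \<theta>\<^sup>2 * (h T)\<^sup>2)"
    using exp_le_quadratic[OF bound]
    by (intro integral_mono_AE intP) (auto simp: AE_measure_pmf_iff power_mult_distrib)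
  also have "\<dots> = 1 + \<theta> * \<mu> + \<theta>\<^sup>2 * measure_pmf.expectation P (\<lambda>T. (h T)\<^sup>2)"
    using intP by (simp add: \<mu>_def)
  also have "\<dots> \<le> 1 + (\<theta> * \<mu> + \<theta>\<^sup>2 * v)" using mult_left_mono[OF variance, of "\<theta>\<^sup>2"] by simp
  also have "\<dots> \<le> exp (\<theta> * \<mu> + \<theta>\<^sup>2 * v)" by (rule exp_ge_add_one_self)
  finally have mgf: "measure_pmf.expectation P (\<lambda>T. exp (\<theta> * h T)) \<le> exp (\<theta> * \<mu> + \<theta>\<^sup>2 * v)" .
  have "measure_pmf.prob ?M {f. (\<Sum>i\<in>V. h (f i)) \<ge> real (card V) * \<mu> + \<epsilon>}
    = measure (measure_pmf ?M) {f \<in> space (measure_pmf ?M). (\<Prod>i\<in>V. exp (\<theta> * h (f i))) \<ge> exp (\<theta> * (real (card V) * \<mu> + \<epsilon>))}"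
    unfolding prod_eq using \<theta> by simp
  also have "\<dots> \<le> measure_pmf.expectation ?M (\<lambda>f. \<Prod>i\<in>V. exp (\<theta> * h (f i))) / exp (\<theta> * (real (card V) * \<mu> + \<epsilon>))"
    by (intro integral_Markov_inequality_measure[where A = "{}"] intM) (auto intro!: prod_nonneg)
  also have "measure_pmf.expectation ?M (\<lambda>f. \<Prod>i\<in>V. exp (\<theta> * h (f i))) = (\<Prod>i\<in>V. measure_pmf.expectation P (\<lambda>T. exp (\<theta> * h T)))"
    using V intP by (intro expectation_prod_Pi_pmf) auto
  also have "\<dots> \<le> (\<Prod>i\<in>V. exp (\<theta> * \<mu> + \<theta>\<^sup>2 * v))"
    using mgf by (intro prod_mono conjI integral_nonneg_AE) auto
  also have "\<dots> = exp (real (card V) * (\<theta> * \<mu> + \<theta>\<^sup>2 * v))" by (simp flip: exp_of_nat_mult)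
  also have "\<dots> / exp (\<theta> * (real (card V) * \<mu> + \<epsilon>)) = exp (real (card V) * \<theta>\<^sup>2 * v - \<theta> * \<epsilon>)"
    by (simp add: algebra_simps flip: exp_diff)
  finally show ?thesis by (simp add: \<mu>_def divide_right_mono)
qed

section \<open>Exact first and second moments of a uniform t-subset\<close>

lemma prob_contains:
  assumes "t \<le> m" "Q \<subseteq> {1..m}" "card Q \<le> t"
  shows "measure_pmf.expectation (pmf_of_set (t_subsets m t)) (\<lambda>T. of_bool (Q \<subseteq> T))
    = real ((m - card Q) choose (t - card Q)) / real (m choose t)"
proof -
  have "(\<Sum>T\<in>t_subsets m t. of_bool (Q \<subseteq> T) :: real) = real (card (t_subsets m t \<inter> {T. Q \<subseteq> T}))"
    by (rule sum_of_bool_eq; rule finite_t_subsets)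
  also have "t_subsets m t \<inter> {T. Q \<subseteq> T} = {T \<in> t_subsets m t. Q \<subseteq> T}" by auto
  finally show ?thesis
    unfolding integral_pmf_of_set[OF t_subsets_nonempty[OF assms(1)] finite_t_subsets]
    by (simp only: card_t_supersets[OF assms(2,3)] card_t_subsets)
qed

lemma prob_contains_one:
  assumes "t \<le> m" "t \<ge> 1" "j \<in> {1..m}"
  shows "measure_pmf.expectation (pmf_of_set (t_subsets m t)) (\<lambda>T. of_bool (j \<in> T)) = real t / real m"
proof -
  have "t * (m choose t) = m * ((m - 1) choose (t - 1))" using assms by (intro times_binomial_minus1_eq) auto
  then have "real t * real (m choose t) = real m * real ((m - 1) choose (t - 1))" by (simp flip: of_nat_mult)
  moreover have "real (m choose t) > 0" using assms by (simp add: zero_less_binomial_iff)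
  moreover have "real m > 0" using assms by auto
  ultimately have "real ((m - 1) choose (t - 1)) / real (m choose t) = real t / real m"
    by (simp add: field_simps)
  then show ?thesis using prob_contains[of t m "{j}"] assms by simp
qed

lemma prob_contains_two:
  assumes "t \<le> m" "t \<ge> 2" "j \<in> {1..m}" "l \<in> {1..m}" "j \<noteq> l"
  shows "measure_pmf.expectation (pmf_of_set (t_subsets m t)) (\<lambda>T. of_bool (j \<in> T \<and> l \<in> T))
    = real t / real m * ((real t - 1) / (real m - 1))"
proof -
  have "t * (m choose t) = m * ((m - 1) choose (t - 1))" using assms by (intro times_binomial_minus1_eq) auto
  then have 1: "real t * real (m choose t) = real m * real ((m - 1) choose (t - 1))" by (simp flip: of_nat_mult)
  have "(t - 1) * ((m - 1) choose (t - 1)) = (m - 1) * ((m - 1 - 1) choose (t - 1 - 1))"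
    using assms by (intro times_binomial_minus1_eq) auto
  then have "real (t - 1) * real ((m - 1) choose (t - 1)) = real (m - 1) * real ((m - 2) choose (t - 2))"
    by (simp flip: of_nat_mult add: numeral_2_eq_2)
  then have 2: "(real t - 1) * real ((m - 1) choose (t - 1)) = (real m - 1) * real ((m - 2) choose (t - 2))"
    using assms by (simp add: of_nat_diff)
  have pos: "real (m choose t) > 0" "real m > 0" "real m - 1 > 0" using assms by (auto simp: zero_less_binomial_iff)
  have "real m * (real m - 1) * real ((m - 2) choose (t - 2)) = (real t - 1) * (real m * real ((m - 1) choose (t - 1)))"
    using 2 by (metis mult.assoc mult.left_commute)
  also have "\<dots> = (real t - 1) * (real t * real (m choose t))" by (simp only: 1)
  finally have "real ((m - 2) choose (t - 2)) / real (m choose t) = real t / real m * ((real t - 1) / (real m - 1))"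
    using pos by (simp add: divide_simps) (simp add: mult_ac)
  then show ?thesis using prob_contains[of t m "{j, l}"] assms by (simp add: numeral_2_eq_2)
qed

text \<open>A vector \<open>b\<close> is the mean of \<open>T \<mapsto> g T \<cdot> 1\<^sub>T\<close> for a linear functional \<open>g\<close> of \<open>1\<^sub>T\<close>: the second
  moment matrix of \<open>1\<^sub>T\<close> is a positive combination of the identity and the all-ones matrix,
  hence explicitly invertible.\<close>

lemma mean_correction:
  fixes b :: "nat \<Rightarrow> real"
  assumes t: "t \<ge> 2" "4 * t \<le> m" and b: "\<forall>j\<in>{1..m}. \<bar>b j\<bar> \<le> D"
  shows "\<exists>g. (\<forall>T\<in>t_subsets m t. \<bar>g T\<bar> \<le> 3 * D * real m) \<and>
    (\<forall>j\<in>{1..m}. measure_pmf.expectation (pmf_of_set (t_subsets m t)) (\<lambda>T. g T * of_bool (j \<in> T)) = b j)"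
proof -
  define P where "P = pmf_of_set (t_subsets m t)"
  define p where "p = real t / real m"
  define q where "q = (real t - 1) / (real m - 1)"
  \<comment> \<open>The system to solve is
    \<open>p * (1 - q) * w j + p * q * (\<Sum>l\<in>{1..m}. w l) = b j\<close>. Summing over
    \<open>j\<close> determines the second term on the left, and \<open>c\<close> is its value. The
    assumption \<open>4 * t \<le> m\<close> keeps the conditional probability \<open>q\<close> at
    most 1/4, so dividing by \<open>1 - q\<close> is harmless.\<close>
  define c where "c = q * (\<Sum>l\<in>{1..m}. b l) / (1 - q + q * real m)"
  define w where "w l = (b l - c) / (p * (1 - q))" for l
  define g where "g T = (\<Sum>l\<in>T. w l)" for T
  have m: "real m > 1" "t \<le> m" "t \<ge> 1" using t by auto
  have "1 \<in> {1..m}" using t by simp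
  then have D: "D \<ge> 0" using b by (meson abs_ge_zero order.trans)
  have "real (4 * t) \<le> real m" using t(2) by (simp only: of_nat_le_iff)
  then have "4 * (real t - 1) \<le> real m - 1" by simp
  then have q: "0 \<le> q" "q \<le> 1 / 4" using t m by (auto simp: q_def field_simps)
  have p: "p > 0" using t by (simp add: p_def)
  have den: "1 - q + q * real m > 0" using q m by (intro add_pos_nonneg) auto
  have sum_b: "\<bar>\<Sum>l\<in>{1..m}. b l\<bar> \<le> real m * D"
    using sum_mono[of "{1..m}" "\<lambda>l. \<bar>b l\<bar>" "\<lambda>_. D"] b by (intro order.trans[OF sum_abs]) simp
  have c: "\<bar>c\<bar> \<le> D"
  proof -
    have "\<bar>q * (\<Sum>l\<in>{1..m}. b l)\<bar> \<le> q * (real m * D)" using sum_b q by (simp add: abs_mult mult_left_mono)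
    also have "\<dots> \<le> D * (1 - q + q * real m)" using q D by (simp add: algebra_simps mult_right_le_one_le)
    finally show ?thesis using den by (simp add: c_def abs_divide pos_divide_le_eq)
  qed
  have w: "\<bar>w l\<bar> \<le> 3 * D / p" if "l \<in> {1..m}" for l
  proof -
    have "\<bar>b l - c\<bar> \<le> 2 * D" using b c that by (smt (verit))
    also have "\<dots> \<le> 3 * D * (1 - q)" using q D mult_left_mono[of "3/4" "1 - q" "3 * D"] by simp
    finally have "\<bar>b l - c\<bar> / (p * (1 - q)) \<le> 3 * D * (1 - q) / (p * (1 - q))"
      using p q by (intro divide_right_mono) auto
    then show ?thesis using p q by (simp add: w_def abs_divide abs_mult)
  qed
  have "\<bar>g T\<bar> \<le> 3 * D * real m" if T: "T \<in> t_subsets m t" for T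
  proof -
    have "\<bar>g T\<bar> \<le> (\<Sum>l\<in>T. 3 * D / p)"
      unfolding g_def using w T by (intro order.trans[OF sum_abs] sum_mono) auto
    also have "\<dots> = 3 * D * real m" using T t by (simp add: p_def)
    finally show ?thesis .
  qed
  moreover have "measure_pmf.expectation P (\<lambda>T. g T * of_bool (j \<in> T)) = b j" if j: "j \<in> {1..m}" for j
  proof -
    have set_P: "set_pmf P = t_subsets m t"
      unfolding P_def using t_subsets_nonempty[OF m(2)] finite_t_subsets by (rule set_pmf_of_set)
    have intP: "integrable (measure_pmf P) f" for f :: "nat set \<Rightarrow> real"
      using finite_t_subsets by (intro integrable_measure_pmf_finite) (simp only: set_P)
    have "measure_pmf.expectation P (\<lambda>T. g T * of_bool (j \<in> T)) =
        measure_pmf.expectation P (\<lambda>T. \<Sum>l\<in>{1..m}. w l * of_bool (j \<in> T \<and> l \<in> T))"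
    proof (intro integral_cong_AE)
      show "AE T in measure_pmf P. g T * of_bool (j \<in> T) = (\<Sum>l\<in>{1..m}. w l * of_bool (j \<in> T \<and> l \<in> T))"
        unfolding AE_measure_pmf_iff
      proof
        fix T assume "T \<in> set_pmf P"
        then have T: "T \<subseteq> {1..m}" by (simp add: set_P)
        then have "{1..m} \<inter> {l. l \<in> T} = T" by auto
        then have "(\<Sum>l\<in>{1..m}. w l * of_bool (l \<in> T)) = g T"
          using sum.inter_restrict[of "{1..m}" w T] T
          by (simp add: g_def Int_absorb1 of_bool_def if_distrib cong: if_cong)
        then show "g T * of_bool (j \<in> T) = (\<Sum>l\<in>{1..m}. w l * of_bool (j \<in> T \<and> l \<in> T))"
          by (cases "j \<in> T") simp_all
      qed
    qed auto
    also have "\<dots> = (\<Sum>l\<in>{1..m}. w l * measure_pmf.expectation P (\<lambda>T. of_bool (j \<in> T \<and> l \<in> T)))"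
      using intP by (subst Bochner_Integration.integral_sum) auto
    also have "\<dots> = (\<Sum>l\<in>{1..m}. w l * (p * q) + (if l = j then w l * (p * (1 - q)) else 0))"
    proof (intro sum.cong refl)
      fix l assume l: "l \<in> {1..m}"
      show "w l * measure_pmf.expectation P (\<lambda>T. of_bool (j \<in> T \<and> l \<in> T)) = w l * (p * q) + (if l = j then w l * (p * (1 - q)) else 0)"
      proof (cases "l = j")
        case True
        then show ?thesis using prob_contains_one[OF m(2,3) j] unfolding P_def[symmetric] p_def[symmetric] by (simp add: algebra_simps)
      next
        case False
        then show ?thesis using prob_contains_two[OF m(2) t(1) j l] by (simp add: P_def p_def q_def)
      qed
    qed
    also have "\<dots> = p * q * (\<Sum>l\<in>{1..m}. w l) + w j * (p * (1 - q))"
      using j by (simp add: sum.distrib sum_distrib_left sum.delta mult_ac)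
    also have "w j * (p * (1 - q)) = b j - c" using p q by (simp add: w_def)
    also have "(\<Sum>l\<in>{1..m}. w l) = ((\<Sum>l\<in>{1..m}. b l) - real m * c) / (p * (1 - q))"
      by (simp add: w_def sum_subtractf flip: sum_divide_distrib)
    also have "p * q * (((\<Sum>l\<in>{1..m}. b l) - real m * c) / (p * (1 - q))) = c"
    proof -
      have "c * (1 - q + q * real m) = q * (\<Sum>l\<in>{1..m}. b l)" using den by (simp add: c_def)
      then have "q * ((\<Sum>l\<in>{1..m}. b l) - real m * c) = c * (1 - q)" by (simp add: algebra_simps)
      then show ?thesis using p q by (simp add: mult.assoc)
    qed
    finally show ?thesis by simp
  qed
  ultimately show ?thesis unfolding P_def by blast
qed

text \<open>The functional from \<open>mean_correction\<close> is divided by the number of elements,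
  so that the sum over \<open>V\<close> has mean \<open>b j\<close>. Its terms are at most
  \<open>6 * t * m / N\<close> and vanish unless \<open>j\<close> is hit, so the second moments add
  up to at most 36 t^3 m / N.\<close>

lemma prob_correction_fails:
  fixes b :: "nat \<Rightarrow> real"
  assumes t: "t \<ge> 8000" "4 * t \<le> m" and b: "\<forall>j\<in>{1..m}. \<bar>b j\<bar> \<le> 2 * real t"
    and V: "finite V" "real (card V) \<ge> 576 * (real t)\<^sup>2 * real m * ln (real m)"
  shows "\<exists>g. (\<forall>T\<in>t_subsets m t. \<bar>g T\<bar> \<le> 1) \<and>
    measure_pmf.prob (Pi_pmf V {} (\<lambda>_. pmf_of_set (t_subsets m t)))
      {f. \<exists>j\<in>{1..m}. \<bar>b j - (\<Sum>i\<in>V. g (f i) * of_bool (j \<in> f i))\<bar> > sqrt t} \<le> 2 / (real m)\<^sup>2"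
proof -
  define P where "P = pmf_of_set (t_subsets m t)"
  define M where "M = Pi_pmf V {} (\<lambda>_. P)"
  define N where "N = real (card V)"
  define L where "L = ln (real m)"
  \<comment> \<open>The gain \<open>\<theta> * sqrt t\<close> is \<open>4 * L\<close>, and 576 = 16
    * 36 is chosen so that the quadratic term costs at most \<open>L\<close>. Each of the
    \<open>2 * m\<close> one-sided deviations then has probability at most
    \<open>exp (- (3 * L))\<close>, that is \<open>1 / m ^ 3\<close>.\<close>
  define \<theta> where "\<theta> = 4 * L / sqrt t"
  have m: "m > 0" "t \<le> m" "real m \<ge> 8000" "t \<ge> 1" using t by auto
  have set_P: "set_pmf P = t_subsets m t"
    unfolding P_def using t_subsets_nonempty[OF m(2)] finite_t_subsets by (rule set_pmf_of_set)
  have finP: "finite (set_pmf P)" unfolding set_P by (rule finite_t_subsets)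
  have intP: "integrable (measure_pmf P) f" for f :: "nat set \<Rightarrow> real"
    using finP by (rule integrable_measure_pmf_finite)
  have L: "L \<ge> 1"
  proof -
    have "exp 1 \<le> real m" using exp_le m by linarith
    then show ?thesis unfolding L_def using m by (subst ln_ge_iff) auto
  qed
  have N: "N \<ge> 576 * (real t)\<^sup>2 * real m * L" using V by (simp add: N_def L_def)
  have t2: "real t * real m * L \<le> (real t)\<^sup>2 * real m * L" "real t * real m \<le> real t * real m * L"
  proof -
    have "real t \<le> (real t)\<^sup>2" using t by (simp add: self_le_power)
    then show "real t * real m * L \<le> (real t)\<^sup>2 * real m * L" using L by (intro mult_right_mono) auto
    have "real t * real m * 1 \<le> real t * real m * L" using L by (intro mult_left_mono) auto
    then show "real t * real m \<le> real t * real m * L" by simp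
  qed
  have tm: "real t * real m > 0" using m t by simp
  have N_pos: "N > 0" using N t2 tm by linarith
  obtain g\<^sub>0 where g\<^sub>0: "\<And>T. T \<in> t_subsets m t \<Longrightarrow> \<bar>g\<^sub>0 T\<bar> \<le> 6 * real t * real m"
    "\<And>j. j \<in> {1..m} \<Longrightarrow> measure_pmf.expectation P (\<lambda>T. g\<^sub>0 T * of_bool (j \<in> T)) = b j"
    using mean_correction[of t m b "2 * real t"] t b unfolding P_def by force
  define g where "g T = g\<^sub>0 T / N" for T
  have g: "\<bar>g T\<bar> \<le> 6 * real t * real m / N" if "T \<in> t_subsets m t" for T
    using g\<^sub>0(1)[OF that] N_pos by (simp add: g_def abs_divide divide_right_mono)
  have \<theta>: "\<theta> > 0" using L t by (simp add: \<theta>_def)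
  have \<theta>_bound: "\<theta> * (6 * real t * real m / N) \<le> 1"
  proof -
    have "4 * L / sqrt t \<le> 4 * L / 1" using t L by (intro divide_left_mono) auto
    then have "\<theta> * (6 * real t * real m) \<le> 4 * L * (6 * real t * real m)"
      unfolding \<theta>_def by (intro mult_right_mono) auto
    also have "\<dots> \<le> N" using N t2 tm by (simp add: mult_ac)
    finally show ?thesis using N_pos by simp
  qed
  have tail: "measure_pmf.prob M {f. (\<Sum>i\<in>V. s * (g (f i) * of_bool (j \<in> f i))) \<ge> s * b j + sqrt t} \<le> 1 / real m ^ 3"
    if j: "j \<in> {1..m}" and s: "\<bar>s\<bar> = 1" for s j
  proof -
    define h where "h T = s * (g T * of_bool (j \<in> T))" for T
    have mean: "N * measure_pmf.expectation P h = s * b j"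
    proof -
      have "h = (\<lambda>T. s / N * (g\<^sub>0 T * of_bool (j \<in> T)))" by (auto simp: h_def g_def)
      then have "measure_pmf.expectation P h = s / N * b j" using intP by (simp add: g\<^sub>0(2)[OF j])
      then show ?thesis using N_pos by simp
    qed
    have var: "measure_pmf.expectation P (\<lambda>T. (h T)\<^sup>2) \<le> (6 * real t * real m / N)\<^sup>2 * (real t / real m)"
    proof -
      have "measure_pmf.expectation P (\<lambda>T. (h T)\<^sup>2) \<le> measure_pmf.expectation P (\<lambda>T. (6 * real t * real m / N)\<^sup>2 * of_bool (j \<in> T))"
      proof (intro integral_mono_AE intP)
        show "AE T in measure_pmf P. (h T)\<^sup>2 \<le> (6 * real t * real m / N)\<^sup>2 * of_bool (j \<in> T)"
          unfolding AE_measure_pmf_iff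
        proof
          fix T assume "T \<in> set_pmf P"
          then have "\<bar>g T\<bar> \<le> \<bar>6 * real t * real m / N\<bar>" using g[of T] N_pos unfolding set_P by simp
          then have "(g T)\<^sup>2 \<le> (6 * real t * real m / N)\<^sup>2" by (simp only: abs_le_square_iff)
          moreover have "s\<^sup>2 = 1" using s by (simp add: abs_square_eq_1)
          ultimately show "(h T)\<^sup>2 \<le> (6 * real t * real m / N)\<^sup>2 * of_bool (j \<in> T)"
            by (cases "j \<in> T") (simp_all add: h_def power_mult_distrib)
        qed
      qed
      also have "\<dots> = (6 * real t * real m / N)\<^sup>2 * (real t / real m)"
        using intP prob_contains_one[OF m(2,4) j] by (simp add: P_def)
      finally show ?thesis .
    qed
    have "measure_pmf.prob M {f. (\<Sum>i\<in>V. h (f i)) \<ge> N * measure_pmf.expectation P h + sqrt t}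
      \<le> exp (N * \<theta>\<^sup>2 * ((6 * real t * real m / N)\<^sup>2 * (real t / real m)) - \<theta> * sqrt t)"
      unfolding M_def N_def
    proof (intro Pi_pmf_upper_tail V finP \<theta>)
      show "\<theta> * h T \<le> 1" if "T \<in> set_pmf P" for T
      proof -
        have "h T \<le> \<bar>h T\<bar>" by simp
        also have "\<dots> \<le> \<bar>g T\<bar>" using s by (simp add: h_def abs_mult)
        also have "\<dots> \<le> 6 * real t * real m / N" using g that unfolding set_P by blast
        finally have "\<theta> * h T \<le> \<theta> * (6 * real t * real m / N)" using \<theta> by (intro mult_left_mono) auto
        then show ?thesis using \<theta>_bound by linarith
      qed
      show "measure_pmf.expectation P (\<lambda>T. (h T)\<^sup>2) \<le> (6 * real t * real m / real (card V))\<^sup>2 * (real t / real m)"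
        using var by (simp only: N_def)
    qed
    also have "\<dots> \<le> exp (- (3 * L))"
    proof -
      have "N * \<theta>\<^sup>2 * ((6 * real t * real m / N)\<^sup>2 * (real t / real m)) = 576 * (real t)\<^sup>2 * real m * L * L / N"
        using t m N_pos by (simp add: \<theta>_def power_mult_distrib power_divide) (simp add: field_simps power2_eq_square)
      also have "\<dots> \<le> N * L / N" using N L N_pos by (intro divide_right_mono mult_right_mono) auto
      also have "\<dots> = L" using N_pos by simp
      finally have "N * \<theta>\<^sup>2 * ((6 * real t * real m / N)\<^sup>2 * (real t / real m)) \<le> L" .
      moreover have "\<theta> * sqrt t = 4 * L" using t by (simp add: \<theta>_def)
      ultimately show ?thesis by simp
    qed
    also have "\<dots> = 1 / real m ^ 3"
    proof -
      have "exp (real 3 * L) = real m ^ 3" using m unfolding L_def exp_of_nat_mult by simp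
      then show ?thesis by (simp add: exp_minus divide_inverse)
    qed
    finally show ?thesis unfolding mean by (simp only: h_def)
  qed
  define F where "F s j = {f. (\<Sum>i\<in>V. s * (g (f i) * of_bool (j \<in> f i))) \<ge> s * b j + sqrt t}" for s :: real and j
  have "{f. \<exists>j\<in>{1..m}. \<bar>b j - (\<Sum>i\<in>V. g (f i) * of_bool (j \<in> f i))\<bar> > sqrt t} \<subseteq> (\<Union>(s, j)\<in>{-1, 1} \<times> {1..m}. F s j)"
  proof safe
    fix f j assume j: "j \<in> {1..m}" and *: "\<bar>b j - (\<Sum>i\<in>V. g (f i) * of_bool (j \<in> f i))\<bar> > sqrt t"
    have "f \<in> F 1 j \<or> f \<in> F (-1) j" unfolding F_def mem_Collect_eq sum_distrib_left[symmetric] using * by (auto simp: abs_if split: if_splits)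
    then show "f \<in> (\<Union>(s, j)\<in>{-1, 1} \<times> {1..m}. F s j)" using j by auto
  qed
  then have "measure_pmf.prob M {f. \<exists>j\<in>{1..m}. \<bar>b j - (\<Sum>i\<in>V. g (f i) * of_bool (j \<in> f i))\<bar> > sqrt t}
     \<le> measure_pmf.prob M (\<Union>(s, j)\<in>{-1, 1} \<times> {1..m}. F s j)"
    by (intro measure_pmf.finite_measure_mono) auto
  also have "\<dots> \<le> (\<Sum>(s, j)\<in>{-1, 1} \<times> {1..m}. measure_pmf.prob M (F s j))"
    using measure_pmf.finite_measure_subadditive_finite[of "{-1, 1} \<times> {1..m}" "\<lambda>(s, j). F s j" M]
    by (simp add: case_prod_unfold)
  also have "\<dots> \<le> (\<Sum>(s, j)\<in>{-1, 1 :: real} \<times> {1..m}. 1 / real m ^ 3)"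
  proof (intro sum_mono, clarify)
    fix s :: real and j assume "s \<in> {-1, 1}" "j \<in> {1..m}"
    then show "measure_pmf.prob M (F s j) \<le> 1 / real m ^ 3" unfolding F_def by (intro tail) auto
  qed
  also have "\<dots> = 2 / (real m)\<^sup>2"
    using m by (simp add: case_prod_unfold card_cartesian_product power2_eq_square power3_eq_cube)
  finally have "measure_pmf.prob M {f. \<exists>j\<in>{1..m}. \<bar>b j - (\<Sum>i\<in>V. g (f i) * of_bool (j \<in> f i))\<bar> > sqrt t} \<le> 2 / (real m)\<^sup>2" .
  moreover have "\<bar>g T\<bar> \<le> 1" if "T \<in> t_subsets m t" for T
  proof -
    have "6 * real t * real m \<le> N" using N t2 tm by linarith
    then show ?thesis using g[OF that] N_pos by (smt (verit) divide_le_eq_1_pos)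
  qed
  ultimately show ?thesis unfolding M_def P_def by blast
qed

text \<open>Fubini in the form of conditioning on the first component: the event may involve objects
  constructed from \<open>a\<close>, as long as the bound is uniform in \<open>a\<close>.\<close>

lemma prob_pair_le:
  fixes A :: "'a pmf" and B :: "'b pmf"
  assumes le: "\<And>a. a \<in> set_pmf A \<Longrightarrow> measure_pmf.prob B {b. (a, b) \<in> X} \<le> c"
  shows "measure_pmf.prob (pair_pmf A B) X \<le> c"
proof -
  obtain a where "a \<in> set_pmf A" using set_pmf_not_empty by fast
  then have c: "c \<ge> 0" using le measure_nonneg order.trans by blast
  have "emeasure (measure_pmf (pair_pmf A B)) X = (\<integral>\<^sup>+x. indicator X x \<partial>measure_pmf (pair_pmf A B))" by simp
  also have "\<dots> = (\<integral>\<^sup>+a. \<integral>\<^sup>+b. indicator X (a, b) \<partial>measure_pmf B \<partial>measure_pmf A)" by (rule nn_integral_pair_pmf')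
  also have "\<dots> \<le> (\<integral>\<^sup>+a. ennreal c \<partial>measure_pmf A)"
  proof (intro nn_integral_mono_AE, unfold AE_measure_pmf_iff, rule ballI)
    fix a assume "a \<in> set_pmf A"
    have "(\<integral>\<^sup>+b. indicator X (a, b) \<partial>measure_pmf B) = (\<integral>\<^sup>+b. indicator {b. (a, b) \<in> X} b \<partial>measure_pmf B)"
      by (intro nn_integral_cong) (auto simp: indicator_def)
    also have "\<dots> = ennreal (measure_pmf.prob B {b. (a, b) \<in> X})" by (simp add: measure_pmf.emeasure_eq_measure)
    also have "\<dots> \<le> ennreal c" using le[OF \<open>a \<in> set_pmf A\<close>] by (rule ennreal_leI)
    finally show "(\<integral>\<^sup>+b. indicator X (a, b) \<partial>measure_pmf B) \<le> ennreal c" .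
  qed
  also have "\<dots> = ennreal c" by simp
  finally show ?thesis using c by (simp add: measure_pmf.emeasure_eq_measure)
qed

text \<open>The surplus elements beyond \<open>k\<close> already carry signs, and the elements up to
  \<open>k\<close> carry fractional colours that remain to be rounded. Both may depend on
  \<open>T\<close>; only their existence enters the event.\<close>

definition balanced :: "nat \<Rightarrow> nat \<Rightarrow> nat \<Rightarrow> nat \<Rightarrow> (nat \<Rightarrow> nat set) \<Rightarrow> bool" where
  "balanced k n m t T \<longleftrightarrow> (\<exists>(x::nat \<Rightarrow> real) (\<sigma>::nat \<Rightarrow> int). (\<forall>i\<in>{1..k}. \<bar>x i\<bar> \<le> 1) \<and> (\<forall>i\<in>{k<..n}. \<sigma> i \<in> {-1, 1}) \<and>
     (\<forall>j\<in>{1..m}. \<bar>(\<Sum>i\<in>{1..k} \<inter> rows n T j. x i) + (\<Sum>i\<in>{k<..n} \<inter> rows n T j. of_int (\<sigma> i))\<bar> \<le> sqrt t))"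

lemma balanced_self: "balanced n n m t T"
  unfolding balanced_def by (intro exI[of _ "\<lambda>_. 0"] exI[of _ "\<lambda>_. 1"]) auto

text \<open>The incidences split into independent parts \<open>f\<close> beyond \<open>k\<close> and
  \<open>h\<close> up to \<open>k\<close>. The Beck-Fiala signs, the imbalance \<open>b\<close> and
  the functional \<open>g\<close> are constructed from \<open>f\<close> alone, so for fixed
  \<open>f\<close> the concentration bound applies to a fresh \<open>h\<close>.\<close>

lemma prob_not_balanced:
  assumes t: "t \<ge> 8000" "4 * t \<le> m" and k: "k \<le> n" "real k \<ge> 576 * (real t)\<^sup>2 * real m * ln (real m)"
  shows "measure_pmf.prob (random_incidence n m t) {T. \<not> balanced k n m t T} \<le> 2 / (real m)\<^sup>2"
proof -
  define P where "P = pmf_of_set (t_subsets m t)"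
  define merge where "merge f h x = (if x \<in> {k<..n} then f x else h x)" for f h :: "nat \<Rightarrow> nat set" and x
  have tm: "t \<le> m" using t by simp
  have set_P: "set_pmf P = t_subsets m t"
    unfolding P_def using t_subsets_nonempty[OF tm] finite_t_subsets by (rule set_pmf_of_set)
  have "{1..n} = {k<..n} \<union> {1..k}" using k by auto
  then have "random_incidence n m t = Pi_pmf ({k<..n} \<union> {1..k}) {} (\<lambda>_. P)"
    by (simp only: random_incidence_def P_def)
  also have "\<dots> = map_pmf (\<lambda>(f, h). merge f h) (pair_pmf (Pi_pmf {k<..n} {} (\<lambda>_. P)) (Pi_pmf {1..k} {} (\<lambda>_. P)))"
    by (subst Pi_pmf_union) (auto simp: merge_def[abs_def] case_prod_unfold)
  finally have "measure_pmf.prob (random_incidence n m t) {T. \<not> balanced k n m t T} =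
     measure_pmf.prob (pair_pmf (Pi_pmf {k<..n} {} (\<lambda>_. P)) (Pi_pmf {1..k} {} (\<lambda>_. P)))
       {(f, h). \<not> balanced k n m t (merge f h)}"
    by (simp add: vimage_def case_prod_unfold)
  also have "\<dots> \<le> 2 / (real m)\<^sup>2"
  proof (rule prob_pair_le)
    fix f assume "f \<in> set_pmf (Pi_pmf {k<..n} {} (\<lambda>_. P))"
    then have f: "f i \<in> t_subsets m t" if "i \<in> {k<..n}" for i
      using that set_P by (auto simp: set_Pi_pmf PiE_dflt_def)
    have deg: "\<forall>i\<in>{k<..n}. card {j\<in>{1..m}. i \<in> {i. j \<in> f i}} = t"
    proof
      fix i assume "i \<in> {k<..n}"
      from f[OF this] have "{j\<in>{1..m}. i \<in> {i. j \<in> f i}} = f i" "card (f i) = t" by auto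
      then show "card {j\<in>{1..m}. i \<in> {i. j \<in> f i}} = t" by simp
    qed
    obtain \<sigma> :: "nat \<Rightarrow> int" where \<sigma>: "\<forall>i\<in>{k<..n}. \<sigma> i \<in> {-1, 1}"
      "\<forall>j\<in>{1..m}. \<bar>\<Sum>i\<in>{k<..n} \<inter> {i. j \<in> f i}. real_of_int (\<sigma> i)\<bar> \<le> 2 * real t"
      using beck_fiala[OF _ _ deg] t by auto
    define b where "b j = (\<Sum>i\<in>{k<..n} \<inter> {i. j \<in> f i}. real_of_int (\<sigma> i))" for j
    obtain g where g: "\<forall>T\<in>t_subsets m t. \<bar>g T\<bar> \<le> 1"
      "measure_pmf.prob (Pi_pmf {1..k} {} (\<lambda>_. P))
        {h. \<exists>j\<in>{1..m}. \<bar>b j - (\<Sum>i\<in>{1..k}. g (h i) * of_bool (j \<in> h i))\<bar> > sqrt t} \<le> 2 / (real m)\<^sup>2"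
      using prob_correction_fails[OF t, of b "{1..k}"] \<sigma>(2) k unfolding b_def P_def by auto
    have "measure_pmf.prob (Pi_pmf {1..k} {} (\<lambda>_. P)) {h. (f, h) \<in> {(f, h). \<not> balanced k n m t (merge f h)}}
      \<le> measure_pmf.prob (Pi_pmf {1..k} {} (\<lambda>_. P))
        {h. \<exists>j\<in>{1..m}. \<bar>b j - (\<Sum>i\<in>{1..k}. g (h i) * of_bool (j \<in> h i))\<bar> > sqrt t}"
    proof (intro measure_pmf.finite_measure_mono_AE, unfold AE_measure_pmf_iff, intro ballI impI)
      fix h assume h: "h \<in> set_pmf (Pi_pmf {1..k} {} (\<lambda>_. P))"
        and "h \<in> {h. (f, h) \<in> {(f, h). \<not> balanced k n m t (merge f h)}}"
      then have not_bal: "\<not> balanced k n m t (merge f h)" by simp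
      have h_in: "h i \<in> t_subsets m t" if "i \<in> {1..k}" for i
        using h that set_P by (auto simp: set_Pi_pmf PiE_dflt_def)
      show "h \<in> {h. \<exists>j\<in>{1..m}. \<bar>b j - (\<Sum>i\<in>{1..k}. g (h i) * of_bool (j \<in> h i))\<bar> > sqrt t}"
      proof (rule ccontr)
        assume "\<not> ?thesis"
        then have small: "\<bar>b j - (\<Sum>i\<in>{1..k}. g (h i) * of_bool (j \<in> h i))\<bar> \<le> sqrt t" if "j \<in> {1..m}" for j
          using that by (auto simp: not_less)
        have "balanced k n m t (merge f h)"
          unfolding balanced_def
        proof (intro exI[of _ "\<lambda>i. - g (h i)"] exI[of _ \<sigma>] conjI ballI)
          fix j assume j: "j \<in> {1..m}"
          have "{1..k} \<inter> rows n (merge f h) j = {1..k} \<inter> {i. j \<in> h i}" using k by (auto simp: rows_def merge_def)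
          then have 1: "(\<Sum>i\<in>{1..k} \<inter> rows n (merge f h) j. - g (h i)) = - (\<Sum>i\<in>{1..k}. g (h i) * of_bool (j \<in> h i))"
            by (simp add: sum_negf)
          have "{k<..n} \<inter> rows n (merge f h) j = {k<..n} \<inter> {i. j \<in> f i}" by (auto simp: rows_def merge_def)
          then have 2: "(\<Sum>i\<in>{k<..n} \<inter> rows n (merge f h) j. real_of_int (\<sigma> i)) = b j" by (simp add: b_def)
          show "\<bar>(\<Sum>i\<in>{1..k} \<inter> rows n (merge f h) j. - g (h i)) + (\<Sum>i\<in>{k<..n} \<inter> rows n (merge f h) j. real_of_int (\<sigma> i))\<bar> \<le> sqrt t"
            unfolding 1 2 using small[OF j] by simp
        qed (use g(1) h_in \<sigma>(1) in auto)
        then show False using not_bal by simp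
      qed
    qed auto
    then show "measure_pmf.prob (Pi_pmf {1..k} {} (\<lambda>_. P)) {h. (f, h) \<in> {(f, h). \<not> balanced k n m t (merge f h)}} \<le> 2 / (real m)\<^sup>2"
      using g(2) by linarith
  qed
  finally show ?thesis .
qed

section \<open>The expected discrepancy\<close>

lemma disc_le:
  assumes V: "finite V" and \<S>: "finite \<S>" "\<S> \<noteq> {}" and col: "\<forall>i\<in>V. col i \<in> {-1, 1}"
    and S: "\<And>S. S \<in> \<S> \<Longrightarrow> S \<subseteq> V \<and> \<bar>\<Sum>i\<in>S. real_of_int (col i)\<bar> \<le> D"
  shows "real_of_int (disc V \<S>) \<le> D"
proof -
  define f where "f c = Max ((\<lambda>S. \<bar>\<Sum>i\<in>S. c i\<bar>) ` \<S>)" for c :: "'a \<Rightarrow> int"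
  define c where "c = restrict col V"
  have "c \<in> V \<rightarrow>\<^sub>E {-1, 1}" using col by (auto simp: c_def)
  moreover have "finite (V \<rightarrow>\<^sub>E {-1, 1 :: int})" using V by (intro finite_PiE) auto
  ultimately have "disc V \<S> \<le> f c" unfolding disc_def f_def[symmetric] by (intro Min_le) auto
  moreover have "f c \<in> (\<lambda>S. \<bar>\<Sum>i\<in>S. c i\<bar>) ` \<S>" unfolding f_def using \<S> by (intro Max_in) auto
  then obtain S where SS: "S \<in> \<S>" "f c = \<bar>\<Sum>i\<in>S. c i\<bar>" by blast
  moreover have "(\<Sum>i\<in>S. c i) = (\<Sum>i\<in>S. col i)" using S[OF SS(1)] by (intro sum.cong) (auto simp: c_def)
  ultimately have "disc V \<S> \<le> \<bar>\<Sum>i\<in>S. col i\<bar>" by simp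
  then have "real_of_int (disc V \<S>) \<le> real_of_int \<bar>\<Sum>i\<in>S. col i\<bar>" by (simp only: of_int_le_iff)
  also have "\<dots> = \<bar>\<Sum>i\<in>S. real_of_int (col i)\<bar>" by simp
  also have "\<dots> \<le> D" using S[OF SS(1)] by blast
  finally show ?thesis .
qed

lemma degree_rows:
  assumes "t \<le> m" "T \<in> set_pmf (random_incidence n m t)"
  shows "\<forall>i\<in>{1..n}. card {j\<in>{1..m}. i \<in> rows n T j} = t"
proof
  fix i assume i: "i \<in> {1..n}"
  then have "T i \<in> t_subsets m t" using assms(2) unfolding set_pmf_random_incidence[OF assms(1)] by (auto simp: PiE_dflt_def)
  moreover from this have "{j\<in>{1..m}. i \<in> rows n T j} = T i" using i by (auto simp: rows_def)
  ultimately show "card {j\<in>{1..m}. i \<in> rows n T j} = t" by simp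
qed

lemma disc_rows_le:
  assumes m: "m > 0" and \<sigma>: "\<forall>i\<in>{1..n}. \<sigma> i \<in> {-1, 1 :: int}"
    and le: "\<forall>j\<in>{1..m}. \<bar>\<Sum>i\<in>{1..n} \<inter> rows n T j. real_of_int (\<sigma> i)\<bar> \<le> D"
  shows "real_of_int (disc {1..n} (rows n T ` {1..m})) \<le> D"
proof (rule disc_le[OF _ _ _ \<sigma>])
  fix S assume "S \<in> rows n T ` {1..m}"
  then obtain j where j: "j \<in> {1..m}" "S = rows n T j" by blast
  have "{1..n} \<inter> S = S" using j by (auto simp: rows_def)
  then show "S \<subseteq> {1..n} \<and> \<bar>\<Sum>i\<in>S. real_of_int (\<sigma> i)\<bar> \<le> D"
    using bspec[OF le j(1)] unfolding j(2)[symmetric] by (metis Int_lower1)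
qed (use m in auto)

lemma disc_rows_le_beck_fiala:
  assumes "t \<le> m" "t > 0" "T \<in> set_pmf (random_incidence n m t)"
  shows "real_of_int (disc {1..n} (rows n T ` {1..m})) \<le> 2 * real t"
proof -
  obtain \<sigma> :: "nat \<Rightarrow> int" where \<sigma>: "\<forall>i\<in>{1..n}. \<sigma> i \<in> {-1, 1}"
    "\<forall>j\<in>{1..m}. \<bar>\<Sum>i\<in>{1..n} \<inter> rows n T j. real_of_int (\<sigma> i)\<bar> \<le> 2 * real t"
    using beck_fiala[OF _ _ degree_rows[OF assms(1,3)] assms(2)] by blast
  show ?thesis by (rule disc_rows_le[OF _ \<sigma>]) (use assms in simp)
qed

text \<open>1250 is 1249 for rounding the first \<open>k\<close> elements plus 1 for the imbalance
  left by \<open>balanced\<close>.\<close>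

lemma disc_rows_le_spread:
  assumes tm: "t \<le> m" "t > 0" and T: "T \<in> set_pmf (random_incidence n m t)" and k: "k \<le> n"
    and spread: "well_spread {1..k} {1..m} (rows n T) t" and bal: "balanced k n m t T"
  shows "real_of_int (disc {1..n} (rows n T ` {1..m})) \<le> 1250 * sqrt t"
proof -
  obtain x and \<tau> :: "nat \<Rightarrow> int" where x: "\<forall>i\<in>{1..k}. \<bar>x i\<bar> \<le> (1::real)" and \<tau>: "\<forall>i\<in>{k<..n}. \<tau> i \<in> {-1, 1}"
    and sum: "\<forall>j\<in>{1..m}. \<bar>(\<Sum>i\<in>{1..k} \<inter> rows n T j. x i) + (\<Sum>i\<in>{k<..n} \<inter> rows n T j. of_int (\<tau> i))\<bar> \<le> sqrt t"
    using bal unfolding balanced_def by blast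
  have deg: "\<forall>i\<in>{1..k}. card {j\<in>{1..m}. i \<in> rows n T j} = t"
    using degree_rows[OF tm(1) T] k by auto
  obtain \<sigma> :: "nat \<Rightarrow> int" where \<sigma>: "\<forall>i\<in>{1..k}. \<sigma> i \<in> {-1, 1}"
    "\<forall>j\<in>{1..m}. \<bar>\<Sum>i\<in>{1..k} \<inter> rows n T j. real_of_int (\<sigma> i) - x i\<bar> \<le> 1249 * sqrt t"
    using well_spread_rounding[OF _ _ deg tm(2) spread x] by blast
  define \<phi> where "\<phi> i = (if i \<le> k then \<sigma> i else \<tau> i)" for i
  show ?thesis
  proof (rule disc_rows_le[of _ _ \<phi>])
    show "\<forall>j\<in>{1..m}. \<bar>\<Sum>i\<in>{1..n} \<inter> rows n T j. real_of_int (\<phi> i)\<bar> \<le> 1250 * sqrt t"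
    proof
      fix j assume j: "j \<in> {1..m}"
      have "{1..n} \<inter> rows n T j = ({1..k} \<inter> rows n T j) \<union> ({k<..n} \<inter> rows n T j)" using k by auto
      then have "(\<Sum>i\<in>{1..n} \<inter> rows n T j. real_of_int (\<phi> i)) =
         (\<Sum>i\<in>{1..k} \<inter> rows n T j. real_of_int (\<phi> i)) + (\<Sum>i\<in>{k<..n} \<inter> rows n T j. real_of_int (\<phi> i))"
        by (simp only:) (intro sum.union_disjoint, auto)
      also have "\<dots> = (\<Sum>i\<in>{1..k} \<inter> rows n T j. real_of_int (\<sigma> i)) + (\<Sum>i\<in>{k<..n} \<inter> rows n T j. real_of_int (\<tau> i))"
        by (intro arg_cong2[where f = plus] sum.cong) (auto simp: \<phi>_def)
      finally show "\<bar>\<Sum>i\<in>{1..n} \<inter> rows n T j. real_of_int (\<phi> i)\<bar> \<le> 1250 * sqrt t"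
        using bspec[OF \<sigma>(2) j] bspec[OF sum j] unfolding sum_subtractf by linarith
    qed
  qed (use tm \<sigma>(1) \<tau> in \<open>auto simp: \<phi>_def\<close>)
qed

section \<open>Final numerical estimates and the expectation\<close>

lemma ln_le_two_sqrt: "x > 0 \<Longrightarrow> ln x \<le> 2 * sqrt (x::real)"
  using ln_le_self[of "sqrt x"] by (simp add: ln_sqrt)

text \<open>The logarithm is \<open>ln 577 + 2 * ln t + ln (ln m)\<close>, and the budget
  \<open>sqrt t\<close> is split into quarters. The quarter for \<open>ln (ln m)\<close> dictates
  the factor 16 in the hypothesis. The two for \<open>ln t\<close> dictate 65536 = 256^2: with s =
  sqrt t, \<open>ln t\<close> is at most \<open>4 * sqrt s\<close>, which is at most
  \<open>s / 4\<close> once \<open>sqrt s \<ge> 16\<close>.\<close>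

lemma ln_number_of_columns_le:
  assumes t: "t \<ge> 65536" "t \<le> m" and loglog: "real t \<ge> 16 * (ln (ln (real m)))\<^sup>2"
  shows "ln (577 * (real t)\<^sup>2 * real m * ln (real m) / real m) \<le> sqrt t"
proof -
  define s where "s = sqrt t"
  have s: "s \<ge> 256" unfolding s_def using t by (intro real_le_rsqrt) simp
  have s2: "s\<^sup>2 = real t" by (simp add: s_def)
  have m: "real m > 1" using t by simp
  have L: "ln (real m) > 0" using m by simp
  have "(4 * ln (ln (real m)))\<^sup>2 \<le> s\<^sup>2" using loglog by (simp add: s2 power_mult_distrib)
  then have "\<bar>4 * ln (ln (real m))\<bar> \<le> \<bar>s\<bar>" by (simp only: abs_le_square_iff)
  then have 1: "ln (ln (real m)) \<le> s / 4" using s by linarith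
  have 2: "ln (real t) \<le> s / 4"
  proof -
    define r where "r = sqrt s"
    have r: "r \<ge> 16" unfolding r_def using s by (intro real_le_rsqrt) simp
    have "ln (real t) = 2 * ln s" using s by (simp flip: s2 add: ln_realpow)
    also have "\<dots> \<le> 4 * r" using ln_le_two_sqrt[of s] s by (simp add: r_def)
    also have "\<dots> \<le> r * r / 4" using mult_right_mono[OF r, of r] r by simp
    also have "r * r = s" using s by (simp add: r_def)
    finally show ?thesis .
  qed
  have 3: "ln 577 \<le> s / 4"
  proof -
    have "sqrt 577 \<le> (32::real)" by (intro real_le_lsqrt) auto
    then show ?thesis using ln_le_two_sqrt[of 577] s by simp
  qed
  have "577 * (real t)\<^sup>2 * real m * ln (real m) / real m = 577 * (real t)\<^sup>2 * ln (real m)" using m by simp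
  also have "ln \<dots> = ln 577 + 2 * ln (real t) + ln (ln (real m))"
    using t L by (simp add: ln_mult ln_realpow)
  also have "\<dots> \<le> s" using 1 2 3 by linarith
  finally show ?thesis by (simp add: s_def)
qed

text \<open>Off an event of probability at most \<open>4 / sqrt t\<close> the discrepancy is at most
  \<open>1250 * sqrt t\<close>; on it the bound \<open>2 * t\<close> adds \<open>8 * sqrt t\<close>
  to the expectation.\<close>

lemma expected_disc_le:
  assumes tm: "t \<le> m" and t: "t \<ge> 65536" and loglog: "real t \<ge> 16 * (ln (ln (real m)))\<^sup>2"
  shows "measure_pmf.expectation (random_incidence n m t) (\<lambda>T. real_of_int (disc {1..n} (rows n T ` {1..m})))
    \<le> 1258 * sqrt t"
proof -
  define P where "P = random_incidence n m t"
  define f where "f T = real_of_int (disc {1..n} (rows n T ` {1..m}))" for T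
  have int: "integrable (measure_pmf P) f" for f :: "(nat \<Rightarrow> nat set) \<Rightarrow> real"
    unfolding P_def by (rule integrable_random_incidence[OF tm])
  have m: "m > 0" "t > 0" using t tm by auto
  have "\<exists>Bad. measure_pmf.prob P Bad \<le> 4 / sqrt t \<and> (\<forall>T\<in>set_pmf P. T \<notin> Bad \<longrightarrow> f T \<le> 1250 * sqrt t)"
  proof (cases "4 * t \<ge> m")
    case True
    have "f T \<le> 1250 * sqrt t" if "T \<in> set_pmf P" for T
      unfolding f_def using that True m tm
      by (intro disc_rows_le_spread[of t m T n n] well_spread_trivial balanced_self) (auto simp: P_def)
    then show ?thesis by (intro exI[of _ "{}"]) auto
  next
    case False
    \<comment> \<open>Rounding up costs less than 1, which is absorbed by passing from 576 to 577
      because t^2 m ln m is at least 1.\<close>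
    define N where "N = nat \<lceil>576 * (real t)\<^sup>2 * real m * ln (real m)\<rceil>"
    define k where "k = min n N"
    define Bad1 where "Bad1 = {T. \<not> well_spread {1..k} {1..m} (rows n T) t}"
    define Bad2 where "Bad2 = {T. \<not> balanced k n m t T}"
    have L: "ln (real m) \<ge> 1"
    proof -
      have "exp 1 \<le> real m" using exp_le tm t by linarith
      then show ?thesis using m by (subst ln_ge_iff) auto
    qed
    have "1 * 1 \<le> (real t)\<^sup>2 * real m" using m by (intro mult_mono) auto
    then have tmL: "1 * 1 \<le> (real t)\<^sup>2 * real m * ln (real m)" using L by (intro mult_mono) auto
    have N: "real N \<ge> 576 * (real t)\<^sup>2 * real m * ln (real m)" "real N \<le> 577 * (real t)\<^sup>2 * real m * ln (real m)"
      unfolding N_def using tmL L m by linarith+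
    have "measure_pmf.prob P Bad1 \<le> 2 / sqrt t"
      unfolding P_def Bad1_def
    proof (rule prob_not_well_spread[OF tm _ _ _ _ ln_number_of_columns_le[OF t tm loglog]])
      show "real (card {1..k}) \<le> 577 * (real t)\<^sup>2 * real m * ln (real m)" using N by (simp add: k_def)
      show "577 * (real t)\<^sup>2 * real m * ln (real m) > 0" using tmL by linarith
    qed (use t in \<open>auto simp: k_def\<close>)
    moreover have "measure_pmf.prob P Bad2 \<le> 2 / sqrt t"
    proof (cases "n \<le> N")
      case True
      then have "Bad2 = {}" using balanced_self by (simp add: Bad2_def k_def)
      then show ?thesis by simp
    next
      case nN: False
      have "measure_pmf.prob P Bad2 \<le> 2 / (real m)\<^sup>2"
        unfolding P_def Bad2_def
        by (rule prob_not_balanced) (use nN False t N(1) in \<open>auto simp: k_def\<close>)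
      also have "\<dots> \<le> 2 / sqrt t"
      proof (intro divide_left_mono)
        have "sqrt t \<le> sqrt ((real m)\<^sup>2)" using tm self_le_power[of "real m" 2] m by (intro real_sqrt_le_mono) linarith
        also have "\<dots> \<le> (real m)\<^sup>2" using m by (simp add: self_le_power)
        finally show "sqrt t \<le> (real m)\<^sup>2" .
      qed (use m in auto)
      finally show ?thesis .
    qed
    ultimately have "measure_pmf.prob P (Bad1 \<union> Bad2) \<le> 4 / sqrt t"
      using measure_Un_le[of Bad1 "measure_pmf P" Bad2] by simp
    moreover have "f T \<le> 1250 * sqrt t" if "T \<in> set_pmf P" "T \<notin> Bad1 \<union> Bad2" for T
      unfolding f_def using that m tm
      by (intro disc_rows_le_spread[of t m T n k]) (auto simp: P_def Bad1_def Bad2_def k_def)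
    ultimately show ?thesis by blast
  qed
  then obtain Bad where Bad: "measure_pmf.prob P Bad \<le> 4 / sqrt t"
    "\<And>T. T \<in> set_pmf P \<Longrightarrow> T \<notin> Bad \<Longrightarrow> f T \<le> 1250 * sqrt t" by blast
  have "measure_pmf.expectation P f \<le> measure_pmf.expectation P (\<lambda>T. 1250 * sqrt t + 2 * real t * indicator Bad T)"
  proof (intro integral_mono_AE int, unfold AE_measure_pmf_iff, rule ballI)
    fix T assume T: "T \<in> set_pmf P"
    then have "f T \<le> 2 * real t" unfolding f_def P_def by (intro disc_rows_le_beck_fiala tm m)
    then show "f T \<le> 1250 * sqrt t + 2 * real t * indicator Bad T"
      using Bad(2)[OF T] by (cases "T \<in> Bad") (auto intro: add_increasing)
  qed
  also have "\<dots> = 1250 * sqrt t + 2 * real t * measure_pmf.prob P Bad"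
    using int by simp
  also have "\<dots> \<le> 1250 * sqrt t + 2 * real t * (4 / sqrt t)"
    using Bad(1) by (intro add_left_mono mult_left_mono) auto
  also have "2 * real t * (4 / sqrt t) = 8 * (real t / sqrt t)" by simp
  also have "real t / sqrt t = sqrt t" by (rule real_div_sqrt) simp
  also have "1250 * sqrt t + 8 * sqrt t = 1258 * sqrt t" by simp
  finally show ?thesis by (simp add: f_def [abs_def] P_def)
qed

theorem theorem1:
  "\<exists>C\<^sub>0 C\<^sub>1 :: real. C\<^sub>0 > 0 \<and> C\<^sub>1 > 0 \<and>
     (\<forall>n m t :: nat. n > 0 \<longrightarrow> m > 0 \<longrightarrow> t > 0 \<longrightarrow> t \<le> m \<longrightarrow>
        real t \<ge> C\<^sub>0 * (ln (ln (real m)))\<^sup>2 \<longrightarrow>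
        measure_pmf.expectation (random_set_system n m t)
          (\<lambda>\<S>. real_of_int (disc {1..n} \<S>)) \<le> C\<^sub>1 * sqrt (real t))"
proof (rule exI[of _ 16], rule exI[of _ 1258], intro conjI allI impI)
  fix n m t :: nat
  assume t: "t > 0" "t \<le> m" and loglog: "real t \<ge> 16 * (ln (ln (real m)))\<^sup>2"
  have "measure_pmf.expectation (random_set_system n m t) (\<lambda>\<S>. real_of_int (disc {1..n} \<S>))
    = measure_pmf.expectation (random_incidence n m t) (\<lambda>T. real_of_int (disc {1..n} (rows n T ` {1..m})))"
    by (simp add: random_set_system_def rows_def [abs_def])
  also have "\<dots> \<le> 1258 * sqrt t"
  proof (cases "t \<ge> 65536")
    case True
    then show ?thesis using t loglog by (intro expected_disc_le)
  next
    \<comment> \<open>For bounded \<open>t\<close> the worst-case bound \<open>2 * t\<close> is at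
      most \<open>512 * sqrt t\<close>. This case includes \<open>m = 1\<close>, where
      \<open>ln (ln 1)\<close> is the default value of \<open>ln 0\<close>.\<close>
    case False
    have "measure_pmf.expectation (random_incidence n m t) (\<lambda>T. real_of_int (disc {1..n} (rows n T ` {1..m})))
      \<le> measure_pmf.expectation (random_incidence n m t) (\<lambda>_. 2 * real t)"
      using disc_rows_le_beck_fiala[OF t(2,1)]
      by (intro integral_mono_AE integrable_random_incidence t) (auto simp: AE_measure_pmf_iff)
    also have "\<dots> = 2 * sqrt t * sqrt t" by simp
    also have "\<dots> \<le> 1258 * sqrt t"
    proof (rule mult_right_mono)
      have "sqrt t \<le> 256" using False by (intro real_le_lsqrt) auto
      then show "2 * sqrt t \<le> 1258" by simp
    qed simp
    finally show ?thesis .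
  qed
  finally show "measure_pmf.expectation (random_set_system n m t) (\<lambda>\<S>. real_of_int (disc {1..n} \<S>)) \<le> 1258 * sqrt (real t)" .
qed auto

end
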